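(* Let $\mathbb{K}$ be a field of characteristic $0$, let $S=\mathbb{K}[x_1,\dots,x_l]$ with the standard grading, let $I$ be a homogeneous ideal of $S$ and let $1\le k\le l$. Put $\hat I=I+\langle x_1,\dots,x_l\rangle^{\operatorname{reg}(I)+1}$. Then the following are equivalent: (1) the graded ring $S/I$ has the $k$-SLP; (2) the graded Artinian ring $S/\hat I$ has the $k$-SLP.
   Context: $\operatorname{reg}(I)$ is the Castelnuovo–Mumford regularity of $I$: the maximum of the numbers $d_i-i$, where $d_i=\max\{j\mid\beta_{i,j}(I)\neq0\}$ and $\beta_{i,j}(I)$ are the graded Betti numbers of $I$ as a graded $S$-module (this definition presupposes $I\ne 0$). A linear map is full-rank if it is injective or surjective. A graded ring $R=\bigoplus_{i\ge0}R_i$ over $\mathbb{K}$ with $\dim_{\mathbb{K}}R_i<\infty$ (not necessarily Artinian) has the SLP with Lefschetz element $\ell\in R_1$ if $\times\ell^s\colon R_i\to R_{i+s}$ is full-rank for all $i\ge 0$, $s\ge1$. For $k\ge1$, $R$ has the $k$-SLP if there exist $\ell_1,\dots,\ell_k\in R_1$ such that $R$ has the SLP with Lefschetz element $\ell_1$ and, for all $i=2,\dots,k$, $R/\langle\ell_1,\dots,\ell_{i-1}\rangle$ has the SLP with Lefschetz element (the class of) $\ell_i$. *)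

theory Defs
  imports
    "HOL-Library.Cardinality"
    "HOL-Library.Poly_Mapping"
    "HOL-Algebra.QuotRing"
    "HOL-Algebra.Ideal_Product"
    "HOL-Algebra.Algebraic_Closure_Type"
    "Jordan_Normal_Form.Matrix"
    "Jordan_Normal_Form.Matrix_Kernel"
begin

section \<open>The standard graded polynomial ring\<close>

text \<open>
  A polynomial maps exponent vectors to coefficients. The variables are indexed by a finite
  type \<open>'n\<close>, so that there are \<open>l = CARD('n)\<close> of them.
\<close>

type_synonym ('n, 'k) mpoly = "('n \<Rightarrow>\<^sub>0 nat) \<Rightarrow>\<^sub>0 'k"

definition mpoly_ring :: "('n, 'k::comm_ring_1) mpoly ring" where
  "mpoly_ring = ring_of_type_algebra"

definition variable :: "'n \<Rightarrow> ('n, 'k::comm_ring_1) mpoly" where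
  "variable x = Poly_Mapping.single (Poly_Mapping.single x 1) 1"

definition monomial_degree :: "('n::finite \<Rightarrow>\<^sub>0 nat) \<Rightarrow> nat" where
  "monomial_degree m = (\<Sum>x\<in>UNIV. Poly_Mapping.lookup m x)"

text \<open>The component \<open>S\<^sub>d\<close> of degree \<open>d\<close>; it contains \<open>0\<close> for every \<open>d\<close>.\<close>

definition forms :: "nat \<Rightarrow> ('n::finite, 'k::comm_ring_1) mpoly set" where
  "forms d = {f. \<forall>m\<in>Poly_Mapping.keys f. monomial_degree m = d}"

definition homogeneous_ideal :: "('n::finite, 'k::comm_ring_1) mpoly set \<Rightarrow> bool" where
  "homogeneous_ideal I \<longleftrightarrow> (\<exists>H \<subseteq> (\<Union>d. forms d). I = Idl\<^bsub>mpoly_ring\<^esub> H)"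

definition irrelevant_ideal :: "('n, 'k::comm_ring_1) mpoly set" where
  "irrelevant_ideal = Idl\<^bsub>mpoly_ring\<^esub> (range variable)"


section \<open>Graded Betti numbers and regularity\<close>

text \<open>
  A graded free resolution \<open>\<dots> \<rightarrow> F\<^sub>1 \<rightarrow> F\<^sub>0 \<rightarrow> I \<rightarrow> 0\<close> by modules of finite rank. The module \<open>F\<^sub>i\<close> has
  rank \<open>dim_col (\<phi> i)\<close>, and its \<open>t\<close>-th basis vector has degree \<open>e i t\<close>, i.e. \<open>F\<^sub>i\<close> is the direct
  sum of the \<open>S(-e i t)\<close>. The one-row matrix \<open>\<phi> 0\<close> lists the generators of \<open>I\<close>, and \<open>\<phi> (i + 1)\<close> is
  the matrix of \<open>F\<^sub>i\<^sub>+\<^sub>1 \<rightarrow> F\<^sub>i\<close>. All these maps have degree \<open>0\<close>. The sequence is indexed by all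
  naturals; a finite resolution is continued by modules of rank \<open>0\<close>.
\<close>

definition graded_free_resolution ::
  "('n::finite, 'k::field) mpoly set \<Rightarrow> (nat \<Rightarrow> ('n, 'k) mpoly mat) \<Rightarrow> (nat \<Rightarrow> nat \<Rightarrow> nat) \<Rightarrow> bool"
where
  "graded_free_resolution I \<phi> e \<longleftrightarrow>
     dim_row (\<phi> 0) = 1 \<and>
     (\<forall>i. dim_row (\<phi> (Suc i)) = dim_col (\<phi> i)) \<and>
     (\<forall>t < dim_col (\<phi> 0). \<phi> 0 $$ (0, t) \<in> forms (e 0 t)) \<and>
     (\<forall>i. \<forall>s < dim_col (\<phi> i). \<forall>t < dim_col (\<phi> (Suc i)).
        \<phi> (Suc i) $$ (s, t) = 0 \<or>
        e i s \<le> e (Suc i) t \<and> \<phi> (Suc i) $$ (s, t) \<in> forms (e (Suc i) t - e i s)) \<and>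
     (\<lambda>v. (\<phi> 0 *\<^sub>v v) $ 0) ` carrier_vec (dim_col (\<phi> 0)) = I \<and>
     (\<forall>i. (\<lambda>v. \<phi> (Suc i) *\<^sub>v v) ` carrier_vec (dim_col (\<phi> (Suc i))) = mat_kernel (\<phi> i))"

text \<open>Minimality: the image of \<open>F\<^sub>i\<^sub>+\<^sub>1\<close> lies in \<open>\<langle>x\<^sub>1, \<dots>, x\<^sub>l\<rangle> F\<^sub>i\<close> for all \<open>i\<close>.\<close>

definition minimal_graded_free_resolution ::
  "('n::finite, 'k::field) mpoly set \<Rightarrow> (nat \<Rightarrow> ('n, 'k) mpoly mat) \<Rightarrow> (nat \<Rightarrow> nat \<Rightarrow> nat) \<Rightarrow> bool"
where
  "minimal_graded_free_resolution I \<phi> e \<longleftrightarrow>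
     graded_free_resolution I \<phi> e \<and>
     (\<forall>i. \<forall>s < dim_col (\<phi> i). \<forall>t < dim_col (\<phi> (Suc i)). \<phi> (Suc i) $$ (s, t) \<in> irrelevant_ideal)"

text \<open>
  The number of basis vectors of degree \<open>j\<close> in \<open>F\<^sub>i\<close>. A homogeneous ideal has a minimal graded free
  resolution, unique up to isomorphism of graded complexes, so the choice made here is immaterial.
  Since \<open>I\<close> lives in degrees \<open>\<ge> 0\<close>, so do all these basis vectors, and \<open>j :: nat\<close> loses nothing.
\<close>

definition graded_betti :: "('n::finite, 'k::field) mpoly set \<Rightarrow> nat \<Rightarrow> nat \<Rightarrow> nat" where
  "graded_betti I i j =
     (case (SOME (\<phi>, e). minimal_graded_free_resolution I \<phi> e) of
        (\<phi>, e) \<Rightarrow> card {t. t < dim_col (\<phi> i) \<and> e i t = j})"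

text \<open>
  The maximum of \<open>d\<^sub>i - i\<close>, where \<open>d\<^sub>i\<close> is the largest \<open>j\<close> with \<open>\<beta>\<^sub>i\<^sub>,\<^sub>j \<noteq> 0\<close>; only those \<open>i\<close> count for
  which such \<open>j\<close> exist. Meaningful for \<open>I \<noteq> 0\<close> only (otherwise this is the maximum of the empty
  set); for nonzero homogeneous \<open>I\<close> the value is nonnegative.
\<close>

definition regularity :: "('n::finite, 'k::field) mpoly set \<Rightarrow> int" where
  "regularity I =
     Max {int (Max {j. graded_betti I i j \<noteq> 0}) - int i | i. \<exists>j. graded_betti I i j \<noteq> 0}"


section \<open>Lefschetz properties\<close>

text \<open>
  Here \<open>R\<close> is a graded ring, with component \<open>G d\<close> in degree \<open>d\<close>. In the intended use it is a
  standard graded algebra over a field, so that the components are finite-dimensional.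
\<close>

definition has_SLP :: "('a, 'm) ring_scheme \<Rightarrow> (nat \<Rightarrow> 'a set) \<Rightarrow> 'a \<Rightarrow> bool" where
  "has_SLP R G w \<longleftrightarrow>
     w \<in> G 1 \<and>
     (\<forall>i. \<forall>s\<ge>1. let \<mu> = (\<lambda>x. (w [^]\<^bsub>R\<^esub> (s::nat)) \<otimes>\<^bsub>R\<^esub> x)
                 in inj_on \<mu> (G i) \<or> \<mu> ` G i = G (i + s))"

text \<open>The grading induced on \<open>R Quot J\<close>, for a homogeneous ideal \<open>J\<close>.\<close>

definition quotient_grading ::
  "('a, 'm) ring_scheme \<Rightarrow> 'a set \<Rightarrow> (nat \<Rightarrow> 'a set) \<Rightarrow> nat \<Rightarrow> 'a set set"
where
  "quotient_grading R J G d = (\<lambda>x. J +>\<^bsub>R\<^esub> x) ` G d"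

definition has_k_SLP :: "nat \<Rightarrow> ('a, 'm) ring_scheme \<Rightarrow> (nat \<Rightarrow> 'a set) \<Rightarrow> bool" where
  "has_k_SLP k R G \<longleftrightarrow>
     (\<exists>w :: nat \<Rightarrow> 'a.
        (\<forall>i\<in>{1..k}. w i \<in> G 1) \<and>
        has_SLP R G (w 1) \<and>
        (\<forall>i\<in>{2..k}. let J = Idl\<^bsub>R\<^esub> (w ` {1..i-1})
           in has_SLP (R Quot J) (quotient_grading R J G) (J +>\<^bsub>R\<^esub> w i)))"

text \<open>The ideal \<open>I + \<langle>x\<^sub>1, \<dots>, x\<^sub>l\<rangle>\<^bsup>reg(I)+1\<^esup>\<close>; the power is taken in the semiring of ideals.\<close>

definition ideal_hat :: "('n::finite, 'k::field) mpoly set \<Rightarrow> ('n, 'k) mpoly set" where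
  "ideal_hat I =
     I <+>\<^bsub>mpoly_ring\<^esub> (irrelevant_ideal [^]\<^bsub>ideals_set mpoly_ring\<^esub> nat (regularity I + 1))"

end

(* If w is a linear form that is injective on (S/J)_d for all d >= r, then full rank of the maps
   w^s : (S/J)_i -> (S/J)_(i+s) for i + s <= r implies full rank in all degrees: an injective map
   into degree r stays injective, and a surjective one stays surjective because the graded ring
   S/J is generated in degree 1. So (2) => (1) amounts to choosing the Lefschetz elements well. Full rank in the
   finitely many degrees <= reg I survives small perturbations, by semicontinuity of dimensions
   along a line; hence the l_p can be replaced by generic ones, which form a basis of the linear
   forms and are almost regular on S/I, i.e. injective on S/(I + <l_1, ..., l_(p-1)>) in large
   degrees. The degrees of the generators in a free resolution of I improve "large" to ">= reg I":
   the vanishing of Tor_1(F_j/Z_j, S/<l_1, ..., l_p>), where Z_j is the image of F_(j+1) in F_j,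
   and the injectivity of l_p on F_j/(Z_j + <l_1, ..., l_(p-1)> F_j) control each other along the
   resolution. The same relations give Hilbert's syzygy theorem for the minimal resolution, so
   that reg I is the maximum of a finite set. *)
theory Submission
  imports Defs "HOL-Library.Function_Algebras" "HOL-Computational_Algebra.Polynomial"
begin

text \<open>For (1) => (2) the same forms serve: in S / \<open>ideal_hat I\<close> a map with target
  degree above reg I is onto 0, and up to degree reg I nothing has changed. In the converse
  direction (2) says nothing about the given forms above degree reg I, which is why they are
  replaced. Degree reg I is the pivot through which every map from below to above is factored; the
  truncation has to retain it, hence the exponent reg I + 1. Characteristic 0 enters as infinitude
  of the field: a line of linear forms has to avoid finitely many parameters where a rank drops and
  finitely many proper subspaces of bad forms. Perturbing one form changes all later quotients, so
  ranks of the later maps cannot be compared directly. Full rank itself cures this: it fixes the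
  Hilbert function of the next quotient. Tor does not occur as a functor. Its vanishing and the
  injectivity of a form on a syzygy module are written elementwise in single degrees; the bound on
  the degrees of generators then takes the place of an argument by local cohomology.\<close>

abbreviation single :: "'a \<Rightarrow> 'b \<Rightarrow> 'a \<Rightarrow>\<^sub>0 'b::zero" where
  "single \<equiv> Poly_Mapping.single"

abbreviation keys :: "('a \<Rightarrow>\<^sub>0 'b::zero) \<Rightarrow> 'a set" where
  "keys \<equiv> Poly_Mapping.keys"

abbreviation cst :: "'k \<Rightarrow> ('n, 'k::comm_ring_1) mpoly" where
  "cst \<equiv> single 0"

abbreviation lk :: "('a \<Rightarrow>\<^sub>0 'b::zero) \<Rightarrow> 'a \<Rightarrow> 'b" where
  "lk \<equiv> Poly_Mapping.lookup"

abbreviation mdeg :: "('n::finite \<Rightarrow>\<^sub>0 nat) \<Rightarrow> int" where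
  "mdeg m \<equiv> int (monomial_degree m)"

text \<open>An ideal is a submodule of S over itself: \<open>S.subspace\<close> means ideal and
  \<open>S.span\<close> the ideal generated. The structure \<open>K\<close> below is for dimension
  counts in one degree.\<close>

interpretation S: Modules.module "(*) :: ('n, 'k::comm_ring_1) mpoly \<Rightarrow> _ \<Rightarrow> _"
  by unfold_locales (auto simp: algebra_simps)

text \<open>All free modules of the resolution share the type of functions on \<open>nat\<close>; a
  module of rank n is cut out by \<open>vecs n\<close>. So one scaling and one zero serve every step
  of the complex.\<close>

definition vscale :: "('n, 'k::comm_ring_1) mpoly \<Rightarrow> (nat \<Rightarrow> ('n, 'k) mpoly) \<Rightarrow> nat \<Rightarrow> ('n, 'k) mpoly" where
  "vscale a v = (\<lambda>t. a * v t)"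

definition cscale :: "'k::comm_ring_1 \<Rightarrow> ('n, 'k) mpoly \<Rightarrow> ('n, 'k) mpoly" where
  "cscale c f = cst c * f"

interpretation V: Modules.module vscale
  by (unfold_locales; rule ext)
    (simp_all only: vscale_def plus_fun_apply distrib_left distrib_right mult.assoc mult_1_left)

interpretation K: Vector_Spaces.vector_space "cscale :: 'k::field \<Rightarrow> ('n, 'k) mpoly \<Rightarrow> ('n, 'k) mpoly"
  by unfold_locales (simp_all add: cscale_def distrib_left distrib_right single_add mult_single mult.assoc[symmetric])

section \<open>Homogeneous components\<close>

text \<open>Degrees are integers so that shifts such as d - 1 or d - e need no truncation; in
  negative degrees only 0 remains.\<close>

definition fm :: "int \<Rightarrow> ('n::finite, 'k::comm_ring_1) mpoly set" where
  "fm d = {f. \<forall>m\<in>keys f. mdeg m = d}"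

lemma forms_eq_fm: "forms d = fm (int d)"
  by (auto simp: forms_def fm_def)

lemma fm_negative: "f \<in> fm d \<Longrightarrow> d < 0 \<Longrightarrow> f = 0"
  by (metis (mono_tags, lifting) fm_def keys_eq_empty ex_in_conv mem_Collect_eq of_nat_0_le_iff
      not_less)

lemma mdeg_zero [simp]: "monomial_degree 0 = 0"
  by (simp add: monomial_degree_def)

lemma mdeg_add [simp]: "monomial_degree (m + m') = monomial_degree m + monomial_degree m'"
  by (simp add: monomial_degree_def lookup_add sum.distrib)

lemma mdeg_single [simp]: "monomial_degree (single x a) = a"
proof -
  have "monomial_degree (single x a) = (\<Sum>y\<in>UNIV. if y = x then a else 0)"
    unfolding monomial_degree_def by (rule sum.cong) (auto simp: lookup_single when_def)
  then show ?thesis by simp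
qed

lemma mdeg_eq_0_iff [simp]: "monomial_degree m = 0 \<longleftrightarrow> m = 0"
  by (auto simp: monomial_degree_def poly_mapping_eq_iff fun_eq_iff)

lemma fm_zero [simp]: "0 \<in> fm d"
  by (simp add: fm_def)

lemma fm_add: "f \<in> fm d \<Longrightarrow> g \<in> fm d \<Longrightarrow> f + g \<in> fm d"
  using keys_add[of f g] by (auto simp: fm_def)

lemma fm_uminus: "f \<in> fm d \<Longrightarrow> - f \<in> fm d"
  by (auto simp: fm_def in_keys_iff)

lemma fm_diff: "f \<in> fm d \<Longrightarrow> g \<in> fm d \<Longrightarrow> f - g \<in> fm d"
  by (metis fm_add fm_uminus diff_conv_add_uminus)

lemma fm_sum: "(\<And>i. i \<in> A \<Longrightarrow> f i \<in> fm d) \<Longrightarrow> sum f A \<in> fm d"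
  by (induction A rule: infinite_finite_induct) (auto intro: fm_add)

lemma fm_mult: "f \<in> fm d \<Longrightarrow> g \<in> fm e \<Longrightarrow> f * g \<in> fm (d + e)"
  using keys_mult[of f g] by (fastforce simp: fm_def)

lemma fm_cst [simp]: "cst c \<in> fm 0"
  by (simp add: fm_def)

lemma fm_scale: "f \<in> fm d \<Longrightarrow> cst c * f \<in> fm d"
  using fm_mult[OF fm_cst[of c], of f d] by simp

lemma fm_one [simp]: "1 \<in> fm 0"
  by (simp add: fm_def)

lemma fm_power: "f \<in> fm d \<Longrightarrow> f ^ n \<in> fm (int n * d)"
  by (induction n) (auto dest: fm_mult simp: algebra_simps)

lemma fm_single [simp]: "mdeg m = d \<Longrightarrow> single m c \<in> fm d"
  by (simp add: fm_def)

lemma fm_variable [simp]: "variable x \<in> fm 1"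
  by (simp add: variable_def)

lemma subspace_K_fm: "K.subspace (fm d)"
  by (auto intro!: K.subspaceI fm_add fm_scale simp: cscale_def)

section \<open>Projections to homogeneous components\<close>

lift_definition hcomp :: "int \<Rightarrow> ('n::finite, 'k::comm_ring_1) mpoly \<Rightarrow> ('n, 'k) mpoly" is
  "\<lambda>d f m. if mdeg m = d then f m else 0"
proof -
  fix d and f :: "('n \<Rightarrow>\<^sub>0 nat) \<Rightarrow> 'k"
  assume "finite {x. f x \<noteq> 0}"
  then show "finite {x. (if mdeg x = d then f x else 0) \<noteq> 0}"
    by (rule rev_finite_subset) auto
qed

lemma keys_hcomp: "keys (hcomp d f) = {m \<in> keys f. mdeg m = d}"
  by (auto simp: in_keys_iff hcomp.rep_eq split: if_splits)

lemma hcomp_in_fm [simp]: "hcomp d f \<in> fm d"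
  by (simp add: fm_def keys_hcomp)

lemma hcomp_zero [simp]: "hcomp d 0 = 0"
  by (simp add: poly_mapping_eq_iff fun_eq_iff hcomp.rep_eq)

lemma hcomp_add: "hcomp d (f + g) = hcomp d f + hcomp d g"
  by (simp add: poly_mapping_eq_iff fun_eq_iff hcomp.rep_eq lookup_add)

lemma hcomp_diff: "hcomp d (f - g) = hcomp d f - hcomp d g"
  by (simp add: poly_mapping_eq_iff fun_eq_iff hcomp.rep_eq lookup_minus)

lemma hcomp_sum: "hcomp d (sum f A) = (\<Sum>i\<in>A. hcomp d (f i))"
  by (induction A rule: infinite_finite_induct) (auto simp: hcomp_add)

lemma hcomp_fm: "f \<in> fm e \<Longrightarrow> hcomp d f = (if d = e then f else 0)"
  by (auto simp: poly_mapping_eq_iff fun_eq_iff hcomp.rep_eq fm_def in_keys_iff)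

lemma sum_hcomp:
  assumes "finite D" "mdeg ` keys f \<subseteq> D"
  shows "f = (\<Sum>d\<in>D. hcomp d f)"
proof -
  have "lk f m = (\<Sum>d\<in>D. if mdeg m = d then lk f m else 0)" for m
    using assms by (cases "m \<in> keys f") (auto simp: in_keys_iff)
  then show ?thesis
    by (simp add: poly_mapping_eq_iff fun_eq_iff hcomp.rep_eq lookup_sum)
qed

lemma hcomp_mult:
  assumes "g \<in> fm e"
  shows "hcomp d (f * g) = hcomp (d - e) f * g"
proof -
  let ?D = "insert (d - e) (mdeg ` keys f)"
  have f: "f = (\<Sum>c\<in>?D. hcomp c f)"
    by (rule sum_hcomp) auto
  have "f * g = (\<Sum>c\<in>?D. hcomp c f * g)"
    by (subst f) (simp only: sum_distrib_right)
  then have "hcomp d (f * g) = (\<Sum>c\<in>?D. hcomp d (hcomp c f * g))"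
    by (simp only: hcomp_sum)
  also have "\<dots> = (\<Sum>c\<in>?D. if c = d - e then hcomp (d - e) f * g else 0)"
  proof (rule sum.cong)
    fix c
    show "hcomp d (hcomp c f * g) = (if c = d - e then hcomp (d - e) f * g else 0)"
      using hcomp_fm[OF fm_mult[OF hcomp_in_fm[of c f] assms], of d] by auto
  qed simp
  finally show ?thesis by simp
qed

lemma hcomp_mult':
  assumes "g \<in> fm e"
  shows "hcomp d (g * f) = g * hcomp (d - e) f"
  using hcomp_mult[OF assms, of d f] by (simp add: mult.commute)

lemma sum_singles:
  assumes "finite A" "keys f \<subseteq> A"
  shows "f = (\<Sum>m\<in>A. single m (lk f m))"
proof -
  have "lk f m = (\<Sum>m'\<in>A. if m' = m then lk f m else 0)" for m
    using assms by (cases "m \<in> keys f") (auto simp: in_keys_iff)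
  moreover have "lk (single m' (lk f m')) m = (if m' = m then lk f m else 0)" for m m'
    by (auto simp: lookup_single when_def)
  ultimately show ?thesis
    by (simp add: poly_mapping_eq_iff fun_eq_iff lookup_sum)
qed

lemma mpoly_induct [case_names zero single add]:
  fixes f :: "('n, 'k::comm_ring_1) mpoly"
  assumes "P 0" "\<And>m c. P (single m c)" "\<And>f g. P f \<Longrightarrow> P g \<Longrightarrow> P (f + g)"
  shows "P f"
proof -
  have "P (\<Sum>m\<in>A. single m (lk f m))" for A
    by (induction A rule: infinite_finite_induct) (auto intro: assms)
  then show ?thesis
    by (metis sum_singles finite_keys order_refl)
qed

lemma lookup_mult_single:
  fixes f :: "('n, 'k::comm_ring_1) mpoly"
  shows "lk (single m c * f) (m + m') = c * lk f m'"
proof (induction f rule: mpoly_induct)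
  case (single m1 c1)
  have "m + m1 = m + m' \<longleftrightarrow> m1 = m'" by simp
  then show ?case by (simp only: mult_single lookup_single when_def) simp
qed (simp_all add: distrib_left lookup_add)

lemma lookup_cst_mult [simp]:
  fixes f :: "('n, 'k::comm_ring_1) mpoly"
  shows "lk (cst c * f) m = c * lk f m"
  using lookup_mult_single[of 0 c f m] by simp

text \<open>Exponents are natural numbers, so only 0 + 0 gives 0. The constant term is the later
  test for membership in the irrelevant ideal.\<close>

lemma lookup_mult_0 [simp]:
  fixes f g :: "('n, 'k::comm_ring_1) mpoly"
  shows "lk (f * g) 0 = lk f 0 * lk g 0"
proof (induction f rule: mpoly_induct)
  case (single m c)
  show ?case
  proof (induction g rule: mpoly_induct)
    case (single m' c')
    have "m + m' = 0 \<longleftrightarrow> m = 0 \<and> m' = 0"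
      by (auto simp: poly_mapping_eq_iff fun_eq_iff lookup_add)
    then show ?case by (cases "m = 0"; cases "m' = 0") (simp_all add: mult_single lookup_single when_def)
  qed (auto simp: algebra_simps lookup_add)
qed (auto simp: algebra_simps lookup_add)

lemma fm_0_eq: "f \<in> fm 0 \<Longrightarrow> f = cst (lk f 0)"
  by (rule poly_mapping_eqI) (auto simp: fm_def in_keys_iff lookup_single when_def)

lemma lookup_0_fm: "f \<in> fm d \<Longrightarrow> d \<noteq> 0 \<Longrightarrow> lk f 0 = 0"
  by (auto simp: fm_def in_keys_iff)

lemma lookup_hcomp: "lk (hcomp d f) m = (if mdeg m = d then lk f m else 0)"
  by (simp add: hcomp.rep_eq)

section \<open>Homogeneous ideals\<close>

text \<open>Homogeneity in the form used throughout, closure under components;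
  \<open>hom_ideal_span_homogeneous\<close> obtains it from homogeneous generators.\<close>

definition hom_ideal :: "('n::finite, 'k::comm_ring_1) mpoly set \<Rightarrow> bool" where
  "hom_ideal J \<longleftrightarrow> S.subspace J \<and> (\<forall>f\<in>J. \<forall>d. hcomp d f \<in> J)"

lemma hom_idealD:
  assumes "hom_ideal J"
  shows "0 \<in> J" "f \<in> J \<Longrightarrow> g \<in> J \<Longrightarrow> f + g \<in> J" "f \<in> J \<Longrightarrow> g \<in> J \<Longrightarrow> f - g \<in> J"
    "f \<in> J \<Longrightarrow> a * f \<in> J" "f \<in> J \<Longrightarrow> f * a \<in> J" "f \<in> J \<Longrightarrow> hcomp d f \<in> J"
    "S.subspace J"
  using assms unfolding hom_ideal_def
  by (auto intro: S.subspace_0 S.subspace_add S.subspace_diff S.subspace_scale simp: mult.commute)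

lemma hom_ideal_span: "hom_ideal J \<Longrightarrow> S.span J = J"
  by (simp add: hom_ideal_def)

lemma subspace_S_K: "S.subspace J \<Longrightarrow> K.subspace J"
  by (auto intro!: K.subspaceI S.subspace_0 S.subspace_add S.subspace_scale simp: cscale_def)

lemma hom_ideal_insert:
  assumes "hom_ideal J" "w \<in> fm e"
  shows "hom_ideal (S.span (insert w J))"
proof -
  have "hcomp d f \<in> S.span (insert w J)" if f: "f \<in> S.span (insert w J)" for f d
  proof -
    obtain k where k: "f - k * w \<in> J"
      using f S.span_breakdown_eq[of f w J] hom_ideal_span[OF assms(1)] by auto
    have "hcomp d f - hcomp (d - e) k * w \<in> J"
      using hom_idealD(6)[OF assms(1) k, of d] by (simp add: hcomp_diff hcomp_mult[OF assms(2)])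
    then show ?thesis
      using S.span_breakdown_eq[of "hcomp d f" w J] hom_ideal_span[OF assms(1)]
      by auto
  qed
  then show ?thesis by (simp add: hom_ideal_def)
qed

text \<open>Taking the component of degree d in a relation f - k * w shows that the cofactor of w
  may be chosen homogeneous.\<close>

lemma hom_ideal_insert_fm:
  assumes J: "hom_ideal J" and w: "w \<in> fm e" and f: "f \<in> fm d"
  shows "f \<in> S.span (insert w J) \<longleftrightarrow> (\<exists>k\<in>fm (d - e). f - k * w \<in> J)"
proof
  assume "f \<in> S.span (insert w J)"
  then obtain k where k: "f - k * w \<in> J"
    using S.span_breakdown_eq[of f w J] hom_ideal_span[OF J] by auto
  have "f - hcomp (d - e) k * w \<in> J"
    using hom_idealD(6)[OF J k, of d] f by (simp add: hcomp_diff hcomp_mult[OF w] hcomp_fm)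
  then show "\<exists>k\<in>fm (d - e). f - k * w \<in> J"
    using hcomp_in_fm by blast
next
  assume "\<exists>k\<in>fm (d - e). f - k * w \<in> J"
  then show "f \<in> S.span (insert w J)"
    using S.span_breakdown_eq[of f w J] hom_ideal_span[OF J] by auto
qed

lemma S_span_Un_insert: "S.span (insert w (S.span (I \<union> A))) = S.span (I \<union> insert w A)"
  by (auto simp: S.span_eq intro: S.span_base subsetD[OF S.span_mono, of "I \<union> A"])
   
lemma hom_ideal_span_Un:
  assumes "hom_ideal J" "finite A" "A \<subseteq> fm e"
  shows "hom_ideal (S.span (J \<union> A))"
  using assms(2,3)
proof (induction A)
  case empty
  then show ?case using assms(1) by (metis hom_ideal_span sup_bot_right)
next
  case (insert w A)
  then show ?case
    using hom_ideal_insert[of "S.span (J \<union> A)" w e] by (simp add: S_span_Un_insert)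
qed

section \<open>Linear forms acting on an exact complex\<close>

definition is_subgroup :: "'a::ab_group_add set \<Rightarrow> bool" where
  "is_subgroup A \<longleftrightarrow> 0 \<in> A \<and> (\<forall>x\<in>A. \<forall>y\<in>A. x - y \<in> A)"

lemma is_subgroupD:
  assumes "is_subgroup A"
  shows "0 \<in> A" "x \<in> A \<Longrightarrow> y \<in> A \<Longrightarrow> x - y \<in> A" "x \<in> A \<Longrightarrow> y \<in> A \<Longrightarrow> x + y \<in> A"
proof -
  show "0 \<in> A" using assms by (simp add: is_subgroup_def)
  show "x - y \<in> A" if "x \<in> A" "y \<in> A" for x y using assms that by (simp add: is_subgroup_def)
  then have "x - (0 - y) \<in> A" if "x \<in> A" "y \<in> A" for x y using that \<open>0 \<in> A\<close> by blast
  then show "x \<in> A \<Longrightarrow> y \<in> A \<Longrightarrow> x + y \<in> A" by fastforce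
qed

text \<open>The set T 0 A + ... + T (p-1) A. With A the part of degree d - 1 of a graded module M
  this is the part of degree d of \<langle>T 0, ..., T (p-1)\<rangle> M.\<close>

primrec lin_comb :: "(nat \<Rightarrow> 'a \<Rightarrow> 'a) \<Rightarrow> nat \<Rightarrow> 'a::ab_group_add set \<Rightarrow> 'a set" where
  "lin_comb T 0 A = {0}"
| "lin_comb T (Suc p) A = {a + T p f |a f. a \<in> lin_comb T p A \<and> f \<in> A}"

lemma lin_comb_mono: "A \<subseteq> B \<Longrightarrow> lin_comb T p A \<subseteq> lin_comb T p B"
  by (induction p) auto

lemma lin_comb_hom:
  assumes "\<And>x y. f (x - y) = f x - (f y :: 'b::ab_group_add)" and "\<And>i x. f (T i x) = Y i (f x)"
  shows "f ` lin_comb T p A = lin_comb Y p (f ` A)"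
proof (induction p)
  have f0: "f 0 = 0" using assms(1)[of 0 0] by simp
  have f_add: "f (x + y) = f x + f y" for x y
    using assms(1)[of x "0 - y"] assms(1)[of 0 y] f0 by simp
  case 0
  then show ?case by (simp add: f0)
  case (Suc p)
  have "f ` lin_comb T (Suc p) A = {a + Y p g |a g. a \<in> f ` lin_comb T p A \<and> g \<in> f ` A}"
  proof (intro subset_antisym subsetI)
    fix x assume "x \<in> {a + Y p g |a g. a \<in> f ` lin_comb T p A \<and> g \<in> f ` A}"
    then obtain a b where ab: "x = f a + Y p (f b)" "a \<in> lin_comb T p A" "b \<in> A" by blast
    then have "x = f (a + T p b)" by (simp add: f_add assms(2))
    then show "x \<in> f ` lin_comb T (Suc p) A" using ab by auto
  next
    fix x assume "x \<in> f ` lin_comb T (Suc p) A"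
    then obtain a g where "a \<in> lin_comb T p A" "g \<in> A" "x = f a + Y p (f g)"
      by (auto simp: f_add assms(2))
    then show "x \<in> {a + Y p g |a g. a \<in> f ` lin_comb T p A \<and> g \<in> f ` A}" by blast
  qed
  then show ?case by (simp add: Suc)
qed

text \<open>\<open>F 0\<close> is meant to be S itself and \<open>F (Suc j)\<close> the j-th module
  of a resolution of the ideal, so that \<open>F 0\<close> modulo the image of
  \<open>\<Phi> 0\<close> is S/I, and exactness starts at \<open>F 1\<close>. By
  \<open>regular\<close>, the maps \<open>T 0\<close>, ..., \<open>T (l-1)\<close> form a regular
  sequence on every \<open>F j\<close>, degree by degree.\<close>

locale graded_complex =
  fixes F :: "nat \<Rightarrow> int \<Rightarrow> 'a::ab_group_add set" and T \<Phi> :: "nat \<Rightarrow> 'a \<Rightarrow> 'a" and l :: nat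
  assumes F_sub: "is_subgroup (F j d)"
    and T_diff: "T i (x - y) = T i x - T i y"
    and T_F: "x \<in> F j d \<Longrightarrow> T i x \<in> F j (d + 1)"
    and T_comm: "T i (T i' x) = T i' (T i x)"
    and \<Phi>_diff: "\<Phi> j (x - y) = \<Phi> j x - \<Phi> j y"
    and \<Phi>_F: "x \<in> F (Suc j) d \<Longrightarrow> \<Phi> j x \<in> F j d"
    and \<Phi>_T: "\<Phi> j (T i x) = T i (\<Phi> j x)"
    and exact: "x \<in> F (Suc j) d \<Longrightarrow> \<Phi> j x = 0 \<Longrightarrow> x \<in> \<Phi> (Suc j) ` F (Suc (Suc j)) d"
    and complex: "y \<in> F (Suc (Suc j)) d \<Longrightarrow> \<Phi> j (\<Phi> (Suc j) y) = 0"
    and regular: "p < l \<Longrightarrow> z \<in> F j d \<Longrightarrow> T p z \<in> lin_comb T p (F j d) \<Longrightarrow>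
      z \<in> lin_comb T p (F j (d - 1))"
begin

lemma T_0: "T i 0 = 0" using T_diff[of i 0 0] by simp
lemma \<Phi>_0: "\<Phi> i 0 = 0" using \<Phi>_diff[of i 0 0] by simp
lemma T_add: "T i (x + y) = T i x + T i y"
  using T_diff[of i x "0 - y"] T_diff[of i 0 y] T_0 by simp
lemma \<Phi>_add: "\<Phi> i (x + y) = \<Phi> i x + \<Phi> i y"
  using \<Phi>_diff[of i x "0 - y"] \<Phi>_diff[of i 0 y] \<Phi>_0 by simp

definition Z :: "nat \<Rightarrow> int \<Rightarrow> 'a set" where "Z j d = \<Phi> j ` F (Suc j) d"

lemma Z_sub: "is_subgroup (Z j d)"
  unfolding is_subgroup_def Z_def
  using is_subgroupD[OF F_sub[of "Suc j" d]] by (auto simp: \<Phi>_diff[symmetric] image_iff) (metis \<Phi>_0)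

lemma T_Z: "y \<in> Z j d \<Longrightarrow> T i y \<in> Z j (d + 1)"
  unfolding Z_def using T_F by (auto simp: \<Phi>_T[symmetric])

lemma lin_comb_sub:
  assumes "is_subgroup A"
  shows "is_subgroup (lin_comb T p A)"
proof (induction p)
  case (Suc p)
  note 1 = is_subgroupD[OF Suc] is_subgroupD[OF assms]
  have "a + T p f - (a' + T p f') = (a - a') + T p (f - f')" for a a' f f'
    by (simp add: T_diff)
  moreover have "0 = 0 + T p 0" by (simp add: T_0)
  ultimately show ?case unfolding is_subgroup_def lin_comb.simps using 1(1,2,4,5) by blast
qed (auto simp: is_subgroup_def)

lemmas L_sub = lin_comb_sub[OF F_sub]

lemma T_L: "a \<in> lin_comb T p (F j d) \<Longrightarrow> T i a \<in> lin_comb T p (F j (d + 1))"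
proof -
  assume "a \<in> lin_comb T p (F j d)"
  then have "T i a \<in> lin_comb T p (T i ` F j d)"
    using lin_comb_hom[of "T i" T T p "F j d"] by (auto simp: T_diff T_comm)
  then show ?thesis
    using lin_comb_mono[of "T i ` F j d" "F j (d + 1)"] T_F by blast
qed

lemma \<Phi>_L: "\<Phi> j ` lin_comb T p A = lin_comb T p (\<Phi> j ` A)"
  by (rule lin_comb_hom) (auto simp: \<Phi>_diff \<Phi>_T)

text \<open>\<open>I j p d\<close> says that \<open>Tor\<^sub>1 (F j / Z j, S / \<langle>T 0, \<dots>, T (p-1)\<rangle>)\<close> vanishes in degree \<open>d\<close>, and
  \<open>C j p d\<close> that \<open>T p\<close> is injective on \<open>F j / (Z j + \<langle>T 0, \<dots>, T (p-1)\<rangle> F j)\<close> in degree \<open>d\<close>.\<close>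

definition I :: "nat \<Rightarrow> nat \<Rightarrow> int \<Rightarrow> bool" where
  "I j p d \<longleftrightarrow> Z j d \<inter> lin_comb T p (F j (d - 1)) \<subseteq> lin_comb T p (Z j (d - 1))"

definition C :: "nat \<Rightarrow> nat \<Rightarrow> int \<Rightarrow> bool" where
  "C j p d \<longleftrightarrow> (\<forall>z\<in>F j d. \<forall>y\<in>Z j (d + 1). \<forall>a\<in>lin_comb T p (F j d). T p z = y + a \<longrightarrow>
     (\<exists>y'\<in>Z j d. \<exists>a'\<in>lin_comb T p (F j (d - 1)). z = y' + a'))"

lemma CD:
  assumes "C j p d" "z \<in> F j d" "y \<in> Z j (d + 1)" "a \<in> lin_comb T p (F j d)" "T p z = y + a"
  obtains y' a' where "y' \<in> Z j d" "a' \<in> lin_comb T p (F j (d - 1))" "z = y' + a'"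
  using assms unfolding C_def by blast

lemma I_0: "I j 0 d"
  by (auto simp: I_def)

text \<open>A piece of the long exact Tor sequence for multiplication by \<open>T p\<close>: the Tor
  for p + 1 forms lies between the Tor for p forms and the kernel of \<open>T p\<close> on
  \<open>F j / Z j\<close> modulo the first p forms.\<close>

lemma I_Suc:
  assumes "I j p (d + 1)" "C j p d"
  shows "I j (Suc p) (d + 1)"
  unfolding I_def
proof safe
  fix z assume z: "z \<in> Z j (d + 1)" "z \<in> lin_comb T (Suc p) (F j (d + 1 - 1))"
  then obtain a f where af: "z = a + T p f" "a \<in> lin_comb T p (F j d)" "f \<in> F j d" by auto
  have "T p f = z + (0 - a)" "0 - a \<in> lin_comb T p (F j d)"
    using af is_subgroupD(2)[OF L_sub is_subgroupD(1)[OF L_sub]] by auto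
  then obtain y b where yb: "y \<in> Z j d" "b \<in> lin_comb T p (F j (d - 1))" "f = y + b"
    using CD[OF assms(2) af(3) z(1)] by blast
  have "T p b \<in> lin_comb T p (F j d)" using T_L[OF yb(2), of p] by simp
  then have "a + T p b \<in> lin_comb T p (F j d)"
    using af(2) is_subgroupD(3)[OF L_sub] by blast
  moreover have "a + T p b = z - T p y" by (simp add: af yb T_add)
  moreover have "z - T p y \<in> Z j (d + 1)"
    using z(1) T_Z[OF yb(1)] is_subgroupD(2)[OF Z_sub] by blast
  ultimately have "z - T p y \<in> lin_comb T p (Z j d)"
    using assms(1) unfolding I_def by auto
  then have "\<exists>a f. z = a + T p f \<and> a \<in> lin_comb T p (Z j d) \<and> f \<in> Z j d"
    using yb(1) by (metis diff_add_cancel)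
  then show "z \<in> lin_comb T (Suc p) (Z j (d + 1 - 1))" by simp
qed

text \<open>\<open>F (Suc j) / Z (Suc j)\<close> is isomorphic to \<open>Z j\<close>. Vanishing of
  Tor means that \<open>Z j\<close> modulo the first p forms embeds into \<open>F j\<close> modulo
  these forms, where \<open>T p\<close> is injective by \<open>regular\<close>.\<close>

lemma C_Suc:
  assumes "I j p d" "p < l"
  shows "C (Suc j) p d"
  unfolding C_def
proof (intro ballI impI)
  fix z y a assume z: "z \<in> F (Suc j) d" and y: "y \<in> Z (Suc j) (d + 1)"
    and a: "a \<in> lin_comb T p (F (Suc j) d)" and eq: "T p z = y + a"
  have "\<Phi> j y = 0" using y complex by (auto simp: Z_def)
  then have "T p (\<Phi> j z) = \<Phi> j a" by (metis eq \<Phi>_T \<Phi>_add add_0)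
  moreover have "\<Phi> j a \<in> lin_comb T p (\<Phi> j ` F (Suc j) d)"
    using a \<Phi>_L by blast
  then have "\<Phi> j a \<in> lin_comb T p (F j d)"
    using lin_comb_mono[of "\<Phi> j ` F (Suc j) d" "F j d" T p] \<Phi>_F by blast
  ultimately have "\<Phi> j z \<in> lin_comb T p (F j (d - 1))"
    using regular[OF assms(2) \<Phi>_F[OF z]] by simp
  then have "\<Phi> j z \<in> lin_comb T p (Z j (d - 1))"
    using assms(1) z unfolding I_def Z_def by blast
  then obtain b where b: "b \<in> lin_comb T p (F (Suc j) (d - 1))" "\<Phi> j z = \<Phi> j b"
    unfolding Z_def \<Phi>_L[symmetric] by blast
  have "b \<in> F (Suc j) d"
  proof -
    have "lin_comb T q (F (Suc j) (d - 1)) \<subseteq> F (Suc j) d" for q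
      using T_F[of _ "Suc j" "d - 1"] by (induction q) (auto intro: is_subgroupD[OF F_sub])
    then show ?thesis using b by blast
  qed
  then have "z - b \<in> F (Suc j) d" using z is_subgroupD[OF F_sub] by blast
  moreover have "\<Phi> j (z - b) = 0" using b by (simp add: \<Phi>_diff)
  ultimately have "z - b \<in> Z (Suc j) d" using exact unfolding Z_def by blast
  then show "\<exists>y'\<in>Z (Suc j) d. \<exists>a'\<in>lin_comb T p (F (Suc j) (d - 1)). z = y' + a'"
    using b(1) by (metis diff_add_cancel)
qed

text \<open>By \<open>\<Phi>_L\<close> the hypothesis puts y into the combinations of
  \<open>T 0\<close>, ..., \<open>T p\<close> over \<open>Z j\<close>. Its \<open>T p\<close>-part
  can be moved to the side of z, and \<open>regular\<close> applies to what is left.\<close>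

lemma C_of_decomposition:
  assumes "p < l"
    and decomp: "\<And>z y a. z \<in> F j d \<Longrightarrow> y \<in> Z j (d + 1) \<Longrightarrow> a \<in> lin_comb T p (F j d) \<Longrightarrow>
      T p z = y + a \<Longrightarrow> y \<in> \<Phi> j ` lin_comb T (Suc p) (F (Suc j) d)"
  shows "C j p d"
  unfolding C_def
proof (intro ballI impI)
  fix z y a assume z: "z \<in> F j d" and y: "y \<in> Z j (d + 1)"
    and a: "a \<in> lin_comb T p (F j d)" and eq: "T p z = y + a"
  obtain b f where bf: "y = \<Phi> j (b + T p f)" "b \<in> lin_comb T p (F (Suc j) d)" "f \<in> F (Suc j) d"
    using decomp[OF z y a eq] by auto
  have "T p (z - \<Phi> j f) = \<Phi> j b + a"
    by (simp add: T_diff eq bf(1) \<Phi>_add \<Phi>_T)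
  moreover have "\<Phi> j b \<in> lin_comb T p (F j d)"
    using bf(2) \<Phi>_L[of j p "F (Suc j) d"] lin_comb_mono[of "\<Phi> j ` F (Suc j) d" "F j d" T p] \<Phi>_F
    by blast
  ultimately have "T p (z - \<Phi> j f) \<in> lin_comb T p (F j d)"
    using a is_subgroupD(3)[OF L_sub] by simp
  moreover have "z - \<Phi> j f \<in> F j d"
    using z \<Phi>_F[OF bf(3)] is_subgroupD(2)[OF F_sub] by blast
  ultimately have "z - \<Phi> j f \<in> lin_comb T p (F j (d - 1))"
    using regular[OF assms(1)] by blast
  moreover have "\<Phi> j f \<in> Z j d" using bf(3) by (simp add: Z_def)
  ultimately show "\<exists>y'\<in>Z j d. \<exists>a'\<in>lin_comb T p (F j (d - 1)). z = y' + a'"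
    by (metis add_diff_cancel_left' add.commute diff_add_cancel)
qed

text \<open>Injectivity descends by one degree. Multiplying the relation for z by the next form
  reaches degree d + 1, where \<open>T p\<close> is already injective; two ways of writing the
  product express \<open>T (Suc p) y\<close> through \<open>T 0\<close>, ..., \<open>T p\<close>
  over \<open>Z j\<close>. The condition on \<open>Suc j\<close> then cancels
  \<open>T (Suc p)\<close>.\<close>

lemma C_step:
  assumes "Suc p < l" "I j p (d + 2)" "C (Suc j) (Suc p) (d + 1)" "C j p (d + 1)"
  shows "C j p d"
proof (rule C_of_decomposition)
  fix z y a assume z: "z \<in> F j d" and y: "y \<in> Z j (d + 1)"
    and a: "a \<in> lin_comb T p (F j d)" and eq: "T p z = y + a"
  let ?q = "Suc p"
  have y_q: "T ?q y \<in> Z j (d + 2)" using T_Z[OF y, of ?q] by (simp add: add.assoc)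
  have a_q: "T ?q a \<in> lin_comb T p (F j (d + 1))" using T_L[OF a] .
  have "T p (T ?q z) = T ?q y + T ?q a"
    by (metis T_comm eq T_add)
  moreover have "T ?q y \<in> Z j (d + 1 + 1)" using y_q by (simp add: add.assoc)
  ultimately obtain y' a' where y': "y' \<in> Z j (d + 1)" and a': "a' \<in> lin_comb T p (F j d)"
    and eq': "T ?q z = y' + a'"
    using CD[OF assms(4) T_F[OF z, of ?q] _ a_q] by (metis add_diff_cancel_right')
  \<comment> \<open>Both sides are \<open>T p (T ?q z)\<close>: the relation for z multiplied by
    \<open>T ?q\<close>, and the new relation multiplied by \<open>T p\<close>.\<close>
  have "T ?q y + T ?q a = T p y' + T p a'"
    by (metis T_comm eq eq' T_add)
  then have e1: "T ?q y - T p y' = T p a' - T ?q a"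
    by (simp add: algebra_simps)
  have "T p a' - T ?q a \<in> lin_comb T p (F j (d + 1))"
    using T_L[OF a'] a_q is_subgroupD(2)[OF L_sub] by blast
  moreover have "T p y' \<in> Z j (d + 2)" using T_Z[OF y', of p] by (simp add: add.assoc)
  then have "T ?q y - T p y' \<in> Z j (d + 2)"
    using y_q is_subgroupD(2)[OF Z_sub] by blast
  moreover have "d + 2 - 1 = d + 1" by simp
  ultimately have "T ?q y - T p y' \<in> lin_comb T p (Z j (d + 1))"
    using assms(2) e1 unfolding I_def by (metis IntI subsetD)
  then obtain c where c: "c \<in> lin_comb T p (F (Suc j) (d + 1))" "T ?q y - T p y' = \<Phi> j c"
    unfolding Z_def \<Phi>_L[symmetric] by blast
  obtain u u' where u: "u \<in> F (Suc j) (d + 1)" "y = \<Phi> j u" and u': "u' \<in> F (Suc j) (d + 1)" "y' = \<Phi> j u'"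
    using y y' unfolding Z_def by blast
  define b where "b = c + T p u'"
  have b: "b \<in> lin_comb T ?q (F (Suc j) (d + 1))"
    using c u' by (auto simp: b_def)
  have "\<Phi> j (T ?q u - b) = 0"
    using c(2) u u' by (simp add: \<Phi>_diff \<Phi>_add \<Phi>_T b_def algebra_simps)
  moreover have "T ?q u - b \<in> F (Suc j) (d + 1 + 1)"
  proof -
    have "lin_comb T q (F (Suc j) (d + 1)) \<subseteq> F (Suc j) (d + 1 + 1)" for q
      using T_F[of _ "Suc j" "d + 1"] by (induction q) (auto intro: is_subgroupD[OF F_sub])
    then show ?thesis using b T_F[OF u(1), of ?q] is_subgroupD(2)[OF F_sub] by blast
  qed
  ultimately have "T ?q u - b \<in> Z (Suc j) (d + 1 + 1)"
    using exact unfolding Z_def by blast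
  moreover have "T ?q u = (T ?q u - b) + b" by simp
  ultimately obtain y2 b2 where y2: "y2 \<in> Z (Suc j) (d + 1)"
    and b2: "b2 \<in> lin_comb T ?q (F (Suc j) d)" and eq2: "u = y2 + b2"
    using CD[OF assms(3) u(1) _ b] by (metis add_diff_cancel_right')
  have "\<Phi> j y2 = 0" using y2 complex by (auto simp: Z_def)
  then have "y = \<Phi> j b2" using u(2) eq2 by (simp add: \<Phi>_add)
  then show "y \<in> \<Phi> j ` lin_comb T (Suc p) (F (Suc j) d)" using b2 by blast
qed (use assms in auto)

text \<open>\<open>F j / Z j\<close> is a j-th syzygy module of \<open>F 0 / Z 0\<close>, so this is
  the vanishing of its Tor in index j + 1 against a Koszul complex of length p. Each further form
  costs one step of the resolution, by \<open>C_Suc\<close> and \<open>I_Suc\<close>.\<close>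

lemma I_le: "p \<le> j \<Longrightarrow> p \<le> l \<Longrightarrow> I j p d"
proof (induction p arbitrary: j d)
  case (Suc p j d)
  obtain j' where j: "j = Suc j'" using Suc.prems by (cases j) auto
  have "C j p (d - 1)" unfolding j using Suc by (intro C_Suc) (auto simp: j)
  then show ?case using I_Suc[of j p "d - 1"] Suc by simp
qed (simp add: I_0)

text \<open>Serre-type vanishing in large degrees is improved to the sharp bound by descending on
  \<open>d - j\<close>, and on \<open>p\<close> for a fixed value of \<open>d - j\<close>.\<close>

theorem C_of_generator_degrees:
  assumes gen: "\<And>j d. d > r + int j \<Longrightarrow> F (Suc j) d \<subseteq> lin_comb T l (F (Suc j) (d - 1))"
    and base: "\<And>p d. p < l \<Longrightarrow> d \<ge> D \<Longrightarrow> C 0 p d"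
    and "p < l" "d \<ge> r"
  shows "C 0 p d"
proof -
  \<comment> \<open>The base case j = 0 climbs the resolution, losing one degree per step.\<close>
  have C_large: "p < l \<Longrightarrow> d \<ge> D + int j \<Longrightarrow> C j p d" for j p d
  proof (induction j arbitrary: p d)
    case (Suc j)
    have "q \<le> p \<Longrightarrow> d' \<ge> D + int j + 1 \<Longrightarrow> I j q d'" for q d'
    proof (induction q arbitrary: d')
      case (Suc q)
      then show ?case using I_Suc[of j q "d' - 1"] Suc.IH Suc.prems \<open>p < l\<close> Suc.prems(2)
        \<open>\<And>p d. p < l \<Longrightarrow> D + int j \<le> d \<Longrightarrow> C j p d\<close>[of q "d' - 1"] by simp
    qed (simp add: I_0)
    then show ?case using C_Suc[of j p d] Suc.prems by simp
  qed (use base in simp)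
  \<comment> \<open>With \<delta> = d - j, \<open>C_step\<close> refers to the same \<delta> for
    \<open>Suc j\<close> and \<open>Suc p\<close>, and to \<delta> + 1 otherwise; n counts how far
    \<delta> lies below D.\<close>
  have main: "\<delta> \<ge> D - int n \<Longrightarrow> \<delta> \<ge> r \<Longrightarrow> p < l \<Longrightarrow> C j p (\<delta> + int j)" for n \<delta> p j
  proof (induction n arbitrary: \<delta> p j)
    case 0
    then show ?case using C_large[of p j] by simp
  next
    case (Suc n)
    note IH = Suc.IH
    show ?case using \<open>p < l\<close>
    proof (induction "l - p" arbitrary: p j rule: less_induct)
      case less
      have up: "C j q (\<delta> + int j + 1)" if "q < l" for q j
        using IH[of "\<delta> + 1" q j] Suc.prems that by (simp add: algebra_simps)
      show ?case
      proof (cases "Suc p < l")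
        case True
        have "q \<le> p \<Longrightarrow> I j q (\<delta> + int j + 2)" for q
        proof (induction q)
          case (Suc q)
          then show ?case using I_Suc[of j q "\<delta> + int j + 1"] up[of q j] less.prems
            by (simp add: algebra_simps)
        qed (simp add: I_0)
        moreover have "C (Suc j) (Suc p) (\<delta> + int j + 1)"
          using less.hyps[of "Suc p" "Suc j"] True less.prems by (simp add: algebra_simps)
        ultimately show ?thesis
          using C_step[OF True, of j "\<delta> + int j"] up[OF less.prems] by simp
      next
        case False
        \<comment> \<open>No next form is left. Here the degree bound enters: \<delta> + j + 1 > r +
          j, so every element of \<open>F (Suc j)\<close> in that degree is a combination of all l
          forms.\<close>
        then have p: "Suc p = l" using less.prems by simp
        show ?thesis
        proof (rule C_of_decomposition[OF less.prems])
          fix z y a assume "y \<in> Z j (\<delta> + int j + 1)"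
          then show "y \<in> \<Phi> j ` lin_comb T (Suc p) (F (Suc j) (\<delta> + int j))"
            using gen[of j "\<delta> + int j + 1"] Suc.prems(2) unfolding p Z_def by auto
        qed
      qed
    qed
  qed
  show ?thesis using main[of "nat (D - d)" d p 0] assms by simp
qed

end

section \<open>Linear substitutions\<close>

definition monom_at :: "('n::finite \<Rightarrow> ('n, 'k::comm_ring_1) mpoly) \<Rightarrow> ('n \<Rightarrow>\<^sub>0 nat) \<Rightarrow> ('n, 'k) mpoly" where
  "monom_at g m = (\<Prod>x\<in>UNIV. g x ^ lk m x)"

text \<open>The algebra endomorphism with x \<mapsto> g x; it carries statements about the variables
  over to an arbitrary basis of the linear forms.\<close>

definition subst :: "('n::finite \<Rightarrow> ('n, 'k::comm_ring_1) mpoly) \<Rightarrow> ('n, 'k) mpoly \<Rightarrow> ('n, 'k) mpoly" where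
  "subst g f = (\<Sum>m\<in>keys f. cst (lk f m) * monom_at g m)"

lemma monom_at_add: "monom_at g (m + m') = monom_at g m * monom_at g m'"
  by (simp add: monom_at_def lookup_add power_add prod.distrib)

lemma monom_at_0 [simp]: "monom_at g 0 = 1"
  by (simp add: monom_at_def)

lemma monom_at_single [simp]: "monom_at g (single x k) = g x ^ k"
proof -
  have "monom_at g (single x k) = (\<Prod>y\<in>UNIV. if y = x then g x ^ k else 1)"
    unfolding monom_at_def by (rule prod.cong) (auto simp: lookup_single when_def)
  then show ?thesis by simp
qed

lemma subst_superset:
  assumes "finite A" "keys f \<subseteq> A"
  shows "subst g f = (\<Sum>m\<in>A. cst (lk f m) * monom_at g m)"
  unfolding subst_def
  by (rule sum.mono_neutral_left) (use assms in \<open>auto simp: in_keys_iff\<close>)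

lemma subst_zero [simp]: "subst g 0 = 0"
  by (simp add: subst_def)

lemma subst_add: "subst g (f + f') = subst g f + subst g f'"
proof -
  let ?A = "keys f \<union> keys f'"
  show ?thesis
    using subst_superset[of ?A f g] subst_superset[of ?A f' g] subst_superset[of ?A "f + f'" g]
      keys_add[of f f']
    by (simp add: lookup_add single_add distrib_right sum.distrib)
qed

lemma subst_single [simp]: "subst g (single m c) = cst c * monom_at g m"
  by (cases "c = 0") (simp_all add: subst_def)

lemma subst_mult: "subst g (f * f') = subst g f * subst g f'"
proof (induction f rule: mpoly_induct)
  case (single m c)
  show ?case
  proof (induction f' rule: mpoly_induct)
    case (single m' c')
    have *: "cst (c * c') = cst c * (cst c' :: ('a, 'b) mpoly)" by (simp add: mult_single)
    show ?case
      unfolding mult_single[of m c m' c'] subst_single monom_at_add * by (simp only: ac_simps)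
  qed (simp_all add: distrib_left subst_add)
qed (simp_all add: distrib_right subst_add)

lemma subst_variable [simp]: "subst g (variable x) = g x"
  by (simp add: variable_def)

lemma subst_one [simp]: "subst g 1 = 1"
  using subst_single[of g 0 1] by simp

lemma subst_diff: "subst g (f - f') = subst g f - subst g f'"
  using subst_add[of g "f - f'" f'] by simp

lemma subst_power: "subst g (f ^ n) = subst g f ^ n"
  by (induction n) (auto simp: subst_mult)

lemma subst_prod: "subst g (prod f A) = (\<Prod>a\<in>A. subst g (f a))"
  by (induction A rule: infinite_finite_induct) (auto simp: subst_mult)

lemma subst_comp: "subst g (subst h f) = subst (\<lambda>x. subst g (h x)) f"
proof (induction f rule: mpoly_induct)
  case (single m c)
  show ?case by (simp add: subst_mult) (simp add: monom_at_def subst_prod subst_power)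
qed (simp_all add: subst_add)

lemma variable_power: "variable x ^ k = single (single x k) 1"
  by (induction k) (simp_all add: variable_def mult_single flip: single_add)

lemma monom_at_variable: "monom_at variable m = single m 1"
proof -
  have "(\<Prod>x\<in>A. variable x ^ lk m x) =
      single (\<Sum>x\<in>A. single x (lk m x)) 1" for A :: "'a set"
    by (induction A rule: infinite_finite_induct) (auto simp: variable_power mult_single)
  moreover have "(\<Sum>x\<in>UNIV. single x (lk m x)) = m"
    by (rule poly_mapping_eqI) (simp add: lookup_sum lookup_single when_def)
  ultimately show ?thesis unfolding monom_at_def by metis
qed

lemma subst_id: "subst variable f = f"
  by (induction f rule: mpoly_induct) (auto simp: subst_add monom_at_variable mult_single)

lemma fm_prod: "(\<And>i. i \<in> A \<Longrightarrow> f i \<in> fm (d i)) \<Longrightarrow> prod f A \<in> fm (sum d A)"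
  by (induction A rule: infinite_finite_induct) (auto intro: fm_mult)

lemma subst_fm:
  assumes "\<And>x. g x \<in> fm 1" "f \<in> fm d"
  shows "subst g f \<in> fm d"
proof -
  have "monom_at g m \<in> fm (mdeg m)" for m
    using fm_prod[of UNIV "\<lambda>x. g x ^ lk m x" "\<lambda>x. int (lk m x)"] fm_power[OF assms(1)]
    by (simp add: monom_at_def monomial_degree_def)
  then show ?thesis
    unfolding subst_def using assms(2) by (intro fm_sum fm_scale) (auto simp: fm_def)
qed

section \<open>Regular sequences of linear forms\<close>

text \<open>An ideal generated by variables is monomial, so membership is decided monomial by
  monomial; this lemma and the next are the two directions.\<close>

lemma keys_lin_comb_variables:
  assumes "f \<in> lin_comb (\<lambda>i h. variable (c i) * h) p A" "m \<in> keys f"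
  shows "\<exists>i<p. lk m (c i) > 0"
  using assms
proof (induction p arbitrary: f)
  case (Suc p)
  then obtain a h where f: "f = a + variable (c p) * h"
    and a: "a \<in> lin_comb (\<lambda>i h. variable (c i) * h) p A" by auto
  consider "m \<in> keys a" | "m \<in> keys (variable (c p) * h)"
    using Suc.prems(2) keys_add[of a] unfolding f by blast
  then show ?case
  proof cases
    case 1
    then show ?thesis using Suc.IH[OF a] by (auto intro: less_SucI)
  next
    case 2
    then obtain m' where "m = single (c p) 1 + m'"
      using keys_mult[of "variable (c p)" h] by (fastforce simp: variable_def)
    then show ?thesis by (auto simp: lookup_add intro!: exI[of _ p])
  qed
qed auto

lemma lin_comb_variablesI:
  assumes "f \<in> fm d" "\<And>m. m \<in> keys f \<Longrightarrow> \<exists>i<p. lk m (c i) > 0"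
  shows "f \<in> lin_comb (\<lambda>i h. variable (c i) * h) p (fm (d - 1))"
  using assms
proof (induction p arbitrary: f)
  case 0
  then show ?case by (metis all_not_in_conv keys_eq_empty lin_comb.simps(1) not_less0 singletonI)
next
  case (Suc p)
  \<comment> \<open>Monomials divisible by the last variable go into its cofactor h, the others are
    left to the induction hypothesis.\<close>
  define P where "P = {m \<in> keys f. lk m (c p) > 0}"
  define Q where "Q = {m \<in> keys f. lk m (c p) = 0}"
  define a where "a = (\<Sum>m\<in>Q. single m (lk f m))"
  define h where "h = (\<Sum>m\<in>P. single (m - single (c p) 1) (lk f m))"
  have PQ: "keys f = P \<union> Q" "P \<inter> Q = {}" "finite P" "finite Q"
    by (auto simp: P_def Q_def)
  have m: "single (c p) 1 + (m - single (c p) 1) = m" if "m \<in> P" for m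
    using that by (intro poly_mapping_eqI) (auto simp: P_def lookup_add lookup_minus lookup_single when_def)
  have "variable (c p) * h = (\<Sum>m\<in>P. single m (lk f m))"
    unfolding h_def sum_distrib_left
    by (rule sum.cong) (use m in \<open>simp_all add: variable_def mult_single\<close>)
  moreover have "f = (\<Sum>m\<in>P \<union> Q. single m (lk f m))"
    using sum_singles[of "P \<union> Q" f] PQ by simp
  ultimately have "f = a + variable (c p) * h"
    using PQ by (simp add: sum.union_disjoint a_def add.commute)
  moreover have "a \<in> lin_comb (\<lambda>i h. variable (c i) * h) p (fm (d - 1))"
  proof (rule Suc.IH)
    show "a \<in> fm d"
      unfolding a_def using Suc.prems(1) by (intro fm_sum fm_single) (auto simp: Q_def fm_def)
    fix m assume "m \<in> keys a"
    then have "m \<in> Q"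
      using keys_sum[of "\<lambda>m. single m (lk f m)" Q]
      by (auto simp: a_def split: if_splits)
    then show "\<exists>i<p. lk m (c i) > 0"
      using Suc.prems(2)[of m] by (auto simp: Q_def less_Suc_eq)
  qed
  moreover have "h \<in> fm (d - 1)"
    unfolding h_def
  proof (intro fm_sum fm_single)
    fix m assume "m \<in> P"
    then have "mdeg m = d" using Suc.prems(1) by (auto simp: P_def fm_def)
    then show "mdeg (m - single (c p) 1) = d - 1"
      using arg_cong[OF m[OF \<open>m \<in> P\<close>], of mdeg] by (simp del: mdeg_eq_0_iff)
  qed
  ultimately show ?case by auto
qed

text \<open>Multiplying a monomial by a further variable does not change its divisibility by the
  first p variables.\<close>

lemma variables_regular:
  assumes "inj_on c {..p}" "z \<in> fm d"
    "variable (c p) * z \<in> lin_comb (\<lambda>i h. variable (c i) * h) p (fm d)"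
  shows "z \<in> lin_comb (\<lambda>i h. variable (c i) * h) p (fm (d - 1))"
proof (rule lin_comb_variablesI[OF assms(2)])
  fix m assume "m \<in> keys z"
  then have "single (c p) 1 + m \<in> keys (variable (c p) * z)"
    using lookup_mult_single[of "single (c p) 1" 1 z m] by (simp add: in_keys_iff variable_def)
  then obtain i where i: "i < p" "lk (single (c p) 1 + m) (c i) > 0"
    using keys_lin_comb_variables[OF assms(3)] by blast
  then have "c i \<noteq> c p" using inj_onD[OF assms(1), of i p] by auto
  then show "\<exists>i<p. lk m (c i) > 0" using i by (auto simp: lookup_add lookup_single when_def)
qed

lemma fm_1_span: "fm 1 = K.span (range (variable :: 'n::finite \<Rightarrow> ('n, 'k::field) mpoly))"
proof
  show "K.span (range variable) \<subseteq> (fm 1 :: ('n, 'k) mpoly set)"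
    by (rule K.span_minimal) (auto simp: subspace_K_fm)
  show "fm 1 \<subseteq> K.span (range (variable :: 'n \<Rightarrow> ('n, 'k) mpoly))"
  proof
    fix f :: "('n, 'k) mpoly" assume f: "f \<in> fm 1"
    have "single m (lk f m) \<in> K.span (range variable)" if m: "m \<in> keys f" for m
    proof -
      have d: "monomial_degree m = 1" using f m by (auto simp: fm_def)
      then have "m \<noteq> 0" by auto
      then obtain x where x: "lk m x \<noteq> 0" by (auto simp: poly_mapping_eq_iff fun_eq_iff)
      have "m = single x 1 + (m - single x 1)"
        using x by (intro poly_mapping_eqI) (auto simp: lookup_add lookup_minus lookup_single when_def)
      then have "m = single x 1"
        using d by (metis add.right_neutral add_left_cancel mdeg_add mdeg_eq_0_iff mdeg_single)
      then have "single m (lk f m) = cst (lk f m) * variable x"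
        by (simp add: variable_def mult_single)
      then show ?thesis by (metis K.span_base K.span_scale rangeI cscale_def)
    qed
    then have "(\<Sum>m\<in>keys f. single m (lk f m)) \<in> K.span (range variable)"
      by (rule K.span_sum)
    then show "f \<in> K.span (range variable)"
      using sum_singles[of "keys f" f] by simp
  qed
qed

text \<open>Independence is stated for one form after the other because generic forms are chosen in
  that way.\<close>

locale linear_basis =
  fixes w :: "nat \<Rightarrow> ('n::finite, 'k::field) mpoly"
  assumes w_fm: "i < CARD('n) \<Longrightarrow> w i \<in> fm 1"
    and w_indep: "p < CARD('n) \<Longrightarrow> w p \<notin> K.span (w ` {..<p})"
begin

lemma w_inj: "inj_on w {..<CARD('n)}"
proof (rule linorder_inj_onI)
  fix i j assume "i < j" "i \<in> {..<CARD('n)}" "j \<in> {..<CARD('n)}"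
  then show "w i \<noteq> w j" using w_indep[of j] K.span_base[of "w i" "w ` {..<j}"] by auto
qed auto

lemma w_independent: "K.independent (w ` {..<CARD('n)})"
proof -
  have "K.independent (w ` {..<p})" if "p \<le> CARD('n)" for p
    using that
  proof (induction p)
    case (Suc p)
    then show ?case
      using K.independent_insertI[OF w_indep[of p]] by (simp add: lessThan_Suc)
  qed (simp add: K.independent_empty)
  then show ?thesis by blast
qed

lemma w_span: "K.span (w ` {..<CARD('n)}) = fm 1"
proof
  show "K.span (w ` {..<CARD('n)}) \<subseteq> fm 1"
    by (rule K.span_minimal) (auto simp: subspace_K_fm w_fm)
  show "fm 1 \<subseteq> K.span (w ` {..<CARD('n)})"
  proof
    fix f :: "('n, 'k) mpoly" assume f: "f \<in> fm 1"
    show "f \<in> K.span (w ` {..<CARD('n)})"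
    proof (rule ccontr)
      assume n: "f \<notin> K.span (w ` {..<CARD('n)})"
      then have "K.independent (insert f (w ` {..<CARD('n)}))"
        using w_independent by (rule K.independent_insertI)
      moreover have "insert f (w ` {..<CARD('n)}) \<subseteq> K.span (range variable)"
        using f w_fm fm_1_span by auto
      ultimately have "card (insert f (w ` {..<CARD('n)})) \<le> card (range (variable :: 'n \<Rightarrow> ('n, 'k) mpoly))"
        by (rule K.independent_span_bound[THEN conjunct2, rotated]) simp
      also have "\<dots> \<le> CARD('n)" by (rule card_image_le) simp
      finally have "card (insert f (w ` {..<CARD('n)})) \<le> CARD('n)" .
      then show False
      proof -
        have "f \<notin> w ` {..<CARD('n)}" using n by (meson K.span_base)
        then have "card (insert f (w ` {..<CARD('n)})) = Suc CARD('n)"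
          using card_image[OF w_inj] card_insert_disjoint[of "w ` {..<CARD('n)}" f] by simp
        then show False using \<open>card (insert f (w ` {..<CARD('n)})) \<le> CARD('n)\<close> by linarith
      qed
    qed
  qed
qed

text \<open>Substituting the \<open>w i\<close> for the variables is bijective on linear forms, and
  the preimages of the variables define the inverse substitution. So any basis behaves like the
  variables.\<close>

lemma automorphism:
  obtains c and \<sigma> :: "('n, 'k) mpoly \<Rightarrow> ('n, 'k) mpoly" where "bij_betw c {..<CARD('n)} (UNIV :: 'n set)"
    "\<And>f g. \<sigma> (f - g) = \<sigma> f - \<sigma> g" "\<And>f g. \<sigma> (f * g) = \<sigma> f * \<sigma> g"
    "\<And>d. \<sigma> ` fm d = fm d" "inj \<sigma>" "\<And>i. i < CARD('n) \<Longrightarrow> \<sigma> (variable (c i)) = w i"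
proof -
  obtain c where c: "bij_betw c {..<CARD('n)} (UNIV :: 'n set)"
    using ex_bij_betw_nat_finite[of "UNIV :: 'n set"] by (auto simp: atLeast0LessThan)
  define c' where "c' = the_inv_into {..<CARD('n)} c"
  have c': "c' (c i) = i" if "i < CARD('n)" for i
    using that c unfolding c'_def by (simp add: bij_betw_def the_inv_into_f_f)
  have c'_less: "c' x < CARD('n)" and cc': "c (c' x) = x" for x
    using the_inv_into_into[of c "{..<CARD('n)}" x] f_the_inv_into_f[of c "{..<CARD('n)}" x] c
    unfolding c'_def by (auto simp: bij_betw_def)
  define \<sigma> where "\<sigma> = subst (\<lambda>x. w (c' x))"
  have lin: "Vector_Spaces.linear cscale cscale \<sigma>"
    by (unfold_locales) (auto simp: \<sigma>_def subst_add subst_mult cscale_def)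
  interpret L: Vector_Spaces.linear cscale cscale \<sigma> by (rule lin)
  have img: "\<sigma> ` range variable = w ` {..<CARD('n)}"
  proof -
    have "range c' = {..<CARD('n)}" using c' c'_less by (metis image_subset_iff lessThan_iff rangeI subsetI subset_antisym)
    moreover have "\<sigma> ` range variable = w ` range c'" by (simp add: \<sigma>_def image_image)
    ultimately show ?thesis by simp
  qed
  have fm1: "\<sigma> ` fm 1 = fm 1"
    using L.span_image[of "range variable"] unfolding img w_span fm_1_span[symmetric] by simp
  have "inj_on \<sigma> (range variable)"
  proof (rule inj_onI, clarify)
    fix x y assume "\<sigma> (variable x) = \<sigma> (variable y)"
    then have "c' x = c' y" using inj_onD[OF w_inj, of "c' x" "c' y"] c'_less by (simp add: \<sigma>_def)
    then show "variable x = variable y" by (metis cc')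
  qed
  then have inj1: "inj_on \<sigma> (fm 1)"
    using L.inj_on_span_iff_independent_image[of "range variable"] w_independent
    unfolding img fm_1_span[symmetric] by simp
  define b where "b x = (SOME f. f \<in> fm 1 \<and> \<sigma> f = variable x)" for x
  have b: "b x \<in> fm 1" "\<sigma> (b x) = variable x" for x
  proof -
    have "variable x \<in> \<sigma> ` fm 1" by (simp add: fm1)
    then have "\<exists>f. f \<in> fm 1 \<and> \<sigma> f = variable x" by (metis imageE)
    from someI_ex[OF this] show "b x \<in> fm 1" "\<sigma> (b x) = variable x" by (auto simp: b_def)
  qed
  have st: "\<sigma> (subst b f) = f" for f
    using b(2) unfolding \<sigma>_def by (simp add: subst_comp subst_id)
  have ws: "w (c' x) \<in> fm 1" for x using w_fm c'_less by blast
  have bw: "subst b (w (c' x)) = variable x" for x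
    by (rule inj_onD[OF inj1]) (use subst_fm[of b "w (c' x)" 1] b ws st in \<open>auto simp: \<sigma>_def\<close>)
  have ts: "subst b (\<sigma> f) = f" for f
    unfolding \<sigma>_def by (simp add: subst_comp bw subst_id)
  have "\<sigma> ` fm d = fm d" for d
  proof
    show "\<sigma> ` fm d \<subseteq> fm d" using subst_fm[OF ws] by (auto simp: \<sigma>_def)
    show "fm d \<subseteq> \<sigma> ` fm d" using subst_fm[of b _ d] b st by (metis image_eqI subsetI)
  qed
  moreover have "inj \<sigma>" using ts by (metis injI)
  moreover have "\<sigma> (variable (c i)) = w i" if "i < CARD('n)" for i
    using c' that by (simp add: \<sigma>_def)
  ultimately show ?thesis
    using that[of c \<sigma>] c by (auto simp: \<sigma>_def subst_diff subst_mult)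
qed

lemma lin_comb_cong:
  assumes "\<And>i. i < p \<Longrightarrow> T i = T' i"
  shows "lin_comb T p A = lin_comb T' p A"
  using assms by (induction p) auto

lemma lin_comb_transport:
  assumes "\<And>f g. \<sigma> (f - g) = \<sigma> f - \<sigma> g" "\<And>f g. \<sigma> (f * g) = \<sigma> f * \<sigma> g"
    "\<sigma> ` fm d = fm d" "\<And>i. i < p \<Longrightarrow> \<sigma> (v i) = w i"
  shows "\<sigma> ` lin_comb (\<lambda>i h. v i * h) p (fm d) = lin_comb (\<lambda>i h. w i * h) p (fm d)"
proof -
  have "\<sigma> ` lin_comb (\<lambda>i h. v i * h) p (fm d) = lin_comb (\<lambda>i h. \<sigma> (v i) * h) p (\<sigma> ` fm d)"
    by (rule lin_comb_hom) (simp_all add: assms(1,2))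
  also have "\<dots> = lin_comb (\<lambda>i h. w i * h) p (fm d)"
    unfolding assms(3) by (rule lin_comb_cong) (simp add: assms(4))
  finally show ?thesis .
qed

lemma w_regular:
  assumes "p < CARD('n)" "z \<in> fm d" "w p * z \<in> lin_comb (\<lambda>i h. w i * h) p (fm d)"
  shows "z \<in> lin_comb (\<lambda>i h. w i * h) p (fm (d - 1))"
proof -
  obtain c and \<sigma> :: "('n, 'k) mpoly \<Rightarrow> ('n, 'k) mpoly" where c: "bij_betw c {..<CARD('n)} (UNIV :: 'n set)"
    and \<sigma>: "\<And>f g. \<sigma> (f - g) = \<sigma> f - \<sigma> g" "\<And>f g. \<sigma> (f * g) = \<sigma> f * \<sigma> g"
    "\<And>d. \<sigma> ` fm d = fm d" "inj \<sigma>" "\<And>i. i < CARD('n) \<Longrightarrow> \<sigma> (variable (c i)) = w i"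
    using automorphism by blast
  have tr: "\<sigma> ` lin_comb (\<lambda>i h. variable (c i) * h) p (fm d) = lin_comb (\<lambda>i h. w i * h) p (fm d)" for d
    by (rule lin_comb_transport) (use \<sigma> assms(1) in auto)
  obtain z' where z': "z = \<sigma> z'" "z' \<in> fm d" using assms(2) \<sigma>(3) by blast
  have "\<sigma> (variable (c p) * z') \<in> \<sigma> ` lin_comb (\<lambda>i h. variable (c i) * h) p (fm d)"
    using assms(1,3) z' \<sigma>(2,5) tr by simp
  then have "variable (c p) * z' \<in> lin_comb (\<lambda>i h. variable (c i) * h) p (fm d)"
    using \<sigma>(4) by (simp add: inj_image_mem_iff)
  moreover have "inj_on c {..p}"
    by (rule inj_on_subset[OF bij_betw_imp_inj_on[OF c]]) (use assms(1) in auto)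
  ultimately have "z' \<in> lin_comb (\<lambda>i h. variable (c i) * h) p (fm (d - 1))"
    using variables_regular z'(2) by blast
  then show ?thesis using tr[of "d - 1"] z'(1) by blast
qed

lemma w_generates:
  assumes "f \<in> fm d" "lk f 0 = 0"
  shows "f \<in> lin_comb (\<lambda>i h. w i * h) CARD('n) (fm (d - 1))"
proof -
  obtain c and \<sigma> :: "('n, 'k) mpoly \<Rightarrow> ('n, 'k) mpoly" where c: "bij_betw c {..<CARD('n)} (UNIV :: 'n set)"
    and \<sigma>: "\<And>f g. \<sigma> (f - g) = \<sigma> f - \<sigma> g" "\<And>f g. \<sigma> (f * g) = \<sigma> f * \<sigma> g"
    "\<And>d. \<sigma> ` fm d = fm d" "inj \<sigma>" "\<And>i. i < CARD('n) \<Longrightarrow> \<sigma> (variable (c i)) = w i"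
    using automorphism by blast
  have tr: "\<sigma> ` lin_comb (\<lambda>i h. variable (c i) * h) CARD('n) (fm d) = lin_comb (\<lambda>i h. w i * h) CARD('n) (fm d)" for d
    by (rule lin_comb_transport) (use \<sigma> in auto)
  obtain g where g: "f = \<sigma> g" "g \<in> fm d" using assms(1) \<sigma>(3) by blast
  have g0: "lk g 0 = 0"
  proof (cases "d = 0")
    case True
    then have "f = 0" using fm_0_eq assms by fastforce
    then have "\<sigma> g = \<sigma> (0 - 0)" using g \<sigma>(1)[of 0 0] by simp
    then have "g = 0 - 0" by (rule injD[OF \<sigma>(4)])
    then show ?thesis by simp
  qed (use g lookup_0_fm in blast)
  have "g \<in> lin_comb (\<lambda>i h. variable (c i) * h) CARD('n) (fm (d - 1))"
  proof (rule lin_comb_variablesI[OF g(2)])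
    fix m assume "m \<in> keys g"
    then have "m \<noteq> 0" using g0 by (auto simp: in_keys_iff)
    then obtain x where "lk m x \<noteq> 0" by (auto simp: poly_mapping_eq_iff fun_eq_iff)
    moreover obtain i where "i < CARD('n)" "x = c i" using c by (auto simp: bij_betw_def)
    ultimately show "\<exists>i<CARD('n). lk m (c i) > 0" by auto
  qed
  then show ?thesis using tr[of "d - 1"] g(1) by blast
qed

end

section \<open>Dimensions of subspaces\<close>

context Vector_Spaces.vector_space
begin

text \<open>The finite spanning set B guards against infinite dimension, where \<open>dim\<close>
  takes the value 0.\<close>

lemma card_le_dim:
  assumes "independent C" "C \<subseteq> V" "V \<subseteq> span B" "finite B"
  shows "finite C" "card C \<le> dim V"
proof -
  obtain D where D: "D \<subseteq> V" "independent D" "V \<subseteq> span D" "card D = dim V"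
    using basis_exists by blast
  have "finite D" using independent_span_bound[of B D] D assms by blast
  then show "finite C" "card C \<le> dim V" using independent_span_bound[of D C] D assms by auto
qed

lemma dim_mono_finite:
  assumes "V \<subseteq> W" "W \<subseteq> span B" "finite B"
  shows "dim V \<le> dim W"
proof -
  obtain D where "D \<subseteq> V" "independent D" "V \<subseteq> span D" "card D = dim V"
    using basis_exists by blast
  then show ?thesis using card_le_dim[of D W B] assms by auto
qed

lemma subspace_eq_of_dim_le:
  assumes "subspace V" "V \<subseteq> W" "W \<subseteq> span B" "finite B" "dim W \<le> dim V"
  shows "V = W"
proof (rule ccontr)
  assume "V \<noteq> W"
  then obtain x where x: "x \<in> W" "x \<notin> V" using assms(2) by blast
  obtain D where D: "D \<subseteq> V" "independent D" "V \<subseteq> span D" "card D = dim V"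
    using basis_exists by blast
  have "span D = V" using D assms(1) by (metis span_subspace)
  then have "independent (insert x D)" using x D by (simp add: independent_insertI)
  then have "finite (insert x D)" "card (insert x D) \<le> dim W"
    using card_le_dim[of "insert x D" W B] x D assms by auto
  moreover have "x \<notin> D" using x D by blast
  ultimately show False using D assms(5) by simp
qed

text \<open>Rank and nullity of the map A/B \<rightarrow> X/D induced by f, with X the ambient
  space: its image is U/D. The last two statements say that equality of dimensions amounts to
  injectivity. Working with sums of subspaces avoids quotient spaces.\<close>

lemma
  assumes f: "Vector_Spaces.linear scale scale f"
    and sub: "subspace A" "subspace B" "subspace D" "B \<subseteq> A" "f ` B \<subseteq> D"
    and fin: "A \<subseteq> span A0" "finite A0" "D \<subseteq> span D0" "finite D0"
  defines "U \<equiv> {f a + d |a d. a \<in> A \<and> d \<in> D}"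
  shows dim_image_sum_le: "dim U + dim B \<le> dim D + dim A"
    and dim_image_sum_ge: "(\<And>a. a \<in> A \<Longrightarrow> f a \<in> D \<Longrightarrow> a \<in> B) \<Longrightarrow> dim D + dim A \<le> dim U + dim B"
    and dim_image_sum_ge_iff: "dim D + dim A \<le> dim U + dim B \<Longrightarrow> a \<in> A \<Longrightarrow> f a \<in> D \<Longrightarrow> a \<in> B"
proof -
  interpret f: Vector_Spaces.linear scale scale f by (rule f)
  obtain \<beta> where \<beta>: "\<beta> \<subseteq> B" "independent \<beta>" "B \<subseteq> span \<beta>" "card \<beta> = dim B" using basis_exists by blast
  obtain \<delta> where \<delta>: "\<delta> \<subseteq> D" "independent \<delta>" "D \<subseteq> span \<delta>" "card \<delta> = dim D" using basis_exists by blast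
  have fin\<delta>: "finite \<delta>" using card_le_dim(1)[of \<delta> D D0] \<delta> fin by auto
  have span\<beta>: "span \<beta> = B" and span\<delta>: "span \<delta> = D"
    using \<beta> \<delta> sub by (metis span_subspace)+
  have finU: "U \<subseteq> span (f ` A0 \<union> D0)"
  proof
    fix u assume "u \<in> U"
    then obtain a d where u: "u = f a + d" "a \<in> span A0" "d \<in> span D0" using fin by (auto simp: U_def)
    then have "f a \<in> span (f ` A0)" using f.span_image[of A0] by blast
    then show "u \<in> span (f ` A0 \<union> D0)" unfolding span_Un using u by blast
  qed
  \<comment> \<open>S collects independent vectors of A that f sends into D. A basis of B gives the
    inequality; one more vector outside B makes it strict, which yields the third statement.\<close>
  have upper: "dim U + card S \<le> dim D + dim A"
    if S: "\<beta> \<subseteq> S" "independent S" "S \<subseteq> A" "f ` S \<subseteq> D" for S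
  proof -
    obtain \<alpha> where \<alpha>: "S \<subseteq> \<alpha>" "\<alpha> \<subseteq> A" "independent \<alpha>" "A \<subseteq> span \<alpha>"
      using maximal_independent_subset_extend[OF S(3,2)] by blast
    have fin\<alpha>: "finite \<alpha>" using card_le_dim(1)[of \<alpha> A A0] \<alpha> fin by auto
    have card\<alpha>: "card \<alpha> = dim A" using basis_card_eq_dim[of \<alpha> A] \<alpha> by auto
    have "U \<subseteq> span (f ` (\<alpha> - S) \<union> \<delta>)"
    proof
      fix u assume "u \<in> U"
      then obtain a d where u: "u = f a + d" "a \<in> A" "d \<in> D" by (auto simp: U_def)
      have "f a \<in> span (f ` \<alpha>)" using f.span_image[of \<alpha>] u \<alpha> by blast
      also have "span (f ` \<alpha>) \<subseteq> span (f ` (\<alpha> - S) \<union> \<delta>)"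
      proof (rule span_minimal)
        show "f ` \<alpha> \<subseteq> span (f ` (\<alpha> - S) \<union> \<delta>)"
        proof
          fix y assume "y \<in> f ` \<alpha>"
          then obtain x where x: "x \<in> \<alpha>" "y = f x" by blast
          show "y \<in> span (f ` (\<alpha> - S) \<union> \<delta>)"
          proof (cases "x \<in> S")
            case True
            then have "y \<in> span \<delta>" using x S(4) span\<delta> by blast
            then show ?thesis using span_mono[of \<delta> "f ` (\<alpha> - S) \<union> \<delta>"] by blast
          qed (use x in \<open>auto intro: span_base\<close>)
        qed
      qed simp
      finally have "f a \<in> span (f ` (\<alpha> - S) \<union> \<delta>)" .
      moreover have "d \<in> span (f ` (\<alpha> - S) \<union> \<delta>)"
        using u(3) span\<delta> span_mono[of \<delta> "f ` (\<alpha> - S) \<union> \<delta>"] by blast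
      ultimately show "u \<in> span (f ` (\<alpha> - S) \<union> \<delta>)" unfolding u by (rule span_add)
    qed
    then have "dim U \<le> card (f ` (\<alpha> - S) \<union> \<delta>)"
      using fin\<alpha> fin\<delta> by (intro dim_le_card) auto
    also have "\<dots> \<le> card (\<alpha> - S) + card \<delta>"
      using card_Un_le[of "f ` (\<alpha> - S)" \<delta>] card_image_le[of "\<alpha> - S" f] fin\<alpha> by simp
    also have "card (\<alpha> - S) = card \<alpha> - card S"
      using \<alpha> fin\<alpha> finite_subset by (intro card_Diff_subset) auto
    finally show ?thesis using card_mono[OF fin\<alpha> \<alpha>(1)] card\<alpha> \<delta>(4) by simp
  qed
  show "dim U + dim B \<le> dim D + dim A"
    using upper[of \<beta>, OF order_refl \<beta>(2)] \<beta>(1,4) sub(4,5) by (metis image_mono subset_trans)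
  show "a \<in> B" if le: "dim D + dim A \<le> dim U + dim B" and a: "a \<in> A" "f a \<in> D" for a
  proof (rule ccontr)
    assume "a \<notin> B"
    then have 1: "independent (insert a \<beta>)" using span\<beta> \<beta> by (simp add: independent_insertI)
    have "finite (insert a \<beta>)" using card_le_dim(1)[of "insert a \<beta>" A A0] 1 a \<beta> sub fin by auto
    moreover have "a \<notin> \<beta>" using \<open>a \<notin> B\<close> \<beta> by blast
    moreover have "dim U + card (insert a \<beta>) \<le> dim D + dim A"
    proof (rule upper)
      show "f ` insert a \<beta> \<subseteq> D" using a \<beta>(1) sub(5) by (metis image_insert image_mono insert_subset subset_trans)
    qed (use 1 a \<beta> sub in auto)
    ultimately show False using le \<beta>(4) by simp
  qed
  show "dim D + dim A \<le> dim U + dim B" if inj: "\<And>a. a \<in> A \<Longrightarrow> f a \<in> D \<Longrightarrow> a \<in> B"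
  proof -
    \<comment> \<open>Conversely, if only B is sent into D, the vectors completing a basis of B to
      one of A have images independent modulo D.\<close>
    obtain \<alpha> where \<alpha>: "\<beta> \<subseteq> \<alpha>" "\<alpha> \<subseteq> A" "independent \<alpha>" "A \<subseteq> span \<alpha>"
      using maximal_independent_subset_extend[of \<beta> A] \<beta> sub by blast
    have fin\<alpha>: "finite \<alpha>" using card_le_dim(1)[of \<alpha> A A0] \<alpha> fin by auto
    have card\<alpha>: "card \<alpha> = dim A" using basis_card_eq_dim[of \<alpha> A] \<alpha> by auto
    have "independent (f ` G \<union> \<delta>) \<and> card (f ` G \<union> \<delta>) = card G + card \<delta>"
      if "finite G" "G \<subseteq> \<alpha> - \<beta>" for G
      using that
    proof (induction G)
      case (insert c G)
      have "f c \<notin> span (f ` G \<union> \<delta>)"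
      proof
        assume "f c \<in> span (f ` G \<union> \<delta>)"
        then obtain x y where xy: "f c = x + y" "x \<in> span (f ` G)" "y \<in> D"
          unfolding span_Un span\<delta> by blast
        then obtain u where u: "x = f u" "u \<in> span G" using f.span_image[of G] by blast
        have "u \<in> A" using u(2) insert.prems \<alpha>(2) sub(1) span_minimal[of G A] by blast
        moreover have "c \<in> A" using insert.prems \<alpha>(2) by blast
        moreover have "f (c - u) \<in> D" using xy u by (simp add: f.diff)
        ultimately have "c - u \<in> span \<beta>" using inj[of "c - u"] sub(1) subspace_diff span\<beta> by blast
        then have "c - u + u \<in> span (\<alpha> - {c})"
          using u(2) insert.prems insert.hyps \<alpha>(1)
          by (intro span_add; elim rev_subsetD[OF _ span_mono]) auto
        then show False using \<alpha>(3) insert.prems unfolding dependent_def by auto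
      qed
      moreover from this have "f c \<notin> f ` G \<union> \<delta>" by (meson span_base)
      ultimately show ?case
        using insert fin\<delta> by (auto simp: independent_insertI)
    qed (use \<delta> in auto)
    from this[of "\<alpha> - \<beta>"] have ind: "independent (f ` (\<alpha> - \<beta>) \<union> \<delta>)"
      "card (f ` (\<alpha> - \<beta>) \<union> \<delta>) = card (\<alpha> - \<beta>) + card \<delta>" using fin\<alpha> by auto
    have f0: "f 0 = 0" by (rule f.zero)
    have "f ` (\<alpha> - \<beta>) \<union> \<delta> \<subseteq> U"
    proof (intro Un_least subsetI)
      fix x assume "x \<in> f ` (\<alpha> - \<beta>)"
      then obtain a where "x = f a + 0" "a \<in> A" using \<alpha> by auto
      then show "x \<in> U" using subspace_0[OF sub(3)] by (auto simp: U_def simp del: add_0_right)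
    next
      fix x assume "x \<in> \<delta>"
      then have "x = f 0 + x" "x \<in> D" using f0 \<delta> by auto
      then show "x \<in> U" using subspace_0[OF sub(1)] unfolding U_def by (metis (mono_tags, lifting) mem_Collect_eq)
    qed
    then have "card (f ` (\<alpha> - \<beta>) \<union> \<delta>) \<le> dim U"
      using card_le_dim(2)[OF ind(1) _ finU] fin by auto
    moreover have "card (\<alpha> - \<beta>) = card \<alpha> - card \<beta>"
      using \<alpha> fin\<alpha> finite_subset by (intro card_Diff_subset) auto
    ultimately show ?thesis
      using ind(2) card\<alpha> \<beta>(4) \<delta>(4) card_mono[OF fin\<alpha> \<alpha>(1)] by simp
  qed
qed

end

section \<open>Semicontinuity along a line\<close>

text \<open>Families rather than sets, as different members may coincide for special values of a
  parameter. The index m runs over coordinates, later the monomials.\<close>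

definition family_indep :: "'i set \<Rightarrow> ('i \<Rightarrow> 'm \<Rightarrow> 'k::field) \<Rightarrow> bool" where
  "family_indep A v \<longleftrightarrow> (\<forall>c. (\<forall>m. (\<Sum>i\<in>A. c i * v i m) = 0) \<longrightarrow> (\<forall>i\<in>A. c i = 0))"

text \<open>Gaussian elimination over \<open>'k poly\<close>, with a pivot that does not vanish at \<open>0\<close>.\<close>

lemma finite_not_family_indep:
  fixes q :: "'i \<Rightarrow> 'm \<Rightarrow> 'k::field poly"
  assumes "finite A" "family_indep A (\<lambda>i m. poly (q i m) 0)"
  shows "finite {t. \<not> family_indep A (\<lambda>i m. poly (q i m) t)}"
  using assms
proof (induction A arbitrary: q)
  case empty
  then show ?case by (simp add: family_indep_def)
next
  case (insert i A)
  have "\<exists>m. poly (q i m) 0 \<noteq> 0"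
  proof (rule ccontr)
    assume "\<nexists>m. poly (q i m) 0 \<noteq> 0"
    then have "\<forall>m. (\<Sum>j\<in>insert i A. (if j = i then 1 else 0) * poly (q j m) 0) = 0"
      using insert.hyps by (auto intro!: sum.neutral)
    then have "(\<lambda>j. if j = i then 1 else (0::'k)) i = 0"
      using insert.prems[unfolded family_indep_def, rule_format, of "\<lambda>j. if j = i then 1 else 0" i]
      by simp
    then show False by simp
  qed
  then obtain m0 where m0: "poly (q i m0) 0 \<noteq> 0" by blast
  \<comment> \<open>Elimination by cross-multiplication keeps the entries polynomial; column
    \<open>m0\<close> becomes 0.\<close>
  define q' where "q' j m = q i m0 * q j m - q j m0 * q i m" for j m
  have sum_q': "(\<Sum>j\<in>A. c j * poly (q' j m) t) =
      poly (q i m0) t * (\<Sum>j\<in>A. c j * poly (q j m) t) - (\<Sum>j\<in>A. c j * poly (q j m0) t) * poly (q i m) t"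
    for c m t
    by (simp add: q'_def sum_distrib_left sum_distrib_right sum_subtractf[symmetric] algebra_simps)
  have "family_indep A (\<lambda>j m. poly (q' j m) 0)"
    unfolding family_indep_def
  proof (intro allI impI ballI)
    fix c j assume 0: "\<forall>m. (\<Sum>j\<in>A. c j * poly (q' j m) 0) = 0" and j: "j \<in> A"
    \<comment> \<open>A relation among the eliminated rows is one among the original rows, with this
      coefficient at the pivot row.\<close>
    define c' where "c' k = (if k = i then - (\<Sum>j\<in>A. c j * poly (q j m0) 0) else poly (q i m0) 0 * c k)" for k
    have "(\<Sum>k\<in>insert i A. c' k * poly (q k m) 0) = 0" for m
    proof -
      have "(\<Sum>k\<in>A. c' k * poly (q k m) 0) = poly (q i m0) 0 * (\<Sum>k\<in>A. c k * poly (q k m) 0)"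
        unfolding sum_distrib_left using insert.hyps
        by (intro sum.cong) (auto simp: c'_def mult.assoc)
      then show ?thesis
        using 0[rule_format, of m] insert.hyps unfolding sum_q' by (simp add: c'_def)
    qed
    then have "c' j = 0" using insert.prems j unfolding family_indep_def by blast
    moreover have "j \<noteq> i" using j insert.hyps by blast
    ultimately show "c j = 0" using m0 by (simp add: c'_def)
  qed
  then have fin: "finite ({t. \<not> family_indep A (\<lambda>j m. poly (q' j m) t)} \<union> {t. poly (q i m0) t = 0})"
    using insert.IH[of q'] m0 poly_roots_finite[of "q i m0"] by fastforce
  show ?case
  proof (rule finite_subset[OF _ fin], rule ccontr)
    assume "\<not> {t. \<not> family_indep (insert i A) (\<lambda>i m. poly (q i m) t)} \<subseteq>
       {t. \<not> family_indep A (\<lambda>j m. poly (q' j m) t)} \<union> {t. poly (q i m0) t = 0}"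
    then obtain t where t: "\<not> family_indep (insert i A) (\<lambda>i m. poly (q i m) t)"
      "family_indep A (\<lambda>j m. poly (q' j m) t)" "poly (q i m0) t \<noteq> 0" by blast
    from t(1) obtain c where c: "\<And>m. (\<Sum>j\<in>insert i A. c j * poly (q j m) t) = 0"
      "\<not> (\<forall>j\<in>insert i A. c j = 0)" unfolding family_indep_def by blast
    have c1: "(\<Sum>j\<in>A. c j * poly (q j m) t) = - (c i * poly (q i m) t)" for m
      using c(1)[of m] insert.hyps by (simp add: add_eq_0_iff)
    have "(\<Sum>j\<in>A. c j * poly (q' j m) t) = 0" for m
      unfolding sum_q' c1 by simp
    then have cA: "\<forall>j\<in>A. c j = 0" using t(2) unfolding family_indep_def by blast
    then have "c i * poly (q i m0) t = 0" using c1[of m0] by simp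
    then show False using cA c(2) t(3) by auto
  qed
qed

text \<open>Curves in S whose coefficients are polynomials in t, by
  \<open>poly_family_lookup\<close>. Generating them from constants avoids passing to polynomials
  over \<open>'k poly\<close>.\<close>

inductive poly_family :: "('k::field \<Rightarrow> ('n, 'k) mpoly) \<Rightarrow> bool" where
  const: "poly_family (\<lambda>t. f)"
| add: "poly_family f \<Longrightarrow> poly_family g \<Longrightarrow> poly_family (\<lambda>t. f t + g t)"
| scale: "poly_family f \<Longrightarrow> poly_family (\<lambda>t. cst t * f t)"

lemma poly_family_mult:
  assumes "poly_family f" "poly_family g"
  shows "poly_family (\<lambda>t. f t * g t)"
  using assms(1)
proof induction
  case (const f)
  show ?case using assms(2)
  proof induction
    case (add g h)
    then show ?case by (simp add: distrib_left poly_family.add)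
  next
    case (scale g)
    then show ?case using poly_family.scale[of "\<lambda>t. f * g t"] by (simp only: mult.left_commute)
  qed (rule poly_family.const)
next
  case (add f g)
  then show ?case by (simp add: distrib_right poly_family.add)
next
  case (scale f)
  then show ?case using poly_family.scale[of "\<lambda>t. f t * g t"] by (simp only: mult.assoc)
qed

lemma poly_family_power: "poly_family f \<Longrightarrow> poly_family (\<lambda>t. f t ^ n)"
  by (induction n) (auto intro: poly_family.const poly_family_mult)

lemma poly_family_lookup: "poly_family f \<Longrightarrow> \<exists>q. \<forall>t. lk (f t) m = poly q t"
proof (induction rule: poly_family.induct)
  case (const f)
  then show ?case by (intro exI[of _ "[:lk f m:]"]) simp
next
  case (add f g)
  then obtain p q where "\<forall>t. lk (f t) m = poly p t" "\<forall>t. lk (g t) m = poly q t" by blast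
  then show ?case by (intro exI[of _ "p + q"]) (simp add: lookup_add)
next
  case (scale f)
  then obtain p where "\<forall>t. lk (f t) m = poly p t" by blast
  then show ?case by (intro exI[of _ "pCons 0 p"]) simp
qed

lemma sum_cst_mult_eq_0:
  "(\<Sum>i\<in>A. cst (c i) * v i) = 0 \<longleftrightarrow> (\<forall>m. (\<Sum>i\<in>A. c i * lk (v i) m) = 0)"
  for v :: "'i \<Rightarrow> ('n, 'k::field) mpoly"
  by (simp add: poly_mapping_eq_iff fun_eq_iff lookup_sum)

lemma family_indep_imp_independent:
  fixes v :: "'i \<Rightarrow> ('n, 'k::field) mpoly"
  assumes "finite A" "family_indep A (\<lambda>i. lk (v i))"
  shows "inj_on v A" "K.independent (v ` A)"
proof -
  have ind: "\<forall>i\<in>A. c i = 0" if "(\<Sum>i\<in>A. cst (c i) * v i) = 0" for c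
    using assms(2) that unfolding family_indep_def sum_cst_mult_eq_0 by blast
  show inj: "inj_on v A"
  proof (rule inj_onI, rule ccontr)
    fix i j assume ij: "i \<in> A" "j \<in> A" "v i = v j" "i \<noteq> j"
    let ?c = "\<lambda>k. if k = i then 1 else if k = j then -1 else (0::'k)"
    have "(\<Sum>k\<in>A. cst (?c k) * v k) = (\<Sum>k\<in>{i, j}. cst (?c k) * v k)"
      by (rule sum.mono_neutral_right) (use assms ij in auto)
    also have "\<dots> = 0" using ij by (simp add: single_uminus)
    finally have "?c i = 0" using ind[of ?c] ij(1) by blast
    then show False by simp
  qed
  show "K.independent (v ` A)"
  proof
    assume "K.dependent (v ` A)"
    then obtain u where u: "\<exists>x\<in>v ` A. u x \<noteq> 0" "(\<Sum>x\<in>v ` A. cst (u x) * x) = 0"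
      using K.dependent_finite[of "v ` A"] assms(1) by (auto simp: cscale_def)
    have "(\<Sum>i\<in>A. cst (u (v i)) * v i) = 0"
      using u(2) by (simp add: sum.reindex[OF inj])
    then show False using ind[of "\<lambda>i. u (v i)"] u(1) by blast
  qed
qed

lemma independent_imp_family_indep:
  fixes B :: "('n, 'k::field) mpoly set"
  assumes "finite B" "K.independent B"
  shows "family_indep B (\<lambda>b. lk b)"
  unfolding family_indep_def
proof (intro allI impI ballI)
  fix c b assume "\<forall>m. (\<Sum>i\<in>B. c i * lk i m) = 0" "b \<in> B"
  then show "c b = 0"
    using K.independentD[OF assms(2,1) order_refl, of c b] sum_cst_mult_eq_0[of c "\<lambda>i. i" B] by (simp add: cscale_def)
qed

lemma finite_monomials: "finite {m :: 'n::finite \<Rightarrow>\<^sub>0 nat. mdeg m = d}"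
proof -
  let ?M = "{m :: 'n \<Rightarrow>\<^sub>0 nat. mdeg m = d}"
  have "lk ` ?M \<subseteq> PiE UNIV (\<lambda>_. {..nat d})"
  proof
    fix f assume "f \<in> lk ` ?M"
    then obtain m :: "'n \<Rightarrow>\<^sub>0 nat" where m: "f = lk m" "mdeg m = d" by blast
    have "lk m x \<le> monomial_degree m" for x
      unfolding monomial_degree_def by (rule member_le_sum) auto
    then show "f \<in> PiE UNIV (\<lambda>_. {..nat d})" using m by auto
  qed
  then have "finite (lk ` ?M)" by (rule finite_subset) (auto intro: finite_PiE)
  moreover have "inj_on lk ?M" by (rule inj_onI) (simp only: Poly_Mapping.lookup_inject)
  ultimately show ?thesis by (rule finite_imageD)
qed

lemma fm_finite_dim:
  obtains B :: "('n::finite, 'k::field) mpoly set" where "finite B" "fm d \<subseteq> K.span B"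
proof
  let ?B = "(\<lambda>m. single m 1) ` {m :: 'n \<Rightarrow>\<^sub>0 nat. mdeg m = d} :: ('n, 'k) mpoly set"
  show "finite ?B" using finite_monomials by blast
  show "fm d \<subseteq> K.span ?B"
  proof
    fix f :: "('n, 'k) mpoly" assume f: "f \<in> fm d"
    have "single m (lk f m) \<in> K.span ?B" if "m \<in> keys f" for m
    proof -
      have "cst (lk f m) * single m 1 \<in> K.span ?B"
        unfolding cscale_def[symmetric] using f that by (intro K.span_scale K.span_base) (auto simp: fm_def)
      then show ?thesis by (simp add: mult_single)
    qed
    then have "(\<Sum>m\<in>keys f. single m (lk f m)) \<in> K.span ?B"
      by (rule K.span_sum)
    then show "f \<in> K.span ?B" using sum_singles[of "keys f" f] by simp
  qed
qed

text \<open>Lower semicontinuity at 0: a basis chosen among the values at 0 comes from finitely many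
  curves, whose values remain independent for all but finitely many t.\<close>

lemma finite_dim_drop:
  fixes \<F> :: "('k::field \<Rightarrow> ('n::finite, 'k) mpoly) set"
  assumes "\<And>f. f \<in> \<F> \<Longrightarrow> poly_family f" "\<And>f t. f \<in> \<F> \<Longrightarrow> f t \<in> fm d"
  shows "finite {t. K.dim ((\<lambda>f. f t) ` \<F>) < K.dim ((\<lambda>f. f 0) ` \<F>)}"
proof -
  obtain B0 :: "('n, 'k) mpoly set" where B0: "finite B0" "fm d \<subseteq> K.span B0" using fm_finite_dim by blast
  have sub: "(\<lambda>f. f t) ` \<F> \<subseteq> K.span B0" for t using assms(2) B0 by blast
  obtain B where B: "B \<subseteq> (\<lambda>f. f 0) ` \<F>" "K.independent B" "card B = K.dim ((\<lambda>f. f 0) ` \<F>)"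
    by (rule K.basis_exists[of "(\<lambda>f. f 0) ` \<F>"])
  have finB: "finite B" using K.card_le_dim(1)[OF B(2,1) sub B0(1)] .
  define g where "g b = (SOME f. f \<in> \<F> \<and> b = f 0)" for b
  have g: "g b \<in> \<F>" "g b 0 = b" if "b \<in> B" for b
  proof -
    have "\<exists>f. f \<in> \<F> \<and> b = f 0" using subsetD[OF B(1) that] by (simp add: image_iff Bex_def)
    from someI_ex[OF this] have *: "g b \<in> \<F> \<and> b = g b 0" unfolding g_def .
    show "g b \<in> \<F>" by (rule conjunct1[OF *])
    show "g b 0 = b" by (rule conjunct2[OF *, symmetric])
  qed
  define q where "q b m = (SOME p. \<forall>t. lk (g b t) m = poly p t)" for b m
  have q: "lk (g b t) m = poly (q b m) t" if "b \<in> B" for b m t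
  proof -
    have "\<forall>t. lk (g b t) m = poly (q b m) t"
      unfolding q_def by (rule someI_ex[OF poly_family_lookup[OF assms(1)[OF g(1)[OF that]]]])
    then show ?thesis by (rule spec)
  qed
  have cong: "family_indep B (\<lambda>b. lk (g b t)) \<longleftrightarrow> family_indep B (\<lambda>b m. poly (q b m) t)" for t
    unfolding family_indep_def using q by simp
  have "family_indep B (\<lambda>b. lk (g b 0))"
    using independent_imp_family_indep[OF finB B(2)] g(2) by (simp add: family_indep_def cong: sum.cong)
  then have "finite {t. \<not> family_indep B (\<lambda>b. lk (g b t))}"
    unfolding cong by (rule finite_not_family_indep[OF finB])
  then show ?thesis
  proof (rule rev_finite_subset, intro subsetI CollectI notI)
    fix t assume lt: "t \<in> {t. K.dim ((\<lambda>f. f t) ` \<F>) < K.dim ((\<lambda>f. f 0) ` \<F>)}"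
      and ind: "family_indep B (\<lambda>b. lk (g b t))"
    have "card ((\<lambda>b. g b t) ` B) \<le> K.dim ((\<lambda>f. f t) ` \<F>)"
      by (rule K.card_le_dim(2)[OF family_indep_imp_independent(2)[OF finB ind] _ sub B0(1)])
        (use g in auto)
    then show False
      using lt card_image[OF family_indep_imp_independent(1)[OF finB ind]] B(3) by simp
  qed
qed

section \<open>Noetherianity\<close>

lemma incseq_subseq_nat:
  fixes f :: "nat \<Rightarrow> nat"
  obtains r where "strict_mono r" "incseq (f \<circ> r)"
proof -
  obtain s where s: "strict_mono s" "monoseq (\<lambda>n. f (s n))" using seq_monosub[of f] by blast
  show ?thesis
  proof (cases "incseq (\<lambda>n. f (s n))")
    case True
    then show ?thesis using s that[of s] by (simp add: comp_def)
  next
    case False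
    then have dec: "decseq (\<lambda>n. f (s n))" using s(2) by (simp add: monoseq_iff)
    \<comment> \<open>A decreasing sequence of naturals is constant from the place where its least
      value occurs.\<close>
    define v where "v = (LEAST a. \<exists>n. f (s n) = a)"
    obtain N where N: "f (s N) = v" unfolding v_def using LeastI_ex[of "\<lambda>a. \<exists>n. f (s n) = a"] by blast
    have "f (s (N + n)) = v" for n
    proof (rule antisym)
      show "f (s (N + n)) \<le> v" using decseqD[OF dec, of N "N + n"] N by simp
      show "v \<le> f (s (N + n))" unfolding v_def by (rule Least_le) blast
    qed
    then have "incseq (f \<circ> (\<lambda>n. s (N + n)))" by (simp add: incseq_def)
    moreover have "strict_mono (\<lambda>n. s (N + n))" using s(1) by (simp add: strict_mono_def)
    ultimately show ?thesis using that by blast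
  qed
qed

text \<open>Passing to subsequences variable by variable makes all exponents weakly increasing along
  one sequence; of any two of its members the first divides the second.\<close>

lemma dickson:
  fixes f :: "nat \<Rightarrow> 'n::finite \<Rightarrow>\<^sub>0 nat"
  obtains i j d where "i < j" "f j = f i + d"
proof -
  have subseq: "\<exists>r. strict_mono r \<and> (\<forall>x\<in>A. incseq (\<lambda>i. lk (f (r i)) x))" for A :: "'n set"
  proof (induction A rule: infinite_finite_induct)
    case empty
    then show ?case by (intro exI[of _ id]) (simp add: strict_mono_def)
  next
    case (insert x A)
    then obtain r where r: "strict_mono r" "\<forall>x\<in>A. incseq (\<lambda>i. lk (f (r i)) x)" by blast
    obtain s where s: "strict_mono s" "incseq ((\<lambda>i. lk (f (r i)) x) \<circ> s)"
      using incseq_subseq_nat[of "\<lambda>i. lk (f (r i)) x"] by blast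
    have "strict_mono (r \<circ> s)" using r s by (simp add: strict_mono_o)
    moreover have "incseq (\<lambda>i. lk (f ((r \<circ> s) i)) y)" if "y \<in> insert x A" for y
    proof (cases "y = x")
      case True
      then show ?thesis using s(2) by (simp add: comp_def)
    next
      case False
      then have "incseq (\<lambda>i. lk (f (r i)) y)" using r that by blast
      then show ?thesis
        using s(1) by (auto simp: incseq_def strict_mono_less_eq)
    qed
    ultimately show ?case by blast
  qed simp
  obtain r where r: "strict_mono r" "\<And>x. incseq (\<lambda>i. lk (f (r i)) x)"
    using subseq[of UNIV] by (metis UNIV_I)
  have "r 0 < r 1" using r(1) by (simp add: strict_mono_def)
  moreover have "f (r 1) = f (r 0) + (f (r 1) - f (r 0))"
    using incseqD[OF r(2), of 0 1] by (intro poly_mapping_eqI) (simp add: lookup_add lookup_minus)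
  ultimately show ?thesis by (rule that)
qed

text \<open>Transports the lexicographic order of \<open>nat \<Rightarrow>\<^sub>0 nat\<close> to monomials along an arbitrary
  enumeration of the variables. It is a well-order by Dickson's lemma.\<close>

definition monomial_key :: "('n::finite \<Rightarrow>\<^sub>0 nat) \<Rightarrow> nat \<Rightarrow>\<^sub>0 nat" where
  "monomial_key m = (\<Sum>x\<in>UNIV. single ((SOME c. inj c) x) (lk m x))"

lemma monomial_key_add: "monomial_key (m + m') = monomial_key m + monomial_key m'"
  by (simp add: monomial_key_def lookup_add single_add sum.distrib)

lemma monomial_key_inj: "monomial_key m = monomial_key m' \<longleftrightarrow> m = m'"
proof
  define c where "c = (SOME c :: 'a \<Rightarrow> nat. inj c)"
  have "\<exists>c :: 'a \<Rightarrow> nat. inj c" using finite_imp_inj_to_nat_seg[of "UNIV :: 'a set"] by auto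
  then have c: "inj c" unfolding c_def by (rule someI_ex)
  have "lk (monomial_key m) (c x) = lk m x" for m x
    by (simp add: monomial_key_def c_def[symmetric] lookup_sum lookup_single when_def inj_eq[OF c])
  then show "m = m'" if "monomial_key m = monomial_key m'"
    using that by (metis poly_mapping_eqI)
qed simp

text \<open>No exponent vector of naturals lies lexicographically below 0.\<close>

lemma monomial_key_le_add: "monomial_key m \<le> monomial_key (m + m')"
proof -
  have "\<not> monomial_key m' < 0"
    by (auto simp: less_poly_mapping.rep_eq less_fun_def)
  then show ?thesis
    using add_left_mono[of 0 "monomial_key m'" "monomial_key m"] unfolding monomial_key_add by (simp add: not_less)
qed

lemma wf_monomial_key: "wf {(m :: 'n::finite \<Rightarrow>\<^sub>0 nat, m'). monomial_key m < monomial_key m'}"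
  unfolding wf_iff_no_infinite_down_chain
proof
  assume "\<exists>f. \<forall>i. (f (Suc i), f i) \<in> {(m :: 'n \<Rightarrow>\<^sub>0 nat, m'). monomial_key m < monomial_key m'}"
  then obtain f where "\<forall>i. (f (Suc i), f i) \<in> {(m :: 'n \<Rightarrow>\<^sub>0 nat, m'). monomial_key m < monomial_key m'}" ..
  then have f: "monomial_key (f (Suc i)) < monomial_key (f i)" for i by simp
  obtain i j d where ij: "i < j" "f j = f i + d" by (rule dickson[of f])
  have "monomial_key (f j) < monomial_key (f i)"
    using lift_Suc_antimono_le[of "\<lambda>i. monomial_key (f i)" "Suc i" j] f[of i] f ij(1)
    by (metis Suc_leI le_less_trans less_imp_le)
  then show False using monomial_key_le_add[of "f i" d] ij(2) by simp
qed

section \<open>Leading monomials and Hilbert's basis theorem\<close>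

definition lead :: "('n::finite, 'k::comm_ring_1) mpoly \<Rightarrow> 'n \<Rightarrow>\<^sub>0 nat" where
  "lead f = (SOME m. m \<in> keys f \<and> (\<forall>m'\<in>keys f. monomial_key m' \<le> monomial_key m))"

lemma lead:
  assumes "f \<noteq> 0"
  shows "lead f \<in> keys f" "m \<in> keys f \<Longrightarrow> monomial_key m \<le> monomial_key (lead f)"
proof -
  let ?K = "monomial_key ` keys f"
  have "finite ?K" "?K \<noteq> {}" using assms by auto
  then have "Max ?K \<in> ?K" "\<forall>k\<in>?K. k \<le> Max ?K" by auto
  then have "\<exists>m. m \<in> keys f \<and> (\<forall>m'\<in>keys f. monomial_key m' \<le> monomial_key m)"
    by (metis (no_types, lifting) imageE imageI)
  from someI_ex[OF this] have *: "lead f \<in> keys f \<and> (\<forall>m'\<in>keys f. monomial_key m' \<le> monomial_key (lead f))"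
    unfolding lead_def .
  show "lead f \<in> keys f" using * by blast
  show "m \<in> keys f \<Longrightarrow> monomial_key m \<le> monomial_key (lead f)" using * by blast
qed

text \<open>If no finite subset generates \<open>J\<close>, choose successively \<open>g n \<in> J - \<langle>g 0, \<dots>, g (n-1)\<rangle>\<close> with
  least leading monomial; Dickson's lemma yields a reduction of some \<open>g j\<close> by an earlier \<open>g i\<close>.\<close>

lemma hilbert_basis:
  fixes J :: "('n::finite, 'k::field) mpoly set"
  assumes J: "S.subspace J"
  shows "\<exists>G. finite G \<and> G \<subseteq> J \<and> S.span G = J"
proof (rule ccontr)
  assume no: "\<nexists>G. finite G \<and> G \<subseteq> J \<and> S.span G = J"
  have ne: "J - S.span G \<noteq> {}" if "finite G" "G \<subseteq> J" for G
    using that no S.span_minimal[OF that(2) J] by auto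
  define P where "P g n r \<longleftrightarrow> r \<in> J - S.span (g ` {..<n}) \<and>
    (\<forall>h\<in>J - S.span (g ` {..<n}). \<not> monomial_key (lead h) < monomial_key (lead r))"
    for g :: "nat \<Rightarrow> ('n, 'k) mpoly" and n r
  have "\<exists>g. \<forall>n. P g n (g n)"
  proof (rule dependent_wellorder_choice)
    fix r and f g :: "nat \<Rightarrow> ('n, 'k) mpoly" and x assume "\<And>y. y < x \<Longrightarrow> f y = g y"
    then have "f ` {..<x} = g ` {..<x}" by auto
    then show "P f x r = P g x r" by (simp add: P_def)
  next
    fix x and f :: "nat \<Rightarrow> ('n, 'k) mpoly" assume "\<And>y. y < x \<Longrightarrow> P f y (f y)"
    then have "f ` {..<x} \<subseteq> J" by (auto simp: P_def)
    then have "lead ` (J - S.span (f ` {..<x})) \<noteq> {}" using ne[of "f ` {..<x}"] by auto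
    then obtain m0 where "m0 \<in> lead ` (J - S.span (f ` {..<x}))" by blast
    then have "\<exists>z\<in>lead ` (J - S.span (f ` {..<x})). \<forall>y. (y, z) \<in> {(m, m'). monomial_key m < monomial_key m'} \<longrightarrow>
        y \<notin> lead ` (J - S.span (f ` {..<x}))"
      by (rule wf_monomial_key[unfolded wf_eq_minimal, rule_format])
    then obtain z where z: "z \<in> lead ` (J - S.span (f ` {..<x}))"
      and zmin: "\<And>y. monomial_key y < monomial_key z \<Longrightarrow> y \<notin> lead ` (J - S.span (f ` {..<x}))"
      by (metis (mono_tags, lifting) case_prodI mem_Collect_eq)
    obtain r where r: "r \<in> J - S.span (f ` {..<x})" "z = lead r" using z by blast
    have "P f x r" unfolding P_def
    proof (intro conjI ballI notI)
      fix h assume h: "h \<in> J - S.span (f ` {..<x})" "monomial_key (lead h) < monomial_key (lead r)"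
      have "lead h \<notin> lead ` (J - S.span (f ` {..<x}))"
        by (rule zmin) (use h(2) r(2) in simp)
      then show False using h(1) by blast
    qed (rule r(1))
    then show "\<exists>r. P f x r" ..
  qed
  then obtain g where g: "\<And>n. P g n (g n)" by blast
  have g_ne: "g n \<noteq> 0" and g_J: "g n \<in> J" for n
    using g[of n] S.span_zero[of "g ` {..<n}"] by (auto simp: P_def)
  obtain i j d where ij: "i < j" "lead (g j) = lead (g i) + d" by (rule dickson[of "\<lambda>i. lead (g i)"])
  \<comment> \<open>\<open>s * g i\<close> has the leading term of \<open>g j\<close>. As i < j, the
    difference h stays outside the span, but its leading monomial is smaller, against the minimal
    choice of \<open>g j\<close>.\<close>
  define c where "c = lk (g j) (lead (g j)) / lk (g i) (lead (g i))"
  define s where "s = single d c"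
  define h where "h = g j - s * g i"
  have lc: "lk (g n) (lead (g n)) \<noteq> 0" for n
    using lead(1)[OF g_ne[of n]] by (simp add: in_keys_iff)
  have "h \<in> J" unfolding h_def by (intro S.subspace_diff S.subspace_scale J g_J)
  moreover have "h \<notin> S.span (g ` {..<j})"
  proof
    assume "h \<in> S.span (g ` {..<j})"
    moreover have "s * g i \<in> S.span (g ` {..<j})" using ij(1) by (intro S.span_scale S.span_base) auto
    ultimately have "h + s * g i \<in> S.span (g ` {..<j})" by (rule S.span_add)
    then show False using g[of j] by (simp add: P_def h_def)
  qed
  ultimately have min: "\<not> monomial_key (lead h) < monomial_key (lead (g j))" using g[of j] by (simp add: P_def)
  have "h \<noteq> 0" using \<open>h \<notin> S.span (g ` {..<j})\<close> S.span_zero by blast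
  have "lk (s * g i) (d + lead (g i)) = c * lk (g i) (lead (g i))"
    unfolding s_def by (rule lookup_mult_single)
  then have h0: "lk h (lead (g j)) = 0"
    using lc[of i] by (simp add: h_def lookup_minus ij(2) c_def add.commute)
  have "monomial_key m \<le> monomial_key (lead (g j))" if mh: "m \<in> keys h" for m
  proof -
    consider "m \<in> keys (g j)" | "m \<in> keys (s * g i)"
      using mh keys_diff[of "g j" "s * g i"] unfolding h_def by blast
    then show ?thesis
    proof cases
      case 2
      then obtain m' where "m' \<in> keys (g i)" "m = d + m'"
        using keys_mult[of s "g i"] by (auto simp: s_def split: if_splits)
      then show ?thesis using lead(2)[OF g_ne[of i], of m']
        by (simp add: ij(2) monomial_key_add add.commute add_right_mono)
    qed (use lead(2)[OF g_ne[of j]] in blast)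
  qed
  then have "monomial_key (lead h) \<le> monomial_key (lead (g j))" using lead(1)[OF \<open>h \<noteq> 0\<close>] by blast
  moreover have "lead h \<noteq> lead (g j)" using h0 lead(1)[OF \<open>h \<noteq> 0\<close>] by (auto simp: in_keys_iff)
  ultimately show False using min monomial_key_inj[of "lead h" "lead (g j)"] by simp
qed

section \<open>Submodules of free modules and chains of ideals\<close>

definition vecs :: "nat \<Rightarrow> (nat \<Rightarrow> ('n, 'k::comm_ring_1) mpoly) set" where
  "vecs n = {v. \<forall>t\<ge>n. v t = 0}"

lemma subspace_vecs: "V.subspace (vecs n)"
  by (rule V.subspaceI) (auto simp: vecs_def vscale_def)

lemma module_hom_eval: "Modules.module_hom vscale (*) (\<lambda>v. v n)"
  by unfold_locales (auto simp: vscale_def distrib_left)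

text \<open>Induction on the rank: the last coordinates of N form an ideal, finitely generated by
  \<open>hilbert_basis\<close>, and the vectors with last coordinate 0 have smaller rank. Lifts of
  the former generators together with generators of the latter span N.\<close>

lemma finitely_generated_submodule:
  fixes N :: "(nat \<Rightarrow> ('n::finite, 'k::field) mpoly) set"
  assumes "V.subspace N" "N \<subseteq> vecs n"
  shows "\<exists>G. finite G \<and> G \<subseteq> N \<and> V.span G = N"
  using assms
proof (induction n arbitrary: N)
  case 0
  then have "N = {0}" using V.subspace_0 by (fastforce simp: vecs_def fun_eq_iff)
  then show ?case by (intro exI[of _ "{}"]) simp
next
  case (Suc n)
  interpret e: Modules.module_hom vscale "(*)" "\<lambda>v. v n" by (rule module_hom_eval)
  have "S.subspace ((\<lambda>v. v n) ` N)" by (rule e.subspace_image[OF Suc.prems(1)])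
  then obtain G0 where G0: "finite G0" "G0 \<subseteq> (\<lambda>v. v n) ` N" "S.span G0 = (\<lambda>v. v n) ` N"
    using hilbert_basis by metis
  obtain L where L: "L \<subseteq> N" "finite L" "G0 = (\<lambda>v. v n) ` L"
    using finite_subset_image[OF G0(1,2)] by auto
  define N' where "N' = {v \<in> N. v n = 0}"
  have sub: "V.subspace N'"
  proof (rule V.subspaceI)
    show "0 \<in> N'" using V.subspace_0[OF Suc.prems(1)] by (simp add: N'_def)
    show "x + y \<in> N'" if "x \<in> N'" "y \<in> N'" for x y
      using that V.subspace_add[OF Suc.prems(1)] by (simp add: N'_def)
    show "vscale c x \<in> N'" if "x \<in> N'" for c x
      using that V.subspace_scale[OF Suc.prems(1), of x c] by (simp add: N'_def) (simp add: vscale_def)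
  qed
  have "N' \<subseteq> vecs n"
  proof
    fix v assume "v \<in> N'"
    then have "v n = 0" "\<forall>t\<ge>Suc n. v t = 0" using Suc.prems(2) by (auto simp: N'_def vecs_def)
    then have "v t = 0" if "t \<ge> n" for t using that by (cases "t = n") auto
    then show "v \<in> vecs n" by (simp add: vecs_def)
  qed
  then obtain G' where G': "finite G'" "G' \<subseteq> N'" "V.span G' = N'" using Suc.IH[OF sub] by blast
  have N'_N: "N' \<subseteq> N" by (simp add: N'_def)
  have "N \<subseteq> V.span (G' \<union> L)"
  proof
    fix v assume v: "v \<in> N"
    have "v n \<in> (\<lambda>v. v n) ` V.span L"
      using v G0(3) e.span_image[of L] L(3) by blast
    then obtain u where u: "u \<in> V.span L" "v n = u n" by blast
    have "u \<in> N" using u(1) V.span_minimal[OF L(1) Suc.prems(1)] by blast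
    then have "v - u \<in> N'" using v u(2) V.subspace_diff[OF Suc.prems(1)] by (simp add: N'_def)
    then have "(v - u) + u \<in> V.span (G' \<union> L)" unfolding V.span_Un using u(1) G'(3) by blast
    then show "v \<in> V.span (G' \<union> L)" by simp
  qed
  moreover have "V.span (G' \<union> L) \<subseteq> N"
    using V.span_minimal[OF _ Suc.prems(1)] G'(2) L(1) N'_N by (meson Un_least subset_trans)
  ultimately show ?case using G' L N'_N by (intro exI[of _ "G' \<union> L"]) auto
qed

text \<open>Each element of a finite generating set involves finitely many members of H. Applied to
  homogeneous vectors, this yields finite homogeneous generating sets.\<close>

lemma finite_subset_spans:
  fixes H :: "(nat \<Rightarrow> ('n::finite, 'k::field) mpoly) set"
  assumes "H \<subseteq> vecs n"
  obtains G where "finite G" "G \<subseteq> H" "V.span G = V.span H"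
proof -
  have "V.span H \<subseteq> vecs n" by (rule V.span_minimal[OF assms subspace_vecs])
  then obtain G where G: "finite G" "G \<subseteq> V.span H" "V.span G = V.span H"
    using finitely_generated_submodule[of "V.span H" n] V.subspace_span[of H] by metis
  have "\<exists>T. finite T \<and> T \<subseteq> H \<and> x \<in> V.span T" if "x \<in> V.span H" for x
    using that
  proof (induction rule: V.span_induct_alt)
    case base
    show ?case by (intro exI[of _ "{}"] conjI V.span_zero) simp_all
  next
    case (step c x y)
    then obtain T where "finite T" "T \<subseteq> H" "y \<in> V.span T" by metis
    then show ?case
      using step(1) by (intro exI[of _ "insert x T"] conjI V.span_add V.span_scale)
        (auto intro: V.span_base subsetD[OF V.span_mono, of T])
  qed
  then obtain T where T: "\<And>x. x \<in> G \<Longrightarrow> finite (T x) \<and> T x \<subseteq> H \<and> x \<in> V.span (T x)"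
    using G(2) by (metis subsetD)
  define U where "U = (\<Union>x\<in>G. T x)"
  have "G \<subseteq> V.span U"
  proof
    fix x assume x: "x \<in> G"
    then have "V.span (T x) \<subseteq> V.span U" by (intro V.span_mono) (auto simp: U_def)
    then show "x \<in> V.span U" using T[OF x] by (meson subsetD)
  qed
  then have "V.span H \<subseteq> V.span U" using V.span_minimal[of G "V.span U"] G(3) V.subspace_span by metis
  moreover have "U \<subseteq> H" using T by (auto simp: U_def)
  ultimately have "V.span U = V.span H" using V.span_mono by (metis subset_antisym)
  moreover have "finite U" using G(1) T by (auto simp: U_def)
  ultimately show ?thesis using that \<open>U \<subseteq> H\<close> by metis
qed

text \<open>The ascending chain condition, with larger ideals as smaller elements: the form required
  for Noetherian induction and for choosing a maximal colon ideal.\<close>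

lemma wf_ideals: "wf {(J', J :: ('n::finite, 'k::field) mpoly set). S.subspace J \<and> S.subspace J' \<and> J \<subset> J'}"
  unfolding wf_iff_no_infinite_down_chain
proof
  assume "\<exists>f. \<forall>i. (f (Suc i), f i) \<in> {(J', J :: ('n, 'k) mpoly set). S.subspace J \<and> S.subspace J' \<and> J \<subset> J'}"
  then obtain f :: "nat \<Rightarrow> ('n, 'k) mpoly set" where f: "\<And>i. S.subspace (f i)" "\<And>i. f i \<subset> f (Suc i)" by blast
  have mono: "f i \<subseteq> f j" if "i \<le> j" for i j
    using lift_Suc_mono_le[of f i j] f(2) that by (metis psubset_imp_subset)
  have "S.subspace (\<Union>i. f i)"
  proof (rule S.subspaceI)
    show "0 \<in> (\<Union>i. f i)" using S.subspace_0[OF f(1)] by (meson UN_I UNIV_I)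
    fix x y assume "x \<in> (\<Union>i. f i)" "y \<in> (\<Union>i. f i)"
    then obtain i j where "x \<in> f i" "y \<in> f j" by auto
    then have "x \<in> f (max i j)" "y \<in> f (max i j)" using mono[of i "max i j"] mono[of j "max i j"] by auto
    then have "x + y \<in> f (max i j)" by (rule S.subspace_add[OF f(1)])
    then show "x + y \<in> (\<Union>i. f i)" by blast
  next
    fix c x assume "x \<in> (\<Union>i. f i)"
    then obtain i where "x \<in> f i" by auto
    then have "c * x \<in> f i" by (rule S.subspace_scale[OF f(1)])
    then show "c * x \<in> (\<Union>i. f i)" by blast
  qed
  then obtain G where G: "finite G" "G \<subseteq> (\<Union>i. f i)" "S.span G = (\<Union>i. f i)" using hilbert_basis by metis
  have "\<exists>i. G \<subseteq> f i"
    using G(1,2)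
  proof (induction G)
    case (insert x G)
    then obtain i j where "G \<subseteq> f i" "x \<in> f j" by auto
    then have "insert x G \<subseteq> f (max i j)" using mono[of i "max i j"] mono[of j "max i j"] by auto
    then show ?case ..
  qed simp
  then obtain i where "G \<subseteq> f i" ..
  then have "f (Suc i) \<subseteq> f i" using S.span_minimal[of G "f i"] f(1) G(3) by auto
  then show False using f(2)[of i] by blast
qed

section \<open>Ideals of the polynomial ring\<close>

lemma mpoly_ring_simps [simp]:
  "carrier mpoly_ring = UNIV" "x \<otimes>\<^bsub>mpoly_ring\<^esub> y = x * y" "x \<oplus>\<^bsub>mpoly_ring\<^esub> y = x + y"
  "\<zero>\<^bsub>mpoly_ring\<^esub> = 0" "\<one>\<^bsub>mpoly_ring\<^esub> = 1"
  by (simp_all add: mpoly_ring_def ring_of_type_algebra_def)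

lemma cring_mpoly_ring: "cring mpoly_ring"
  unfolding mpoly_ring_def by (rule cring_from_type_algebra)

lemma ring_mpoly_ring: "ring mpoly_ring"
  using cring_mpoly_ring by (rule cring.axioms)

lemma ideal_mpoly_ring: "ideal J mpoly_ring \<longleftrightarrow> S.subspace J"
proof
  assume "ideal J mpoly_ring"
  then interpret ideal J mpoly_ring .
  show "S.subspace J"
    using additive_subgroup.zero_closed[OF additive_subgroup_axioms]
      additive_subgroup.a_closed[OF additive_subgroup_axioms] I_l_closed
    by (intro S.subspaceI) auto
next
  assume J: "S.subspace J"
  have "subgroup J (add_monoid mpoly_ring)"
  proof (rule group.subgroupI)
    show "group (add_monoid mpoly_ring)"
      by (rule abelian_group.a_group[OF ring.is_abelian_group[OF ring_mpoly_ring]])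
    fix a assume a: "a \<in> J"
    interpret ring mpoly_ring by (rule ring_mpoly_ring)
    have "\<ominus>\<^bsub>mpoly_ring\<^esub> a = - a"
      by (rule minus_equality) simp_all
    then show "inv\<^bsub>add_monoid mpoly_ring\<^esub> a \<in> J"
      using S.subspace_neg[OF J a] by (simp add: a_inv_def)
  qed (use J S.subspace_0 in \<open>auto intro: S.subspace_add\<close>)
  then show "ideal J mpoly_ring"
    using ring_mpoly_ring S.subspace_scale[OF J]
    by (intro idealI) (auto simp: mult.commute)
qed

lemma Idl_mpoly_ring: "Idl\<^bsub>mpoly_ring\<^esub> H = S.span H"
proof -
  interpret ring mpoly_ring by (rule ring_mpoly_ring)
  have "ideal (Idl\<^bsub>mpoly_ring\<^esub> H) mpoly_ring" by (rule genideal_ideal) simp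
  then have "S.subspace (Idl\<^bsub>mpoly_ring\<^esub> H)" by (simp add: ideal_mpoly_ring)
  moreover have "H \<subseteq> Idl\<^bsub>mpoly_ring\<^esub> H" by (rule genideal_self) simp
  ultimately have "S.span H \<subseteq> Idl\<^bsub>mpoly_ring\<^esub> H" by (intro S.span_minimal)
  moreover have "Idl\<^bsub>mpoly_ring\<^esub> H \<subseteq> S.span H"
    by (rule genideal_minimal) (auto simp: ideal_mpoly_ring S.span_superset)
  ultimately show ?thesis by blast
qed

lemma hom_ideal_span_homogeneous:
  assumes "H \<subseteq> (\<Union>d. fm d)"
  shows "hom_ideal (S.span H)"
proof -
  have "hcomp d f \<in> S.span H" if "f \<in> S.span H" for f d
    using that
  proof (induction arbitrary: d rule: S.span_induct_alt)
    case (step c x y)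
    then obtain e where "x \<in> fm e" using assms by blast
    then have "hcomp d (c * x + y) = hcomp (d - e) c * x + hcomp d y"
      by (simp add: hcomp_add hcomp_mult)
    then show ?case using step by (auto intro: S.span_add S.span_scale S.span_base)
  qed (simp add: S.span_zero)
  then show ?thesis by (simp add: hom_ideal_def)
qed

lemma homogeneous_ideal_imp_hom_ideal:
  assumes "homogeneous_ideal I"
  shows "hom_ideal I"
proof -
  obtain H where H: "H \<subseteq> (\<Union>d. forms d)" "I = S.span H"
    using assms unfolding homogeneous_ideal_def Idl_mpoly_ring by blast
  then have "H \<subseteq> (\<Union>d. fm d)" unfolding forms_eq_fm by blast
  then show ?thesis unfolding H(2) by (rule hom_ideal_span_homogeneous)
qed

text \<open>The e-th power of the irrelevant ideal, by
  \<open>irrelevant_ideal_power\<close>.\<close>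

definition min_degree_ge :: "nat \<Rightarrow> ('n::finite, 'k::comm_ring_1) mpoly set" where
  "min_degree_ge e = {f. \<forall>m\<in>keys f. e \<le> monomial_degree m}"

lemma subspace_min_degree_ge: "S.subspace (min_degree_ge e)"
proof (rule S.subspaceI)
  fix f g :: "('a, 'b) mpoly" assume "f \<in> min_degree_ge e" "g \<in> min_degree_ge e"
  then show "f + g \<in> min_degree_ge e" using keys_add[of f g] by (auto simp: min_degree_ge_def)
next
  fix c f :: "('a, 'b) mpoly" assume "f \<in> min_degree_ge e"
  then show "c * f \<in> min_degree_ge e"
    using keys_mult[of c f] by (fastforce simp: min_degree_ge_def)
qed (simp add: min_degree_ge_def)

lemma variable_factor:
  fixes m :: "'n::finite \<Rightarrow>\<^sub>0 nat"
  assumes "monomial_degree m > 0"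
  obtains x m' where "m = single x 1 + m'" "monomial_degree m = Suc (monomial_degree m')"
proof -
  have "m \<noteq> 0" using assms by auto
  then obtain x where x: "lk m x \<noteq> 0" by (auto simp: poly_mapping_eq_iff fun_eq_iff)
  have m: "m = single x 1 + (m - single x 1)"
    using x by (intro poly_mapping_eqI) (auto simp: lookup_add lookup_minus lookup_single when_def)
  have "monomial_degree m = Suc (monomial_degree (m - single x 1))"
    by (subst m) (simp only: mdeg_add mdeg_single plus_1_eq_Suc)
  with m show ?thesis by (rule that)
qed

lemma irrelevant_ideal_eq: "irrelevant_ideal = (min_degree_ge 1 :: ('n::finite, 'k::field) mpoly set)"
proof
  show "irrelevant_ideal \<subseteq> (min_degree_ge 1 :: ('n, 'k) mpoly set)"
    unfolding irrelevant_ideal_def Idl_mpoly_ring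
    by (rule S.span_minimal[OF _ subspace_min_degree_ge]) (auto simp: min_degree_ge_def variable_def)
  show "(min_degree_ge 1 :: ('n, 'k) mpoly set) \<subseteq> irrelevant_ideal"
  proof
    fix f :: "('n, 'k) mpoly" assume f: "f \<in> min_degree_ge 1"
    have "single m (lk f m) \<in> irrelevant_ideal" if m: "m \<in> keys f" for m
    proof -
      have "monomial_degree m > 0" using f m by (auto simp: min_degree_ge_def)
      then obtain x m' where "m = single x 1 + m'" by (rule variable_factor)
      then have "single m (lk f m) = single m' (lk f m) * variable x"
        by (simp add: variable_def mult_single add.commute)
      then show ?thesis
        unfolding irrelevant_ideal_def Idl_mpoly_ring by (metis S.span_base S.span_scale rangeI)
    qed
    then have "(\<Sum>m\<in>keys f. single m (lk f m)) \<in> irrelevant_ideal"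
      unfolding irrelevant_ideal_def Idl_mpoly_ring by (rule S.span_sum)
    then show "f \<in> irrelevant_ideal" using sum_singles[of "keys f" f] by simp
  qed
qed

lemma mem_irrelevant_ideal: "f \<in> irrelevant_ideal \<longleftrightarrow> lk f 0 = 0"
  for f :: "('n::finite, 'k::field) mpoly"
proof -
  have "1 \<le> monomial_degree m \<longleftrightarrow> m \<noteq> 0" for m :: "'n \<Rightarrow>\<^sub>0 nat"
    using mdeg_eq_0_iff[of m] by linarith
  then show ?thesis unfolding irrelevant_ideal_eq min_degree_ge_def by (auto simp: in_keys_iff)
qed

text \<open>A monomial of degree at least e + 1 splits off one variable, and the remaining factor
  has degree at least e.\<close>

lemma irrelevant_ideal_power:
  "irrelevant_ideal [^]\<^bsub>ideals_set mpoly_ring\<^esub> (e :: nat) = (min_degree_ge e :: ('n::finite, 'k::field) mpoly set)"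
proof (induction e)
  case 0
  show ?case by (simp add: ideals_set_def nat_pow_def min_degree_ge_def)
next
  case (Suc e)
  let ?P = "ideal_prod mpoly_ring (min_degree_ge e) (min_degree_ge 1) :: ('n, 'k) mpoly set"
  interpret ring "mpoly_ring :: ('n, 'k) mpoly ring" by (rule ring_mpoly_ring)
  have "irrelevant_ideal [^]\<^bsub>ideals_set mpoly_ring\<^esub> Suc e = ?P"
    using Suc by (simp add: ideals_set_def nat_pow_def irrelevant_ideal_eq)
  also have "?P = min_degree_ge (Suc e)"
  proof
    show "?P \<subseteq> min_degree_ge (Suc e)"
    proof
      fix f assume "f \<in> ?P"
      then show "f \<in> min_degree_ge (Suc e)"
      proof (induction f rule: ideal_prod.induct)
        case (prod i j)
        then show ?case using keys_mult[of i j] by (fastforce simp: min_degree_ge_def)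
      next
        case (sum s1 s2)
        then show ?case using S.subspace_add[OF subspace_min_degree_ge] by auto
      qed
    qed
    have "ideal ?P mpoly_ring"
      by (rule ideal_prod_is_ideal) (simp_all add: ideal_mpoly_ring subspace_min_degree_ge)
    then have P: "S.subspace ?P" by (simp add: ideal_mpoly_ring)
    show "min_degree_ge (Suc e) \<subseteq> ?P"
    proof
      fix f :: "('n, 'k) mpoly" assume f: "f \<in> min_degree_ge (Suc e)"
      have "single m (lk f m) \<in> ?P" if m: "m \<in> keys f" for m
      proof -
        have d: "monomial_degree m \<ge> Suc e" using f m by (auto simp: min_degree_ge_def)
        then have "monomial_degree m > 0" by simp
        then obtain x m' where m': "m = single x 1 + m'"
          "monomial_degree m = Suc (monomial_degree m')" by (rule variable_factor)
        have "single m' (lk f m) \<otimes>\<^bsub>mpoly_ring\<^esub> variable x \<in> ?P"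
          by (rule ideal_prod.prod) (use d m' in \<open>auto simp: min_degree_ge_def variable_def\<close>)
        then show ?thesis by (simp add: variable_def mult_single m'(1) add.commute)
      qed
      then have "(\<Sum>m\<in>keys f. single m (lk f m)) \<in> ?P"
        by (rule S.subspace_sum[OF P])
      then show "f \<in> ?P" using sum_singles[of "keys f" f] by simp
    qed
  qed
  finally show ?case .
qed

section \<open>Minimal graded free resolutions\<close>

lemma sum_fun_apply: "(\<Sum>i\<in>A. f i) t = (\<Sum>i\<in>A. (f i t :: 'a::comm_monoid_add))"
  by (induction A rule: infinite_finite_induct) auto

lemma vecs_closed:
  "0 \<in> vecs n" "x \<in> vecs n \<Longrightarrow> y \<in> vecs n \<Longrightarrow> x + y \<in> vecs n"
  "x \<in> vecs n \<Longrightarrow> y \<in> vecs n \<Longrightarrow> x - y \<in> vecs n" "x \<in> vecs n \<Longrightarrow> vscale c x \<in> vecs n"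
  by (auto simp: vecs_def vscale_def)

text \<open>Action of a matrix on coordinate functions, with value 0 outside its rows. Vectors with
  an explicit carrier would carry a dimension condition through every step; \<open>toV\<close>
  passes between the two.\<close>

definition mapv :: "('n, 'k::comm_ring_1) mpoly mat \<Rightarrow> (nat \<Rightarrow> ('n, 'k) mpoly) \<Rightarrow> nat \<Rightarrow> ('n, 'k) mpoly" where
  "mapv A v = (\<lambda>s. if s < dim_row A then \<Sum>t<dim_col A. A $$ (s, t) * v t else 0)"

text \<open>The part of degree d of the direct sum of the S(-e t).\<close>

definition gvec :: "(nat \<Rightarrow> nat) \<Rightarrow> int \<Rightarrow> (nat \<Rightarrow> ('n::finite, 'k::comm_ring_1) mpoly) set" where
  "gvec e d = {v. \<forall>t. v t \<in> fm (d - int (e t))}"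

definition vcomp :: "(nat \<Rightarrow> nat) \<Rightarrow> int \<Rightarrow> (nat \<Rightarrow> ('n::finite, 'k::comm_ring_1) mpoly) \<Rightarrow> nat \<Rightarrow> ('n, 'k) mpoly" where
  "vcomp e d v = (\<lambda>t. hcomp (d - int (e t)) (v t))"

lemma vcomp_gvec: "vcomp e d v \<in> gvec e d"
  by (simp add: vcomp_def gvec_def)

lemma vcomp_sum: "vcomp e d (\<Sum>i\<in>A. f i) = (\<Sum>i\<in>A. vcomp e d (f i))"
  by (rule ext) (simp add: vcomp_def sum_fun_apply hcomp_sum)

lemma vcomp_scale: "g \<in> gvec e d' \<Longrightarrow> vcomp e d (vscale a g) = vscale (hcomp (d - d') a) g"
proof
  fix t assume "g \<in> gvec e d'"
  then have "g t \<in> fm (d' - int (e t))" by (simp add: gvec_def)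
  from hcomp_mult[OF this, of "d - int (e t)" a]
  show "vcomp e d (vscale a g) t = vscale (hcomp (d - d') a) g t" by (simp add: vcomp_def vscale_def)
qed

lemma sum_vcomp:
  assumes "v \<in> vecs n"
  obtains D where "finite D" "v = (\<Sum>d\<in>D. vcomp e d v)"
proof
  let ?D = "\<Union>t<n. (\<lambda>m. mdeg m + int (e t)) ` keys (v t)"
  show "finite ?D" by auto
  show "v = (\<Sum>d\<in>?D. vcomp e d v)"
  proof
    fix t
    show "v t = (\<Sum>d\<in>?D. vcomp e d v) t"
    proof (cases "t < n")
      case True
      have "v t = (\<Sum>d\<in>(\<lambda>d. d - int (e t)) ` ?D. hcomp d (v t))"
        by (rule sum_hcomp) (use True in \<open>force+\<close>)
      also have "\<dots> = (\<Sum>d\<in>?D. hcomp (d - int (e t)) (v t))"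
        by (subst sum.reindex) (auto simp: inj_on_def)
      finally show ?thesis by (simp add: sum_fun_apply vcomp_def)
    qed (use assms in \<open>simp add: sum_fun_apply vcomp_def vecs_def\<close>)
  qed
qed

definition graded_submodule :: "nat \<Rightarrow> (nat \<Rightarrow> nat) \<Rightarrow> (nat \<Rightarrow> ('n::finite, 'k::comm_ring_1) mpoly) set \<Rightarrow> bool" where
  "graded_submodule n e N \<longleftrightarrow> V.subspace N \<and> N \<subseteq> vecs n \<and> (\<forall>v\<in>N. \<forall>d. vcomp e d v \<in> N)"

text \<open>A homogeneous generating set of least cardinality will do.\<close>

lemma minimal_homogeneous_generators:
  fixes N :: "(nat \<Rightarrow> ('n::finite, 'k::field) mpoly) set"
  assumes N: "graded_submodule n e N"
  obtains m :: nat and G e' where "inj_on G {..<m} \<and> (\<forall>t<m. G t \<in> N \<and> G t \<in> gvec e (int (e' t))) \<and>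
    V.span (G ` {..<m}) = N \<and>
    (\<forall>u. (\<Sum>t<m. vscale (u t) (G t)) = 0 \<longrightarrow> (\<forall>t<m. lk (u t) 0 = 0))"
proof -
  have sub: "V.subspace N" and vecs: "N \<subseteq> vecs n" and comp: "\<And>v d. v \<in> N \<Longrightarrow> vcomp e d v \<in> N"
    using N by (auto simp: graded_submodule_def)
  define H where "H = {v \<in> N. \<exists>d. v \<in> gvec e d}"
  have HN: "H \<subseteq> N" by (auto simp: H_def)
  have "N \<subseteq> V.span H"
  proof
    fix v assume v: "v \<in> N"
    then have "v \<in> vecs n" using vecs by blast
    then obtain D where "finite D" "v = (\<Sum>d\<in>D. vcomp e d v)" by (rule sum_vcomp)
    moreover have "vcomp e d v \<in> H" for d using comp[OF v] vcomp_gvec[of e d v] by (auto simp: H_def)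
    then have "(\<Sum>d\<in>D. vcomp e d v) \<in> V.span H" by (intro V.span_sum V.span_base)
    ultimately show "v \<in> V.span H" by simp
  qed
  then have spanH: "V.span H = N" using V.span_minimal[OF HN sub] by blast
  define P where "P G \<longleftrightarrow> finite G \<and> G \<subseteq> H \<and> V.span G = N" for G
  have "H \<subseteq> vecs n" using HN vecs by blast
  then obtain G1 where "finite G1" "G1 \<subseteq> H" "V.span G1 = V.span H" by (rule finite_subset_spans)
  then have "P G1" by (simp add: P_def spanH)
  then obtain G0 where G0: "P G0" and min: "\<And>G. P G \<Longrightarrow> card G0 \<le> card G"
    using ex_has_least_nat[of P G1 card] by blast
  have irred: "g \<notin> V.span (G0 - {g})" if g: "g \<in> G0" for g
  proof
    assume "g \<in> V.span (G0 - {g})"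
    then have "G0 \<subseteq> V.span (G0 - {g})" using V.span_superset[of "G0 - {g}"] by blast
    then have "V.span G0 \<subseteq> V.span (G0 - {g})" by (rule V.span_minimal) simp
    then have "V.span (G0 - {g}) = N"
      using V.span_mono[of "G0 - {g}" G0] G0 by (auto simp: P_def)
    then have "P (G0 - {g})" using G0 by (auto simp: P_def)
    moreover have "card (G0 - {g}) < card G0" using g G0 by (intro card_Diff1_less) (auto simp: P_def)
    ultimately show False using min[of "G0 - {g}"] by simp
  qed
  define m where "m = card G0"
  obtain G where bij: "bij_betw G {..<m} G0"
    using ex_bij_betw_nat_finite[of G0] G0 by (auto simp: P_def m_def atLeast0LessThan)
  then have img: "G ` {..<m} = G0" and inj: "inj_on G {..<m}" by (auto simp: bij_betw_def)
  have GH: "G t \<in> H" if "t < m" for t using that img G0 by (auto simp: P_def)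
  \<comment> \<open>A nonzero homogeneous vector has degree at least some \<open>e s\<close>, so
    converting the degree to a natural number loses nothing.\<close>
  define e' where "e' t = nat (SOME d. G t \<in> gvec e d)" for t
  have e': "G t \<in> gvec e (int (e' t))" if t: "t < m" for t
  proof -
    define d where "d = (SOME d. G t \<in> gvec e d)"
    have "\<exists>d. G t \<in> gvec e d" using GH[OF t] by (auto simp: H_def)
    then have d: "G t \<in> gvec e d" unfolding d_def by (rule someI_ex)
    have "G t \<in> G0" using img t by auto
    then have "G t \<noteq> 0" using irred[of "G t"] V.span_zero by metis
    then obtain s where "G t s \<noteq> 0" by (auto simp: fun_eq_iff)
    then have "d \<ge> int (e s)" using d fm_negative[of "G t s" "d - int (e s)"] by (force simp: gvec_def)
    then show ?thesis using d by (simp add: e'_def d_def[symmetric])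
  qed
  have "lk (u t0) 0 = 0" if u: "(\<Sum>t<m. vscale (u t) (G t)) = 0" and t0: "t0 < m" for u t0
  proof (rule ccontr)
    define c where "c = lk (u t0) 0"
    assume "lk (u t0) 0 \<noteq> 0"
    then have c: "c \<noteq> 0" by (simp add: c_def)
    \<comment> \<open>In the component of degree \<open>e' t0\<close> of the relation the
      coefficient of \<open>G t0\<close> is reduced to its constant term c. As c is nonzero,
      \<open>G t0\<close> is a combination of the other generators.\<close>
    define w where "w t = hcomp (int (e' t0) - int (e' t)) (u t)" for t
    have "vcomp e (int (e' t0)) (\<Sum>t<m. vscale (u t) (G t)) = (\<Sum>t<m. vscale (w t) (G t))"
      unfolding vcomp_sum w_def by (rule sum.cong) (use e' in \<open>auto simp: vcomp_scale\<close>)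
    moreover have "vcomp e (int (e' t0)) 0 = (0 :: nat \<Rightarrow> ('n, 'k) mpoly)"
      by (rule ext) (simp add: vcomp_def)
    ultimately have "(\<Sum>t<m. vscale (w t) (G t)) = 0" using u by simp
    then have "vscale (w t0) (G t0) + (\<Sum>t\<in>{..<m} - {t0}. vscale (w t) (G t)) = 0"
      using t0 by (subst (asm) sum.remove[of _ t0]) auto
    then have "vscale (w t0) (G t0) = - (\<Sum>t\<in>{..<m} - {t0}. vscale (w t) (G t))"
      by (simp add: add_eq_0_iff2)
    moreover have "G t \<in> G0 - {G t0}" if "t \<in> {..<m} - {t0}" for t
      using that img inj_onD[OF inj, of t t0] t0 by auto
    then have "- (\<Sum>t\<in>{..<m} - {t0}. vscale (w t) (G t)) \<in> V.span (G0 - {G t0})"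
      by (intro V.span_neg V.span_sum V.span_scale V.span_base)
    ultimately have "vscale (cst (inverse c)) (vscale (w t0) (G t0)) \<in> V.span (G0 - {G t0})"
      by (simp only: V.span_scale)
    moreover have "w t0 = cst c"
      unfolding w_def c_def by (rule poly_mapping_eqI) (auto simp: lookup_hcomp lookup_single when_def)
    then have "vscale (cst (inverse c)) (vscale (w t0) (G t0)) = G t0"
      using c by (simp add: vscale_def mult.assoc[symmetric] mult_single)
    ultimately show False using irred[of "G t0"] img t0 by auto
  qed
  then show ?thesis
    using inj GH e' HN img G0
    by (intro that[of G m e']) (auto simp: P_def)
qed

section \<open>Homogeneous matrices and their kernels\<close>

definition homogeneous_mat :: "('n::finite, 'k::comm_ring_1) mpoly mat \<Rightarrow> (nat \<Rightarrow> nat) \<Rightarrow> (nat \<Rightarrow> nat) \<Rightarrow> bool" where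
  "homogeneous_mat A e e' \<longleftrightarrow>
     (\<forall>s<dim_row A. \<forall>t<dim_col A. A $$ (s, t) \<in> fm (int (e' t) - int (e s)))"

definition kerv :: "('n, 'k::comm_ring_1) mpoly mat \<Rightarrow> (nat \<Rightarrow> ('n, 'k) mpoly) set" where
  "kerv A = {u \<in> vecs (dim_col A). mapv A u = 0}"

text \<open>For homogeneous A this says that the columns generate their image minimally. In a
  resolution it is the minimality of the following map, whose image is the kernel of A.\<close>

definition minimal_mat :: "('n, 'k::comm_ring_1) mpoly mat \<Rightarrow> bool" where
  "minimal_mat A \<longleftrightarrow> (\<forall>u\<in>kerv A. \<forall>t. lk (u t) 0 = 0)"

text \<open>One step of the resolution: minimal homogeneous generators become the columns of A. The
  kernel of A is graded again by \<open>graded_submodule_kerv\<close>, so the step can be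
  repeated.\<close>

lemma presentation_step:
  fixes N :: "(nat \<Rightarrow> ('n::finite, 'k::field) mpoly) set"
  assumes N: "graded_submodule n e N"
  shows "\<exists>A e'. dim_row A = n \<and> homogeneous_mat A e e' \<and> mapv A ` vecs (dim_col A) = N \<and> minimal_mat A"
proof -
  obtain m :: nat and G e' where *: "inj_on G {..<m} \<and> (\<forall>t<m. G t \<in> N \<and> G t \<in> gvec e (int (e' t))) \<and>
    V.span (G ` {..<m}) = N \<and>
    (\<forall>u. (\<Sum>t<m. vscale (u t) (G t)) = 0 \<longrightarrow> (\<forall>t<m. lk (u t) 0 = 0))"
    by (rule minimal_homogeneous_generators[OF N])
  then have inj: "inj_on G {..<m}" and G: "\<And>t. t < m \<Longrightarrow> G t \<in> N \<and> G t \<in> gvec e (int (e' t))"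
    and span: "V.span (G ` {..<m}) = N"
    and min: "\<And>u t. (\<Sum>t<m. vscale (u t) (G t)) = 0 \<Longrightarrow> t < m \<Longrightarrow> lk (u t) 0 = 0"
    by auto
  define A where "A = mat n m (\<lambda>(s, t). G t s)"
  have dims: "dim_row A = n" "dim_col A = m" by (simp_all add: A_def)
  have GN: "G t s = 0" if "t < m" "s \<ge> n" for t s
    using G[OF that(1)] N that(2) by (auto simp: graded_submodule_def vecs_def)
  have map: "mapv A u = (\<Sum>t<m. vscale (u t) (G t))" for u
    by (rule ext) (auto simp: mapv_def dims sum_fun_apply vscale_def A_def GN mult.commute intro!: sum.cong)
  have "homogeneous_mat A e e'"
    using G by (auto simp: homogeneous_mat_def dims A_def gvec_def)
  moreover have "mapv A ` vecs (dim_col A) = N"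
  proof
    show "mapv A ` vecs (dim_col A) \<subseteq> N"
    proof (rule image_subsetI)
      fix u
      have "(\<Sum>t<m. vscale (u t) (G t)) \<in> V.span (G ` {..<m})"
        by (rule V.span_sum, rule V.span_scale, rule V.span_base) simp
      then show "mapv A u \<in> N" by (simp add: map span)
    qed
    show "N \<subseteq> mapv A ` vecs (dim_col A)"
    proof
      fix v assume "v \<in> N"
      then obtain u where "v = (\<Sum>g\<in>G ` {..<m}. vscale (u g) g)"
        using V.span_finite[of "G ` {..<m}"] span by auto
      then have "v = (\<Sum>t<m. vscale (u (G t)) (G t))" by (simp add: sum.reindex[OF inj])
      also have "\<dots> = mapv A (\<lambda>t. if t < m then u (G t) else 0)"
        unfolding map by (rule sum.cong) auto
      finally show "v \<in> mapv A ` vecs (dim_col A)"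
        by (auto simp: vecs_def dims)
    qed
  qed
  moreover have "minimal_mat A"
    unfolding minimal_mat_def
  proof (intro ballI allI)
    fix u t assume u: "u \<in> kerv A"
    show "lk (u t) 0 = 0"
    proof (cases "t < m")
      case True
      then show ?thesis using min[of u t] u by (simp add: kerv_def map)
    qed (use u in \<open>simp add: kerv_def vecs_def dims\<close>)
  qed
  ultimately show ?thesis using dims(1) by blast
qed

lemma mapv_add: "mapv A (u + v) = mapv A u + mapv A v"
  by (rule ext) (simp add: mapv_def distrib_left sum.distrib)

lemma mapv_diff: "mapv A (u - v) = mapv A u - mapv A v"
  using mapv_add[of A "u - v" v] by simp

lemma mapv_scale: "mapv A (vscale a u) = vscale a (mapv A u)"
proof
  fix s
  have "(\<Sum>t<dim_col A. A $$ (s, t) * (a * u t)) = (\<Sum>t<dim_col A. a * (A $$ (s, t) * u t))"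
    by (intro sum.cong refl mult.left_commute)
  then show "mapv A (vscale a u) s = vscale a (mapv A u) s"
    by (cases "s < dim_row A") (simp_all only: mapv_def vscale_def sum_distrib_left if_True if_False mult_zero_right)
qed

lemma mapv_vcomp:
  assumes "homogeneous_mat A e e'"
  shows "mapv A (vcomp e' d u) = vcomp e d (mapv A u)"
proof
  fix s
  show "mapv A (vcomp e' d u) s = vcomp e d (mapv A u) s"
  proof (cases "s < dim_row A")
    case True
    have "hcomp (d - int (e s)) (A $$ (s, t) * u t) = A $$ (s, t) * hcomp (d - int (e' t)) (u t)"
      if "t < dim_col A" for t
    proof -
      have "A $$ (s, t) \<in> fm (int (e' t) - int (e s))"
        using assms True that by (simp add: homogeneous_mat_def)
      then show ?thesis by (simp add: hcomp_mult')
    qed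
    then show ?thesis using True by (simp add: mapv_def vcomp_def hcomp_sum)
  qed (simp add: mapv_def vcomp_def)
qed

lemma graded_submodule_kerv:
  assumes "homogeneous_mat A e e'"
  shows "graded_submodule (dim_col A) e' (kerv A)"
  unfolding graded_submodule_def
proof (intro conjI ballI allI)
  have 0: "mapv A 0 = 0" by (rule ext) (simp add: mapv_def)
  show "V.subspace (kerv A)"
  proof (rule V.subspaceI)
    show "0 \<in> kerv A" using 0 by (simp add: kerv_def vecs_closed)
    show "x + y \<in> kerv A" if "x \<in> kerv A" "y \<in> kerv A" for x y
      using that by (simp add: kerv_def mapv_add vecs_closed)
    show "vscale c x \<in> kerv A" if "x \<in> kerv A" for c x
      using that by (simp add: kerv_def mapv_scale vecs_closed)
  qed
  fix v d assume "v \<in> kerv A"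
  then show "vcomp e' d v \<in> kerv A"
    using mapv_vcomp[OF assms, of d v] by (auto simp: kerv_def vecs_def vcomp_def fun_eq_iff)
qed (auto simp: kerv_def)

section \<open>Passage to the vectors and kernels of the matrix library\<close>

definition toV :: "'a::zero vec \<Rightarrow> nat \<Rightarrow> 'a" where
  "toV u = (\<lambda>t. if t < dim_vec u then u $ t else 0)"

lemma toV_inj: "inj_on toV (carrier_vec n)"
proof (rule inj_onI)
  fix u v :: "'a vec" assume uv: "u \<in> carrier_vec n" "v \<in> carrier_vec n" "toV u = toV v"
  then have "u $ i = v $ i" if "i < n" for i
  proof -
    have "toV u i = toV v i" by (simp only: uv(3))
    moreover have "i < dim_vec u" "i < dim_vec v" using uv(1,2) that by auto
    ultimately show ?thesis by (simp only: toV_def if_True)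
  qed
  then show "u = v" using uv by (intro eq_vecI) auto
qed

lemma toV_carrier: "toV ` carrier_vec n = (vecs n :: (nat \<Rightarrow> ('n, 'k::comm_ring_1) mpoly) set)"
proof
  show "toV ` carrier_vec n \<subseteq> (vecs n :: (nat \<Rightarrow> ('n, 'k) mpoly) set)"
    by (auto simp: toV_def vecs_def)
  show "(vecs n :: (nat \<Rightarrow> ('n, 'k) mpoly) set) \<subseteq> toV ` carrier_vec n"
  proof
    fix v :: "nat \<Rightarrow> ('n, 'k) mpoly" assume "v \<in> vecs n"
    then have "v = toV (vec n v)" by (auto simp: toV_def vecs_def fun_eq_iff)
    then show "v \<in> toV ` carrier_vec n" by (metis imageI vec_carrier)
  qed
qed

lemma toV_mult:
  assumes "u \<in> carrier_vec (dim_col A)"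
  shows "toV (A *\<^sub>v u) = mapv A (toV u)"
  using assms
  by (auto simp: toV_def mapv_def fun_eq_iff scalar_prod_def atLeast0LessThan intro!: sum.cong)

lemma toV_image_mult:
  "toV ` ((\<lambda>v. A *\<^sub>v v) ` carrier_vec (dim_col A)) = mapv A ` vecs (dim_col A)"
  unfolding toV_carrier[symmetric] image_image by (rule image_cong) (simp_all add: toV_mult)

lemma toV_0: "toV (0\<^sub>v n) = 0"
  by (simp add: toV_def fun_eq_iff)

lemma toV_mat_kernel: "toV ` mat_kernel A = kerv A"
proof -
  have "A *\<^sub>v v = 0\<^sub>v (dim_row A) \<longleftrightarrow> mapv A (toV v) = 0" if "v \<in> carrier_vec (dim_col A)" for v
  proof -
    have "A *\<^sub>v v = 0\<^sub>v (dim_row A) \<longleftrightarrow> toV (A *\<^sub>v v) = toV (0\<^sub>v (dim_row A))"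
      by (rule inj_on_eq_iff[symmetric, OF toV_inj[of "dim_row A"]]) (simp_all add: carrier_vecI)
    then show ?thesis by (simp only: toV_mult[OF that] toV_0)
  qed
  then have "mat_kernel A = {v \<in> carrier_vec (dim_col A). mapv A (toV v) = 0}"
    by (auto simp: mat_kernel_def)
  then show ?thesis unfolding kerv_def toV_carrier[symmetric] by auto
qed

lemma fm_int_diff:
  "f \<in> fm (int b - int a) \<longleftrightarrow> f = 0 \<or> a \<le> b \<and> f \<in> forms (b - a)"
proof (cases "a \<le> b")
  case True
  then show ?thesis by (auto simp: forms_eq_fm of_nat_diff)
next
  case False
  then show ?thesis using fm_negative[of f "int b - int a"] by auto
qed

text \<open>The definition on coordinate functions. I appears as a submodule of the free module of
  rank 1, and integer degrees absorb the case distinction for zero entries, as only 0 has negative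
  degree.\<close>

lemma graded_free_resolution_alt:
  fixes I :: "('n::finite, 'k::field) mpoly set"
  shows "graded_free_resolution I \<phi> e \<longleftrightarrow>
    dim_row (\<phi> 0) = 1 \<and> (\<forall>i. dim_row (\<phi> (Suc i)) = dim_col (\<phi> i)) \<and>
    homogeneous_mat (\<phi> 0) (\<lambda>_. 0) (e 0) \<and> (\<forall>i. homogeneous_mat (\<phi> (Suc i)) (e i) (e (Suc i))) \<and>
    mapv (\<phi> 0) ` vecs (dim_col (\<phi> 0)) = {v \<in> vecs 1. v 0 \<in> I} \<and>
    (\<forall>i. mapv (\<phi> (Suc i)) ` vecs (dim_col (\<phi> (Suc i))) = kerv (\<phi> i))"
proof (cases "dim_row (\<phi> 0) = 1 \<and> (\<forall>i. dim_row (\<phi> (Suc i)) = dim_col (\<phi> i))")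
  case True
  then have r0: "dim_row (\<phi> 0) = 1" and r: "\<And>i. dim_row (\<phi> (Suc i)) = dim_col (\<phi> i)" by auto
  have "(\<lambda>v. \<phi> (Suc i) *\<^sub>v v) ` carrier_vec (dim_col (\<phi> (Suc i))) = mat_kernel (\<phi> i) \<longleftrightarrow>
      mapv (\<phi> (Suc i)) ` vecs (dim_col (\<phi> (Suc i))) = kerv (\<phi> i)" for i
    unfolding toV_image_mult[symmetric] toV_mat_kernel[symmetric]
    by (rule inj_on_image_eq_iff[OF toV_inj[of "dim_col (\<phi> i)"], symmetric])
      (intro image_subsetI carrier_vecI, simp add: r, auto simp: mat_kernel_def)
  moreover have "(\<lambda>v. (\<phi> 0 *\<^sub>v v) $ 0) ` carrier_vec (dim_col (\<phi> 0)) = I \<longleftrightarrow>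
      mapv (\<phi> 0) ` vecs (dim_col (\<phi> 0)) = {v \<in> vecs 1. v 0 \<in> I}"
  proof -
    let ?c = "\<lambda>f t. if t = 0 then f else 0 :: ('n, 'k) mpoly"
    have "toV v = ?c (v $ 0)" if "dim_vec v = 1" for v
      using that by (auto simp: toV_def fun_eq_iff)
    then have "mapv (\<phi> 0) ` vecs (dim_col (\<phi> 0)) = ?c ` ((\<lambda>v. (\<phi> 0 *\<^sub>v v) $ 0) ` carrier_vec (dim_col (\<phi> 0)))"
      unfolding toV_image_mult[symmetric] image_image by (intro image_cong) (simp_all add: r0)
    moreover have "{v \<in> vecs 1. v 0 \<in> I} = ?c ` I"
    proof
      show "{v \<in> vecs 1. v 0 \<in> I} \<subseteq> ?c ` I"
      proof
        fix v assume v: "v \<in> {v \<in> vecs 1. v 0 \<in> I}"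
        then have "v = ?c (v 0)" by (auto simp: vecs_def fun_eq_iff)
        then show "v \<in> ?c ` I" using v by blast
      qed
    qed (auto simp: vecs_def)
    moreover have c: "inj ?c" by (rule injI) (metis (full_types))
    ultimately show ?thesis by (simp only: inj_image_eq_iff[OF c])
  qed
  moreover have "homogeneous_mat (\<phi> 0) (\<lambda>_. 0) (e 0) \<longleftrightarrow> (\<forall>t < dim_col (\<phi> 0). \<phi> 0 $$ (0, t) \<in> forms (e 0 t))"
    by (simp add: homogeneous_mat_def r0 forms_eq_fm)
  moreover have "homogeneous_mat (\<phi> (Suc i)) (e i) (e (Suc i)) \<longleftrightarrow>
     (\<forall>s < dim_col (\<phi> i). \<forall>t < dim_col (\<phi> (Suc i)).
        \<phi> (Suc i) $$ (s, t) = 0 \<or>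
        e i s \<le> e (Suc i) t \<and> \<phi> (Suc i) $$ (s, t) \<in> forms (e (Suc i) t - e i s))" for i
    unfolding homogeneous_mat_def r fm_int_diff by blast
  ultimately show ?thesis unfolding graded_free_resolution_def using True by simp
qed (auto simp: graded_free_resolution_def)

lemma minimal_resolution_exists:
  fixes I :: "('n::finite, 'k::field) mpoly set"
  assumes "hom_ideal I"
  shows "\<exists>\<phi> e. minimal_graded_free_resolution I \<phi> e"
proof -
  define N0 where "N0 = {v \<in> vecs 1. v 0 \<in> I}"
  have N0: "graded_submodule 1 (\<lambda>_. 0) N0"
    unfolding graded_submodule_def
  proof (intro conjI ballI allI)
    show "V.subspace N0"
    proof (rule V.subspaceI)
      show "0 \<in> N0" using hom_idealD(1)[OF assms] by (simp add: N0_def vecs_closed)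
      show "x + y \<in> N0" if "x \<in> N0" "y \<in> N0" for x y
        using that hom_idealD(2)[OF assms] by (simp add: N0_def vecs_closed)
      show "vscale c x \<in> N0" if "x \<in> N0" for c x
        using that hom_idealD(4)[OF assms] by (simp add: N0_def vecs_closed) (simp add: vscale_def)
    qed
    show "vcomp (\<lambda>_. 0) d v \<in> N0" if "v \<in> N0" for v d
      using that hom_idealD(6)[OF assms] by (auto simp: N0_def vecs_def vcomp_def)
  qed (auto simp: N0_def)
  \<comment> \<open>The state also carries the degrees of rows and columns: the column degrees of
    one matrix are the row degrees of the next.\<close>
  define P where "P i x \<longleftrightarrow> (case x of (A, er, ec) \<Rightarrow> homogeneous_mat A er ec \<and> minimal_mat A \<and>
      (i = 0 \<longrightarrow> dim_row A = 1 \<and> er = (\<lambda>_. 0) \<and> mapv A ` vecs (dim_col A) = N0))"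
    for i :: nat and x :: "('n, 'k) mpoly mat \<times> (nat \<Rightarrow> nat) \<times> (nat \<Rightarrow> nat)"
  define Q where "Q x y \<longleftrightarrow> (case x of (A, er, ec) \<Rightarrow> case y of (A', er', ec') \<Rightarrow>
      er' = ec \<and> dim_row A' = dim_col A \<and> mapv A' ` vecs (dim_col A') = kerv A)"
    for x y :: "('n, 'k) mpoly mat \<times> (nat \<Rightarrow> nat) \<times> (nat \<Rightarrow> nat)"
  have "\<exists>f. \<forall>i. P i (f i) \<and> Q (f i) (f (Suc i))"
  proof (rule dependent_nat_choice)
    obtain A e' where "dim_row A = 1 \<and> homogeneous_mat A (\<lambda>_. 0) e' \<and>
        mapv A ` vecs (dim_col A) = N0 \<and> minimal_mat A"
      using presentation_step[OF N0] by blast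
    then show "\<exists>x. P 0 x" by (intro exI[of _ "(A, \<lambda>_. 0, e')"]) (simp add: P_def)
  next
    fix x i assume "P i x"
    moreover obtain A er ec where x: "x = (A, er, ec)" by (rule prod_cases3)
    ultimately have "homogeneous_mat A er ec" by (simp add: P_def)
    from presentation_step[OF graded_submodule_kerv[OF this]] obtain A' e' where
      "dim_row A' = dim_col A \<and> homogeneous_mat A' ec e' \<and>
        mapv A' ` vecs (dim_col A') = kerv A \<and> minimal_mat A'" by blast
    then show "\<exists>y. P (Suc i) y \<and> Q x y"
      by (intro exI[of _ "(A', ec, e')"]) (simp add: P_def Q_def x)
  qed
  then obtain f where f: "\<And>i. P i (f i)" "\<And>i. Q (f i) (f (Suc i))" by blast
  define \<phi> where "\<phi> i = fst (f i)" for i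
  define e where "e i = snd (snd (f i))" for i
  define er where "er i = fst (snd (f i))" for i
  have fi: "f i = (\<phi> i, er i, e i)" for i by (simp add: \<phi>_def e_def er_def)
  have P: "homogeneous_mat (\<phi> i) (er i) (e i)" "minimal_mat (\<phi> i)" for i
    using f(1)[of i] by (simp_all add: P_def fi)
  have P0: "dim_row (\<phi> 0) = 1" "er 0 = (\<lambda>_. 0)" "mapv (\<phi> 0) ` vecs (dim_col (\<phi> 0)) = N0"
    using f(1)[of 0] by (simp_all add: P_def fi)
  have Q: "er (Suc i) = e i" "dim_row (\<phi> (Suc i)) = dim_col (\<phi> i)"
    "mapv (\<phi> (Suc i)) ` vecs (dim_col (\<phi> (Suc i))) = kerv (\<phi> i)" for i
    using f(2)[of i] by (simp_all add: Q_def fi)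
  have "graded_free_resolution I \<phi> e"
    unfolding graded_free_resolution_alt
    using P(1)[of 0] P(1)[of "Suc _"] P0 Q by (simp add: N0_def)
  moreover have "\<phi> (Suc i) $$ (s, t) \<in> irrelevant_ideal"
    if "s < dim_col (\<phi> i)" "t < dim_col (\<phi> (Suc i))" for i s t
  proof -
    \<comment> \<open>The t-th column is the image of a basis vector and thus lies in the kernel of
      \<open>\<phi> i\<close>, whose vectors have no constant terms by
      \<open>minimal_mat\<close>.\<close>
    let ?u = "\<lambda>t'. if t' = t then 1 else 0 :: ('n, 'k) mpoly"
    have "?u \<in> vecs (dim_col (\<phi> (Suc i)))" using that by (auto simp: vecs_def)
    then have "mapv (\<phi> (Suc i)) ?u \<in> kerv (\<phi> i)" using Q(3)[of i] by blast
    then have "lk (mapv (\<phi> (Suc i)) ?u s) 0 = 0" using P(2)[of i] by (simp add: minimal_mat_def)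
    moreover have "mapv (\<phi> (Suc i)) ?u s = \<phi> (Suc i) $$ (s, t)"
    proof -
      have "mapv (\<phi> (Suc i)) ?u s = (\<Sum>t'<dim_col (\<phi> (Suc i)). \<phi> (Suc i) $$ (s, t') * ?u t')"
        using that by (simp add: mapv_def Q(2))
      also have "\<dots> = (\<Sum>t'<dim_col (\<phi> (Suc i)). if t' = t then \<phi> (Suc i) $$ (s, t) else 0)"
        by (rule sum.cong) auto
      also have "\<dots> = \<phi> (Suc i) $$ (s, t)" using that by simp
      finally show ?thesis .
    qed
    ultimately show ?thesis by (simp add: mem_irrelevant_ideal)
  qed
  ultimately show ?thesis unfolding minimal_graded_free_resolution_def by blast
qed

text \<open>As a simp rule this reverses \<open>mult.assoc\<close>.\<close>

declare S.scale_scale [simp del]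

section \<open>Almost regular linear forms\<close>

definition almost_regular :: "('n::finite, 'k::comm_ring_1) mpoly set \<Rightarrow> ('n, 'k) mpoly \<Rightarrow> bool" where
  "almost_regular J w \<longleftrightarrow> (\<exists>D. \<forall>d\<ge>D. \<forall>z\<in>fm d. w * z \<in> J \<longrightarrow> z \<in> J)"

definition colon :: "('n, 'k::comm_ring_1) mpoly set \<Rightarrow> ('n, 'k) mpoly \<Rightarrow> ('n, 'k) mpoly set" where
  "colon J z = {a. a * z \<in> J}"

lemma subspace_colon: "S.subspace J \<Longrightarrow> S.subspace (colon J z)"
proof (rule S.subspaceI)
  assume J: "S.subspace J"
  show "0 \<in> colon J z" using S.subspace_0[OF J] by (simp add: colon_def)
  show "x + y \<in> colon J z" if "x \<in> colon J z" "y \<in> colon J z" for x y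
    using that S.subspace_add[OF J] by (simp add: colon_def distrib_right)
  show "c * x \<in> colon J z" if "x \<in> colon J z" for c x
    using that S.subspace_scale[OF J, of "x * z" c] by (simp only: colon_def mem_Collect_eq mult.assoc)
qed

text \<open>Noetherian induction. For a form \<open>z \<notin> J\<close> with maximal \<open>colon J z\<close> this colon ideal is prime, and
  \<open>(J + \<langle>z\<rangle>) / J\<close> is \<open>S / colon J z\<close> up to a shift of degrees. Hence the bad linear forms for \<open>J\<close> are among those in \<open>colon J z\<close> together
  with those that are bad for \<open>J + \<langle>z\<rangle>\<close>. If \<open>colon J z\<close> contains all linear forms, then \<open>z\<close> only
  affects the degree of \<open>z\<close>.\<close>

lemma finite_bad_subspaces_aux:
  fixes J :: "('n::finite, 'k::field) mpoly set"
  assumes "hom_ideal J"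
  shows "\<exists>\<V> D. finite \<V> \<and> (\<forall>V\<in>\<V>. K.subspace V \<and> \<not> fm 1 \<subseteq> V) \<and>
    (\<forall>w\<in>fm 1. (\<forall>V\<in>\<V>. w \<notin> V) \<longrightarrow> (\<forall>d\<ge>D. \<forall>z\<in>fm d. w * z \<in> J \<longrightarrow> z \<in> J))"
  using assms
proof (induction J rule: wf_induct_rule[OF wf_ideals])
  case (1 J)
  define Zs where "Zs = {z. \<exists>d. z \<in> fm d \<and> z \<notin> J}"
  have J: "S.subspace J" using hom_idealD(7)[OF 1(2)] .
  show ?case
  proof (cases "Zs = {}")
    case True
    then have "\<forall>d. \<forall>z\<in>fm d. z \<in> J" unfolding Zs_def by blast
    then show ?thesis by (intro exI[of _ "{}"] exI[of _ 0]) simp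
  next
    case False
    then obtain z0 where "colon J z0 \<in> colon J ` Zs" by blast
    then have "\<exists>C\<in>colon J ` Zs. \<forall>C'. (C', C) \<in> {(J', J :: ('n, 'k) mpoly set). S.subspace J \<and> S.subspace J' \<and> J \<subset> J'} \<longrightarrow>
        C' \<notin> colon J ` Zs"
      by (rule wf_ideals[unfolded wf_eq_minimal, rule_format])
    then obtain C where C: "C \<in> colon J ` Zs" "\<And>C'. S.subspace C \<Longrightarrow> S.subspace C' \<Longrightarrow> C \<subset> C' \<Longrightarrow> C' \<notin> colon J ` Zs"
      by (metis (no_types, lifting) case_prodI mem_Collect_eq)
    then obtain z where z: "z \<in> Zs" and zC: "C = colon J z" by blast
    have zmax: "\<not> colon J z \<subset> colon J y" if "y \<in> Zs" for y
      using C(2)[of "colon J y"] subspace_colon[OF J] that unfolding zC by blast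
    obtain e where e: "z \<in> fm e" "z \<notin> J" using z by (auto simp: Zs_def)
    define J' where "J' = S.span (insert z J)"
    have J': "hom_ideal J'" unfolding J'_def by (rule hom_ideal_insert[OF 1(2) e(1)])
    have "J \<subseteq> J'" "z \<in> J'" unfolding J'_def by (auto intro: S.span_base)
    then have "(J', J) \<in> {(J', J). S.subspace J \<and> S.subspace J' \<and> J \<subset> J'}"
      using e(2) J hom_idealD(7)[OF J'] by auto
    from 1(1)[OF this J'] obtain \<V>' D' where *: "finite \<V>' \<and> (\<forall>V\<in>\<V>'. K.subspace V \<and> \<not> fm 1 \<subseteq> V) \<and>
      (\<forall>w\<in>fm 1. (\<forall>V\<in>\<V>'. w \<notin> V) \<longrightarrow> (\<forall>d\<ge>D'. \<forall>z\<in>fm d. w * z \<in> J' \<longrightarrow> z \<in> J'))"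
      by (elim exE)
    have IH: "finite \<V>'" "\<forall>V\<in>\<V>'. K.subspace V \<and> \<not> fm 1 \<subseteq> V"
      using * by simp_all
    have IH3: "y \<in> J'" if "w \<in> fm 1" "\<forall>V\<in>\<V>'. w \<notin> V" "d \<ge> D'" "y \<in> fm d" "w * y \<in> J'" for w d y
      by (rule *[THEN conjunct2, THEN conjunct2, rule_format, of w d y]) (use that in simp_all)
    have reduce: "\<exists>k\<in>fm (d - e). y - k * z \<in> J"
      if "w \<in> fm 1" "\<forall>V\<in>\<V>'. w \<notin> V" "d \<ge> D'" "y \<in> fm d" "w * y \<in> J" for w d y
    proof -
      have "w * y \<in> J'" using that(5) \<open>J \<subseteq> J'\<close> by blast
      then have "y \<in> J'" using IH3 that by blast
      then show ?thesis
        unfolding J'_def using hom_ideal_insert_fm[OF 1(2) e(1) that(4)] by blast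
    qed
    show ?thesis
    proof (cases "fm 1 \<subseteq> colon J z")
      case True
      \<comment> \<open>From degree e + 1 on the cofactor k of z has positive degree, so it lies in
        the irrelevant ideal, which annihilates z modulo J.\<close>
      have "y \<in> J" if y: "w \<in> fm 1" "\<forall>V\<in>\<V>'. w \<notin> V" "d \<ge> max D' (e + 1)" "y \<in> fm d" "w * y \<in> J" for w d y
      proof -
        obtain k where k: "k \<in> fm (d - e)" "y - k * z \<in> J" using reduce[OF y(1,2) _ y(4,5)] y(3) by auto
        have "lk k 0 = 0" using lookup_0_fm[OF k(1)] y(3) by simp
        then have "k \<in> S.span (range variable)"
          using mem_irrelevant_ideal[of k] by (simp add: irrelevant_ideal_def Idl_mpoly_ring)
        moreover have "range variable \<subseteq> colon J z" using True by (meson fm_variable image_subsetI subsetD)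
        ultimately have "k \<in> colon J z" using S.span_minimal[OF _ subspace_colon[OF J]] by blast
        then have "k * z \<in> J" by (simp add: colon_def)
        then show "y \<in> J" using S.subspace_add[OF J k(2), of "k * z"] by simp
      qed
      then show ?thesis using IH(1,2) by (intro exI[of _ \<V>'] exI[of _ "max D' (e + 1)"]) blast
    next
      case False
      have "y \<in> J" if y: "w \<in> fm 1" "w \<notin> colon J z" "\<forall>V\<in>\<V>'. w \<notin> V" "d \<ge> D'" "y \<in> fm d" "w * y \<in> J" for w d y
      proof -
        obtain k where k: "k \<in> fm (d - e)" "y - k * z \<in> J" using reduce[OF y(1,3-6)] by auto
        have "w * y - w * (y - k * z) \<in> J" using y(6) S.subspace_scale[OF J k(2)] by (rule S.subspace_diff[OF J])
        moreover have "w * y - w * (y - k * z) = w * (k * z)" by (simp only: right_diff_distrib diff_diff_eq2) simp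
        ultimately have w: "w \<in> colon J (k * z)" by (simp only: colon_def mem_Collect_eq)
        have "k * z \<in> J"
        proof (rule ccontr)
          \<comment> \<open>Then \<open>k * z\<close> is a form outside J whose colon ideal contains
            that of z and also w, against maximality.\<close>
          assume "k * z \<notin> J"
          moreover have "k * z \<in> fm d" using fm_mult[OF k(1) e(1)] by simp
          ultimately have "k * z \<in> Zs" unfolding Zs_def by blast
          moreover have "colon J z \<subseteq> colon J (k * z)"
          proof
            fix x assume "x \<in> colon J z"
            then have "k * (x * z) \<in> J" using S.subspace_scale[OF J, of "x * z" k] by (simp only: colon_def mem_Collect_eq)
            moreover have "k * (x * z) = x * (k * z)" by (rule mult.left_commute)
            ultimately show "x \<in> colon J (k * z)" by (simp only: colon_def mem_Collect_eq)
          qed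
          ultimately show False using zmax w y(2) by blast
        qed
        then show "y \<in> J" using S.subspace_add[OF J k(2), of "k * z"] by simp
      qed
      moreover have "K.subspace (colon J z)" by (rule subspace_S_K[OF subspace_colon[OF J]])
      ultimately show ?thesis using IH(1,2) False
        by (intro exI[of _ "insert (colon J z) \<V>'"] exI[of _ D']) auto
    qed
  qed
qed

lemma finite_bad_subspaces:
  fixes J :: "('n::finite, 'k::field) mpoly set"
  assumes "hom_ideal J"
  obtains \<V> where "finite \<V>" "\<And>V. V \<in> \<V> \<Longrightarrow> K.subspace V \<and> \<not> fm 1 \<subseteq> V"
    "\<And>w. w \<in> fm 1 \<Longrightarrow> (\<forall>V\<in>\<V>. w \<notin> V) \<Longrightarrow> almost_regular J w"
proof -
  obtain \<V> D where *: "finite \<V> \<and> (\<forall>V\<in>\<V>. K.subspace V \<and> \<not> fm 1 \<subseteq> V) \<and>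
    (\<forall>w\<in>fm 1. (\<forall>V\<in>\<V>. w \<notin> V) \<longrightarrow> (\<forall>d\<ge>D. \<forall>z\<in>fm d. w * z \<in> J \<longrightarrow> z \<in> J))"
    using finite_bad_subspaces_aux[OF assms] by (elim exE)
  show ?thesis
  proof (rule that)
    show "finite \<V>" "\<And>V. V \<in> \<V> \<Longrightarrow> K.subspace V \<and> \<not> fm 1 \<subseteq> V" using * by simp_all
    fix w :: "('n, 'k) mpoly" assume w: "w \<in> fm 1" "\<forall>V\<in>\<V>. w \<notin> V"
    have "\<forall>d\<ge>D. \<forall>z\<in>fm d. w * z \<in> J \<longrightarrow> z \<in> J"
      by (rule *[THEN conjunct2, THEN conjunct2, THEN bspec, THEN mp]) (use w in simp_all)
    then show "almost_regular J w" unfolding almost_regular_def by (rule exI)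
  qed
qed

text \<open>If two different points of the line lie in V, so does its direction v.\<close>

lemma finite_line_subspace:
  fixes V :: "('n::finite, 'k::field) mpoly set"
  assumes V: "K.subspace V" and v: "v \<notin> V"
  shows "finite {t. w + cst t * v \<in> V}"
proof -
  have "t = t'" if tt: "w + cst t * v \<in> V" "w + cst t' * v \<in> V" for t t'
  proof (rule ccontr)
    assume "t \<noteq> t'"
    have "(w + cst t * v) - (w + cst t' * v) \<in> V" using tt by (rule K.subspace_diff[OF V])
    then have "cscale (t - t') v \<in> V" by (simp add: cscale_def single_diff algebra_simps)
    then have "cscale (inverse (t - t')) (cscale (t - t') v) \<in> V" by (rule K.subspace_scale[OF V])
    then show False using \<open>t \<noteq> t'\<close> v by simp
  qed
  then have "{t. w + cst t * v \<in> V} \<subseteq> {SOME t. w + cst t * v \<in> V}"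
    using someI[of "\<lambda>t. w + cst t * v \<in> V"] by blast
  then show ?thesis by (rule finite_subset) simp
qed

text \<open>A vector space over an infinite field is not a finite union of proper subspaces. A
  vector avoiding the old subspaces is moved along a direction u outside the new one; each subspace
  excludes only finitely many points of the line.\<close>

lemma avoid_subspaces:
  fixes \<V> :: "('n::finite, 'k::field_char_0) mpoly set set"
  assumes "finite \<V>" "\<And>V. V \<in> \<V> \<Longrightarrow> K.subspace V \<and> \<not> fm 1 \<subseteq> V"
  shows "\<exists>v\<in>fm 1. \<forall>V\<in>\<V>. v \<notin> V"
  using assms
proof (induction \<V>)
  case (insert V \<V>)
  then obtain v where v: "v \<in> fm 1" "\<forall>V\<in>\<V>. v \<notin> V" by blast
  obtain u where u: "u \<in> fm 1" "u \<notin> V" using insert.prems by blast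
  have "finite {t. v + cst t * u \<in> V}" using insert.prems u by (intro finite_line_subspace) auto
  moreover have "finite {t. v + cst t * u \<in> V'}" if "V' \<in> \<V>" for V'
  proof (cases "u \<in> V'")
    case True
    have V': "K.subspace V'" using insert.prems that by blast
    have "v + cst t * u \<notin> V'" for t
    proof
      assume "v + cst t * u \<in> V'"
      then have "(v + cst t * u) - cscale t u \<in> V'"
        using K.subspace_scale[OF V' True] by (rule K.subspace_diff[OF V'])
      then show False using v that by (simp add: cscale_def)
    qed
    then show ?thesis by simp
  qed (use insert.prems that in \<open>auto intro: finite_line_subspace\<close>)
  ultimately have "finite ({t. v + cst t * u \<in> V} \<union> (\<Union>V'\<in>\<V>. {t. v + cst t * u \<in> V'}))"
    using insert.hyps(1) by simp
  then obtain t where "t \<notin> {t. v + cst t * u \<in> V} \<union> (\<Union>V'\<in>\<V>. {t. v + cst t * u \<in> V'})"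
    using ex_new_if_finite[OF infinite_UNIV_char_0] by blast
  then show ?case using v u by (intro bexI[of _ "v + cst t * u"]) (auto intro: fm_add fm_scale)
qed (auto intro: fm_zero)

lemma not_fm_1_subset_span:
  fixes w :: "nat \<Rightarrow> ('n::finite, 'k::field) mpoly"
  assumes "q < CARD('n)"
  shows "\<not> fm 1 \<subseteq> K.span (w ` {..<q})"
proof
  assume "fm 1 \<subseteq> K.span (w ` {..<q})"
  then have sub: "range variable \<subseteq> K.span (w ` {..<q})" by (meson fm_variable image_subsetI subsetD)
  have "family_indep UNIV (\<lambda>x :: 'n. lk (variable x :: ('n, 'k) mpoly))"
    unfolding family_indep_def
  proof (intro allI impI ballI)
    fix c :: "'n \<Rightarrow> 'k" and x
    assume "\<forall>m. (\<Sum>y\<in>UNIV. c y * lk (variable y) m) = 0"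
    then have "(\<Sum>y\<in>UNIV. c y * lk (variable y) (single x 1)) = 0" by blast
    moreover have "c y * lk (variable y) (single x 1) = (if y = x then c x else 0)" for y
    proof -
      have "single y (1 :: nat) = single x 1 \<longleftrightarrow> y = x"
        by (metis lookup_single_eq lookup_single_not_eq zero_neq_one)
      then show ?thesis by (simp add: variable_def lookup_single when_def)
    qed
    ultimately show "c x = 0" by simp
  qed
  from family_indep_imp_independent[OF finite_class.finite_UNIV this]
  have "inj (variable :: 'n \<Rightarrow> ('n, 'k) mpoly)" "K.independent (range (variable :: 'n \<Rightarrow> ('n, 'k) mpoly))" by auto
  then have "CARD('n) \<le> card (w ` {..<q})"
    using K.independent_span_bound[OF _ _ sub] by (simp add: card_image)
  also have "\<dots> \<le> q" using card_image_le[of "{..<q}" w] by simp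
  finally show False using assms by simp
qed

section \<open>Full rank in one degree\<close>

text \<open>Multiplication by \<open>w ^ s\<close> on S/J starting in degree i, injective or
  surjective, expressed by representatives in S.\<close>

definition full_rank :: "('n::finite, 'k::comm_ring_1) mpoly set \<Rightarrow> ('n, 'k) mpoly \<Rightarrow> nat \<Rightarrow> nat \<Rightarrow> bool" where
  "full_rank J w i s \<longleftrightarrow> (\<forall>f\<in>fm (int i). w ^ s * f \<in> J \<longrightarrow> f \<in> J) \<or>
     (\<forall>g\<in>fm (int (i + s)). \<exists>f\<in>fm (int i). g - w ^ s * f \<in> J)"

text \<open>The preimage in S of the image of \<open>w ^ s\<close>; its dimension minus that of J in
  degree i + s is the rank.\<close>

definition image_sum :: "('n::finite, 'k::comm_ring_1) mpoly set \<Rightarrow> ('n, 'k) mpoly \<Rightarrow> nat \<Rightarrow> nat \<Rightarrow> ('n, 'k) mpoly set" where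
  "image_sum J w i s = {w ^ s * f + g |f g. f \<in> fm (int i) \<and> g \<in> J \<inter> fm (int (i + s))}"

lemma linear_mult: "Vector_Spaces.linear cscale cscale ((*) (a :: ('n, 'k::field) mpoly))"
  by unfold_locales (simp_all add: cscale_def distrib_left mult.left_commute)

lemma power_fm:
  assumes "w \<in> fm 1" "f \<in> fm (int i)"
  shows "w ^ s * f \<in> fm (int (i + s))"
  using fm_mult[OF fm_power[OF assms(1), of s] assms(2)] by (simp add: add.commute)

lemma image_sum_subset: "w \<in> fm 1 \<Longrightarrow> image_sum J w i s \<subseteq> fm (int (i + s))"
  unfolding image_sum_def using power_fm[of w _ i s] by (auto intro: fm_add)

lemma subspace_Int_fm: "hom_ideal J \<Longrightarrow> K.subspace (J \<inter> fm d)"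
  by (rule K.subspace_inter[OF subspace_S_K[OF hom_idealD(7)] subspace_K_fm])

lemma subspace_image_sum:
  assumes "hom_ideal J"
  shows "K.subspace (image_sum (J :: ('n::finite, 'k::field) mpoly set) w i s)"
proof -
  interpret L: Vector_Spaces.linear cscale cscale "(*) (w ^ s)" by (rule linear_mult)
  have "K.subspace ((*) (w ^ s) ` fm (int i))" by (rule L.subspace_image[OF subspace_K_fm])
  then have "K.subspace {x + y |x y. x \<in> (*) (w ^ s) ` fm (int i) \<and> y \<in> J \<inter> fm (int (i + s))}"
    by (rule K.subspace_sums[OF _ subspace_Int_fm[OF assms]])
  moreover have "{x + y |x y. x \<in> (*) (w ^ s) ` fm (int i) \<and> y \<in> J \<inter> fm (int (i + s))} = image_sum J w i s"
    unfolding image_sum_def by blast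
  ultimately show ?thesis by simp
qed

text \<open>The rank is at most the dimension of S/J in degree i, with equality exactly for
  injective maps, and the map is onto iff \<open>image_sum\<close> fills degree i + s. Thus full
  rank becomes a lower bound on one dimension, which semicontinuity can preserve.\<close>

lemma
  fixes J :: "('n::finite, 'k::field) mpoly set"
  assumes J: "hom_ideal J" and w: "w \<in> fm 1"
  shows dim_image_sum_upper: "K.dim (image_sum J w i s) + K.dim (J \<inter> fm (int i)) \<le>
      K.dim (J \<inter> fm (int (i + s))) + K.dim (fm (int i) :: ('n, 'k) mpoly set)"
    and full_rank_iff_dim: "full_rank J w i s \<longleftrightarrow>
      K.dim (J \<inter> fm (int (i + s))) + K.dim (fm (int i) :: ('n, 'k) mpoly set) \<le>
        K.dim (image_sum J w i s) + K.dim (J \<inter> fm (int i)) \<or>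
      K.dim (fm (int (i + s)) :: ('n, 'k) mpoly set) \<le> K.dim (image_sum J w i s)"
proof -
  let ?A = "fm (int i) :: ('n, 'k) mpoly set" and ?B = "J \<inter> fm (int i)" and ?D = "J \<inter> fm (int (i + s))"
  obtain A0 :: "('n, 'k) mpoly set" where A0: "finite A0" "?A \<subseteq> K.span A0" by (rule fm_finite_dim)
  obtain D0 :: "('n, 'k) mpoly set" where D0: "finite D0" "fm (int (i + s)) \<subseteq> K.span D0" by (rule fm_finite_dim)
  have D0': "?D \<subseteq> K.span D0" using D0(2) by blast
  have img: "(*) (w ^ s) ` ?B \<subseteq> ?D"
    using power_fm[OF w, of _ i s] hom_idealD(4)[OF J] by auto
  have U: "{w ^ s * a + d |a d. a \<in> ?A \<and> d \<in> ?D} = image_sum J w i s" by (simp add: image_sum_def)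
  have BA: "?B \<subseteq> ?A" by blast
  note * = linear_mult[of "w ^ s"] subspace_K_fm subspace_Int_fm[OF J] subspace_Int_fm[OF J] BA img
    A0(2,1) D0' D0(1)
  note upper = K.dim_image_sum_le[OF *] and ge = K.dim_image_sum_ge[OF *] and ge_iff = K.dim_image_sum_ge_iff[OF *]
  show "K.dim (image_sum J w i s) + K.dim ?B \<le> K.dim ?D + K.dim ?A"
    using upper unfolding U .
  have "(\<forall>f\<in>?A. w ^ s * f \<in> J \<longrightarrow> f \<in> J) \<longleftrightarrow> K.dim ?D + K.dim ?A \<le> K.dim (image_sum J w i s) + K.dim ?B"
  proof
    assume inj: "\<forall>f\<in>?A. w ^ s * f \<in> J \<longrightarrow> f \<in> J"
    show "K.dim ?D + K.dim ?A \<le> K.dim (image_sum J w i s) + K.dim ?B"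
      by (rule ge[unfolded U]) (use inj in auto)
  next
    assume le: "K.dim ?D + K.dim ?A \<le> K.dim (image_sum J w i s) + K.dim ?B"
    show "\<forall>f\<in>?A. w ^ s * f \<in> J \<longrightarrow> f \<in> J"
    proof (intro ballI impI)
      fix f assume "f \<in> ?A" "w ^ s * f \<in> J"
      then have "f \<in> ?B" using ge_iff[unfolded U, OF le, of f] power_fm[OF w, of f i s] by blast
      then show "f \<in> J" by blast
    qed
  qed
  moreover have "(\<forall>g\<in>fm (int (i + s)). \<exists>f\<in>?A. g - w ^ s * f \<in> J) \<longleftrightarrow>
      K.dim (fm (int (i + s)) :: ('n, 'k) mpoly set) \<le> K.dim (image_sum J w i s)"
  proof
    assume surj: "\<forall>g\<in>fm (int (i + s)). \<exists>f\<in>?A. g - w ^ s * f \<in> J"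
    have "fm (int (i + s)) \<subseteq> image_sum J w i s"
    proof
      fix g assume g: "g \<in> (fm (int (i + s)) :: ('n, 'k) mpoly set)"
      then obtain f where f: "f \<in> ?A" "g - w ^ s * f \<in> J" using surj by blast
      then have "g - w ^ s * f \<in> ?D" using fm_diff[OF g power_fm[OF w f(1)]] by blast
      moreover have "g = w ^ s * f + (g - w ^ s * f)" by simp
      ultimately show "g \<in> image_sum J w i s" unfolding image_sum_def using f(1) by blast
    qed
    then have "fm (int (i + s)) = image_sum J w i s" using image_sum_subset[OF w] by blast
    then show "K.dim (fm (int (i + s)) :: ('n, 'k) mpoly set) \<le> K.dim (image_sum J w i s)" by simp
  next
    assume le: "K.dim (fm (int (i + s)) :: ('n, 'k) mpoly set) \<le> K.dim (image_sum J w i s)"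
    have eq: "image_sum J w i s = fm (int (i + s))"
      by (rule K.subspace_eq_of_dim_le[OF subspace_image_sum[OF J] image_sum_subset[OF w] D0(2,1) le])
    show "\<forall>g\<in>fm (int (i + s)). \<exists>f\<in>?A. g - w ^ s * f \<in> J"
    proof
      fix g assume "g \<in> (fm (int (i + s)) :: ('n, 'k) mpoly set)"
      then have "g \<in> image_sum J w i s" by (simp add: eq)
      then obtain f d where "g = w ^ s * f + d" "f \<in> ?A" "d \<in> J" unfolding image_sum_def by blast
      then show "\<exists>f\<in>?A. g - w ^ s * f \<in> J" by (intro bexI[of _ f]) auto
    qed
  qed
  ultimately show "full_rank J w i s \<longleftrightarrow> K.dim ?D + K.dim ?A \<le> K.dim (image_sum J w i s) + K.dim ?B \<or>
      K.dim (fm (int (i + s)) :: ('n, 'k) mpoly set) \<le> K.dim (image_sum J w i s)"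
    unfolding full_rank_def by blast
qed

section \<open>Full rank is an open condition\<close>

definition partial_ideal :: "('n, 'k::comm_ring_1) mpoly set \<Rightarrow> (nat \<Rightarrow> ('n, 'k) mpoly) \<Rightarrow> nat \<Rightarrow> ('n, 'k) mpoly set" where
  "partial_ideal I w p = S.span (I \<union> w ` {..<p})"

lemma partial_ideal_0: "hom_ideal I \<Longrightarrow> partial_ideal I w 0 = I"
  by (simp add: partial_ideal_def hom_ideal_span)

lemma partial_ideal_Suc: "partial_ideal I w (Suc p) = S.span (insert (w p) (partial_ideal I w p))"
  by (simp add: partial_ideal_def S_span_Un_insert lessThan_Suc)

lemma partial_ideal_cong: "(\<And>i. i < p \<Longrightarrow> w i = w' i) \<Longrightarrow> partial_ideal I w p = partial_ideal I w' p"
  unfolding partial_ideal_def by (metis image_cong lessThan_iff)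

lemma hom_ideal_partial:
  assumes "hom_ideal I" "\<And>i. i < p \<Longrightarrow> w i \<in> fm 1"
  shows "hom_ideal (partial_ideal I w p)"
  unfolding partial_ideal_def by (rule hom_ideal_span_Un[OF assms(1)]) (use assms(2) in auto)

text \<open>For s = 1 the preimage of the image is the next ideal in degree i + 1. In this way the
  ranks of one form determine the Hilbert function of the next quotient.\<close>

lemma image_sum_1:
  assumes "hom_ideal I" "\<And>j. j \<le> p \<Longrightarrow> w j \<in> fm 1"
  shows "image_sum (partial_ideal I w p) (w p) i 1 = partial_ideal I w (Suc p) \<inter> fm (int (Suc i))"
proof -
  have J: "hom_ideal (partial_ideal I w p)" using hom_ideal_partial[OF assms(1)] assms(2) by simp
  have wp: "w p \<in> fm 1" using assms(2) by simp
  show ?thesis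
  proof (intro subset_antisym subsetI IntI)
    fix x assume x: "x \<in> image_sum (partial_ideal I w p) (w p) i 1"
    then show d: "x \<in> fm (int (Suc i))" using image_sum_subset[OF wp] by fastforce
    obtain f g where fg: "x = w p * f + g" "f \<in> fm (int i)" "g \<in> partial_ideal I w p"
      using x unfolding image_sum_def by auto
    have "int (Suc i) - 1 = int i" by simp
    then have "\<exists>k\<in>fm (int (Suc i) - 1). x - k * w p \<in> partial_ideal I w p"
      using fg by (intro bexI[of _ f]) (simp_all add: mult.commute)
    then show "x \<in> partial_ideal I w (Suc p)"
      unfolding partial_ideal_Suc hom_ideal_insert_fm[OF J wp d] .
  next
    fix x assume "x \<in> partial_ideal I w (Suc p) \<inter> fm (int (Suc i))"
    then have x: "x \<in> fm (int (Suc i))" "x \<in> partial_ideal I w (Suc p)" by auto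
    obtain k where k: "k \<in> fm (int (Suc i) - 1)" "x - k * w p \<in> partial_ideal I w p"
      using x(2) unfolding partial_ideal_Suc hom_ideal_insert_fm[OF J wp x(1)] by blast
    have k': "k \<in> fm (int i)" using k(1) by simp
    have "w p ^ 1 * k \<in> fm (int (i + 1))" by (rule power_fm[OF wp k'])
    then have "x - k * w p \<in> fm (int (i + 1))"
      using x(1) by (intro fm_diff) (simp_all add: mult.commute)
    moreover have "x = w p ^ 1 * k + (x - k * w p)" by (simp add: mult.commute)
    ultimately show "x \<in> image_sum (partial_ideal I w p) (w p) i 1"
      unfolding image_sum_def using k' k(2) by blast
  qed
qed

lemma partial_ideal_Suc_0:
  assumes "hom_ideal I" "\<And>j. j \<le> p \<Longrightarrow> w j \<in> fm 1"
  shows "partial_ideal I w (Suc p) \<inter> fm 0 = partial_ideal I w p \<inter> fm 0"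
proof -
  have J: "hom_ideal (partial_ideal I w p)" using hom_ideal_partial[OF assms(1)] assms(2) by simp
  have wp: "w p \<in> fm 1" using assms(2) by simp
  have "x \<in> partial_ideal I w (Suc p) \<longleftrightarrow> x \<in> partial_ideal I w p" if x: "x \<in> fm 0" for x
  proof -
    have "(\<exists>k\<in>fm (0 - 1). x - k * w p \<in> partial_ideal I w p) \<longleftrightarrow> x \<in> partial_ideal I w p"
    proof
      assume "\<exists>k\<in>fm (0 - 1). x - k * w p \<in> partial_ideal I w p"
      then obtain k where k: "k \<in> fm (0 - 1)" "x - k * w p \<in> partial_ideal I w p" by blast
      then have "k = 0" using fm_negative[of k "0 - 1"] by simp
      then show "x \<in> partial_ideal I w p" using k(2) by simp
    qed (auto intro: bexI[of _ 0])
    then show ?thesis unfolding partial_ideal_Suc hom_ideal_insert_fm[OF J wp x] .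
  qed
  then show ?thesis by blast
qed

text \<open>For each t the space is spanned by the values of one and the same collection of
  polynomial curves, so \<open>finite_dim_drop\<close> applies.\<close>

definition spanned_by_families :: "('k::field \<Rightarrow> ('n::finite, 'k) mpoly set) \<Rightarrow> int \<Rightarrow> bool" where
  "spanned_by_families U d \<longleftrightarrow> (\<exists>\<F>. (\<forall>f\<in>\<F>. poly_family f \<and> (\<forall>t. f t \<in> fm d)) \<and>
     (\<forall>t. U t = K.span ((\<lambda>f. f t) ` \<F>)))"

lemma spanned_by_families_dim:
  assumes "spanned_by_families U d"
  shows "finite {t. K.dim (U t) < K.dim (U 0)}"
proof -
  obtain \<F> where \<F>: "\<forall>f\<in>\<F>. poly_family f \<and> (\<forall>t. f t \<in> fm d)" "\<forall>t. U t = K.span ((\<lambda>f. f t) ` \<F>)"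
    using assms unfolding spanned_by_families_def by (elim exE conjE)
  have "finite {t. K.dim ((\<lambda>f. f t) ` \<F>) < K.dim ((\<lambda>f. f 0) ` \<F>)}"
    by (rule finite_dim_drop) (use \<F>(1) in auto)
  then show ?thesis using \<F>(2) by (simp only: K.dim_span)
qed

lemma spanned_by_families_sum:
  assumes U: "spanned_by_families U d" and a: "poly_family a" "\<And>t. a t \<in> fm e" and de: "d = e + i"
  shows "spanned_by_families (\<lambda>t. {a t * f + g |f g. f \<in> fm i \<and> g \<in> U t}) d"
proof -
  obtain \<F> where \<F>: "\<forall>f\<in>\<F>. poly_family f \<and> (\<forall>t. f t \<in> fm d)" "\<And>t. U t = K.span ((\<lambda>f. f t) ` \<F>)"
    using U unfolding spanned_by_families_def by auto
  let ?G = "(\<lambda>h t. a t * h) ` fm i"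
  have "{a t * f + g |f g. f \<in> fm i \<and> g \<in> U t} = K.span ((\<lambda>f. f t) ` (?G \<union> \<F>))" for t
  proof -
    interpret L: Vector_Spaces.linear cscale cscale "(*) (a t)" by (rule linear_mult)
    have "K.subspace ((*) (a t) ` fm i)" by (rule L.subspace_image[OF subspace_K_fm])
    then have "K.span ((*) (a t) ` fm i) = (*) (a t) ` fm i" by (simp only: K.span_eq_iff)
    then have *: "K.span ((\<lambda>f. f t) ` ?G) = (*) (a t) ` fm i" by (simp add: image_image)
    show ?thesis unfolding image_Un K.span_Un \<F>(2) * by blast
  qed
  moreover have "\<forall>f\<in>?G \<union> \<F>. poly_family f \<and> (\<forall>t. f t \<in> fm d)"
    using \<F>(1) poly_family_mult[OF a(1) poly_family.const] fm_mult[OF a(2)] de by auto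
  ultimately show ?thesis unfolding spanned_by_families_def by blast
qed

context
  fixes I :: "('n::finite, 'k::field) mpoly set" and w :: "nat \<Rightarrow> 'k \<Rightarrow> ('n, 'k) mpoly" and l :: nat
  assumes I: "hom_ideal I" and w: "\<And>p. p < l \<Longrightarrow> poly_family (w p)" "\<And>p t. p < l \<Longrightarrow> w p t \<in> fm 1"
begin

text \<open>By \<open>image_sum_1\<close>, adjoining one more form adds its multiples by forms that
  do not depend on t; in degree 0 there are no such multiples.\<close>

lemma spanned_partial_ideal:
  "p \<le> l \<Longrightarrow> spanned_by_families (\<lambda>t. partial_ideal I (\<lambda>j. w j t) p \<inter> fm (int d)) (int d)"
proof (induction p arbitrary: d)
  case 0
  let ?F = "(\<lambda>f t. f) ` (I \<inter> fm (int d)) :: ('k \<Rightarrow> ('n, 'k) mpoly) set"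
  have "K.span ((\<lambda>f. f t) ` ?F) = I \<inter> fm (int d)" for t
    using subspace_Int_fm[OF I, of "int d"] by (simp add: image_image)
  then show ?case
    unfolding spanned_by_families_def partial_ideal_0[OF I]
    by (intro exI[of _ ?F]) (auto intro: poly_family.const)
next
  case (Suc p)
  show ?case
  proof (cases d)
    case 0
    then show ?thesis using Suc.IH[of 0] Suc.prems partial_ideal_Suc_0[OF I, of p "\<lambda>j. w j _"] w(2) by simp
  next
    case (Suc i)
    have eq: "partial_ideal I (\<lambda>j. w j t) (Suc p) \<inter> fm (int d) =
        {w p t * f + g |f g. f \<in> fm (int i) \<and> g \<in> partial_ideal I (\<lambda>j. w j t) p \<inter> fm (int d)}" for t
      using image_sum_1[OF I, of p "\<lambda>j. w j t" i] w(2) Suc.prems unfolding image_sum_def Suc by simp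
    show ?thesis
      unfolding eq
    proof (rule spanned_by_families_sum[of _ _ _ 1])
      show "spanned_by_families (\<lambda>t. partial_ideal I (\<lambda>j. w j t) p \<inter> fm (int d)) (int d)"
        using Suc.IH[of d] Suc.prems by simp
    qed (use Suc.prems w \<open>d = Suc i\<close> in auto)
  qed
qed

lemma spanned_image_sum:
  assumes "p < l"
  shows "spanned_by_families (\<lambda>t. image_sum (partial_ideal I (\<lambda>j. w j t) p) (w p t) i s) (int (i + s))"
  unfolding image_sum_def
  by (rule spanned_by_families_sum[of _ _ _ "int s"])
    (use assms w spanned_partial_ideal[of p "i + s"] poly_family_power[of "w p" s] fm_power[OF w(2), of p _ s] in auto)

text \<open>As long as the forms \<open>w 0, \<dots>, w (p-1)\<close> have full rank, the Hilbert function of the quotient by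
  them is determined by that of \<open>S/I\<close>. Hence it does not change with \<open>t\<close>, and semicontinuity of the
  rank of the next form suffices.\<close>

lemma full_rank_open:
  assumes kl: "k \<le> l"
    and fr: "\<And>p i s. p < k \<Longrightarrow> s \<ge> 1 \<Longrightarrow> i + s < N \<Longrightarrow> full_rank (partial_ideal I (\<lambda>j. w j 0) p) (w p 0) i s"
  shows "finite {t. \<not> (\<forall>p<k. \<forall>i s. s \<ge> 1 \<longrightarrow> i + s < N \<longrightarrow> full_rank (partial_ideal I (\<lambda>j. w j t) p) (w p t) i s)}"
proof -
  define J where "J t p = partial_ideal I (\<lambda>j. w j t) p" for t p
  define U where "U p i s t = image_sum (J t p) (w p t) i s" for p i s t
  \<comment> \<open>Only finitely many maps are concerned, as i + s < N, and each loses rank for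
    finitely many t.\<close>
  define bad where "bad = (\<Union>(p, i, s)\<in>{..<k} \<times> {..<N} \<times> {..<N}. {t. K.dim (U p i s t) < K.dim (U p i s 0)})"
  have "finite {t. K.dim (U p i s t) < K.dim (U p i s 0)}" if "p < k" for p i s
    unfolding U_def J_def using spanned_by_families_dim[OF spanned_image_sum[of p i s]] that kl by simp
  then have fin: "finite bad" unfolding bad_def by auto
  have J: "hom_ideal (J t p)" if "p \<le> l" for t p
    unfolding J_def by (rule hom_ideal_partial[OF I]) (use w that in auto)
  have J1: "U p i 1 t = J t (Suc p) \<inter> fm (int (Suc i))" if "p < l" for p i t
    unfolding U_def J_def by (rule image_sum_1[OF I]) (use w that in auto)
  have J0: "J t (Suc p) \<inter> fm 0 = J t p \<inter> fm 0" if "p < l" for p t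
    unfolding J_def by (rule partial_ideal_Suc_0[OF I]) (use w that in auto)
  have good: "full_rank (J t p) (w p t) i s"
    if t: "t \<notin> bad" and "p < k" "s \<ge> 1" "i + s < N" for t p i s
  proof -
    have dim_U: "K.dim (U p i s 0) \<le> K.dim (U p i s t)" if "p < k" "i + s < N" for p i s
      using t that unfolding bad_def by (force simp: not_less)
    have fr_step: "full_rank (J t p) (w p t) i s"
      "K.dim (U p i s t) = K.dim (U p i s 0)"
      if hf: "\<And>d. d < N \<Longrightarrow> K.dim (J t p \<inter> fm (int d)) = K.dim (J 0 p \<inter> fm (int d))"
        and p: "p < k" "s \<ge> 1" "i + s < N" for p i s
    proof -
      have pl: "p < l" "p \<le> l" using p kl by auto
      have eqs: "K.dim (J t p \<inter> fm (int i)) = K.dim (J 0 p \<inter> fm (int i))"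
        "K.dim (J t p \<inter> fm (int (i + s))) = K.dim (J 0 p \<inter> fm (int (i + s)))"
        using hf[of i] hf[of "i + s"] p by auto
      have fr0: "full_rank (J 0 p) (w p 0) i s" unfolding J_def by (rule fr[OF p])
      note dU = dim_U[OF p(1,3)]
      show fr_t: "full_rank (J t p) (w p t) i s"
        using fr0 dU unfolding full_rank_iff_dim[OF J[OF pl(2)] w(2)[OF pl(1)]] eqs U_def by linarith
      \<comment> \<open>The two upper bounds on the dimension are the same at t and at 0, and one of
        them is attained at 0; so the dimension cannot grow either.\<close>
      have "K.dim (U p i s t) \<le> K.dim (fm (int (i + s)) :: ('n, 'k) mpoly set)"
      proof -
        obtain B :: "('n, 'k) mpoly set" where "finite B" "fm (int (i + s)) \<subseteq> K.span B" by (rule fm_finite_dim)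
        then show ?thesis
          unfolding U_def using K.dim_mono_finite[OF image_sum_subset[OF w(2)[OF pl(1)]]] by blast
      qed
      moreover have "K.dim (U p i s t) + K.dim (J 0 p \<inter> fm (int i)) \<le>
          K.dim (J 0 p \<inter> fm (int (i + s))) + K.dim (fm (int i) :: ('n, 'k) mpoly set)"
        using dim_image_sum_upper[OF J[OF pl(2)] w(2)[OF pl(1)], of t t i s] unfolding U_def eqs .
      ultimately show "K.dim (U p i s t) = K.dim (U p i s 0)"
        using fr0 dU unfolding full_rank_iff_dim[OF J[OF pl(2)] w(2)[OF pl(1)]] U_def by linarith
    qed
    have "K.dim (J t p \<inter> fm (int d)) = K.dim (J 0 p \<inter> fm (int d))" if "p \<le> k" "d < N" for p d
      using that
    proof (induction p arbitrary: d)
      case 0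
      then show ?case by (simp add: J_def partial_ideal_0[OF I])
    next
      case (Suc p)
      show ?case
      proof (cases d)
        case 0
        then show ?thesis using Suc.IH[of 0] Suc.prems J0[of p] kl by simp
      next
        case (Suc i)
        have "K.dim (U p i 1 t) = K.dim (U p i 1 0)"
          by (rule fr_step(2)) (use Suc.IH Suc.prems Suc in auto)
        then show ?thesis using J1[of p i] Suc.prems kl Suc by simp
      qed
    qed
    then show ?thesis using fr_step(1) that by simp
  qed
  show ?thesis
    by (rule finite_subset[OF _ fin]) (use good in \<open>auto simp: J_def\<close>)
qed

end

section \<open>Generic linear forms\<close>

text \<open>The forms are made generic one after the other. Genericity of the forms before q does
  not involve \<open>w q\<close>, and \<open>w q\<close> moves along a line that meets the bad
  subspaces in finitely many points. Full rank involves the later forms as well and survives by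
  \<open>full_rank_open\<close>.\<close>

lemma generic_tuple:
  fixes I :: "('n::finite, 'k::field_char_0) mpoly set"
  assumes I: "hom_ideal I" and w0: "\<And>p. p < k \<Longrightarrow> w0 p \<in> fm 1"
    and fr0: "\<And>p i s. p < k \<Longrightarrow> s \<ge> 1 \<Longrightarrow> i + s < N \<Longrightarrow> full_rank (partial_ideal I w0 p) (w0 p) i s"
    and k: "k \<le> CARD('n)"
  shows "\<exists>w. (\<forall>p. w p \<in> fm 1) \<and>
    (\<forall>p<k. \<forall>i s. s \<ge> 1 \<longrightarrow> i + s < N \<longrightarrow> full_rank (partial_ideal I w p) (w p) i s) \<and>
    (\<forall>p<CARD('n). w p \<notin> K.span (w ` {..<p}) \<and> almost_regular (partial_ideal I w p) (w p))"
proof -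
  have "\<exists>w. (\<forall>p. w p \<in> fm 1) \<and>
    (\<forall>p<k. \<forall>i s. s \<ge> 1 \<longrightarrow> i + s < N \<longrightarrow> full_rank (partial_ideal I w p) (w p) i s) \<and>
    (\<forall>p<q. w p \<notin> K.span (w ` {..<p}) \<and> almost_regular (partial_ideal I w p) (w p))"
    if "q \<le> CARD('n)" for q
    using that
  proof (induction q)
    case 0
    \<comment> \<open>The forms from k on are not prescribed and start at 0. They are made generic
      too, since the regularity argument works with a basis of all linear forms.\<close>
    let ?w = "\<lambda>p. if p < k then w0 p else 0"
    have "full_rank (partial_ideal I ?w p) (?w p) i s" if "p < k" "s \<ge> 1" "i + s < N" for p i s
      using fr0[OF that] partial_ideal_cong[of p ?w w0 I] that by simp
    then show ?case using w0 by (intro exI[of _ ?w]) auto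
  next
    case (Suc q)
    from Suc.IH[OF Suc_leD[OF Suc.prems]] obtain w where *: "(\<forall>p. w p \<in> fm 1) \<and>
      (\<forall>p<k. \<forall>i s. s \<ge> 1 \<longrightarrow> i + s < N \<longrightarrow> full_rank (partial_ideal I w p) (w p) i s) \<and>
      (\<forall>p<q. w p \<notin> K.span (w ` {..<p}) \<and> almost_regular (partial_ideal I w p) (w p))"
      by (elim exE)
    have w: "w p \<in> fm 1" for p using * by blast
    have fr: "full_rank (partial_ideal I w p) (w p) i s" if "p < k" "s \<ge> 1" "i + s < N" for p i s
      using * that by blast
    have gen: "w p \<notin> K.span (w ` {..<p}) \<and> almost_regular (partial_ideal I w p) (w p)" if "p < q" for p
      using * that by blast
    have J: "hom_ideal (partial_ideal I w q)" by (rule hom_ideal_partial[OF I w])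
    obtain \<V> where \<V>: "finite \<V>" "\<And>V. V \<in> \<V> \<Longrightarrow> K.subspace V \<and> \<not> fm 1 \<subseteq> V"
      "\<And>u. u \<in> fm 1 \<Longrightarrow> (\<forall>V\<in>\<V>. u \<notin> V) \<Longrightarrow> almost_regular (partial_ideal I w q) u"
      by (rule finite_bad_subspaces[OF J]) (rule that)
    \<comment> \<open>Avoiding the span of the earlier forms as well gives independence.\<close>
    define \<V>' where "\<V>' = insert (K.span (w ` {..<q})) \<V>"
    have \<V>': "finite \<V>'" "\<And>V. V \<in> \<V>' \<Longrightarrow> K.subspace V \<and> \<not> fm 1 \<subseteq> V"
      unfolding \<V>'_def using \<V>(1,2) not_fm_1_subset_span[of q w] Suc.prems by auto
    obtain v where v: "v \<in> fm 1" "\<And>V. V \<in> \<V>' \<Longrightarrow> v \<notin> V" using avoid_subspaces[OF \<V>'] by blast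
    define W where "W p t = (if p = q then w q + cst t * v else w p)" for p t
    have W_fm: "W p t \<in> fm 1" for p t using w v(1) by (auto simp: W_def intro: fm_add fm_scale)
    have "poly_family (\<lambda>t. w q + cst t * v)"
      by (intro poly_family.add poly_family.scale poly_family.const)
    then have W_pf: "poly_family (W p)" for p
      by (cases "p = q") (simp_all add: W_def[abs_def] poly_family.const)
    have W0: "W p 0 = w p" for p by (simp add: W_def)
    have "finite {t. \<not> (\<forall>p<k. \<forall>i s. s \<ge> 1 \<longrightarrow> i + s < N \<longrightarrow> full_rank (partial_ideal I (\<lambda>j. W j t) p) (W p t) i s)}"
      (is "finite ?bad1")
      by (rule full_rank_open[OF I, of "CARD('n)"]) (use W_pf W_fm k fr in \<open>auto simp: W0\<close>)
    moreover have "finite {t. w q + cst t * v \<in> V}" if "V \<in> \<V>'" for V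
      using \<V>'(2)[OF that] v(2)[OF that] by (intro finite_line_subspace) auto
    ultimately have "finite (?bad1 \<union> (\<Union>V\<in>\<V>'. {t. w q + cst t * v \<in> V}))"
      using \<V>'(1) by blast
    from ex_new_if_finite[OF infinite_UNIV_char_0 this]
    obtain t where t: "t \<notin> ?bad1 \<union> (\<Union>V\<in>\<V>'. {t. w q + cst t * v \<in> V})" by (elim exE)
    define w' where "w' j = W j t" for j
    have same: "w' p = w p" if "p \<noteq> q" for p using that by (simp add: w'_def W_def)
    have w'q: "w' q = w q + cst t * v" by (simp add: w'_def W_def)
    have pi: "partial_ideal I w' p = partial_ideal I w p" if "p \<le> q" for p
      by (rule partial_ideal_cong) (use same that in auto)
    have im: "w' ` {..<p} = w ` {..<p}" if "p \<le> q" for p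
      by (rule image_cong) (use same that in auto)
    have "w' q \<notin> V" if "V \<in> \<V>'" for V using t that unfolding w'q by blast
    then have q: "w' q \<notin> K.span (w ` {..<q})" "almost_regular (partial_ideal I w q) (w' q)"
      using \<V>(3)[of "w' q"] W_fm[of q t] unfolding \<V>'_def w'_def by auto
    have "w' p \<notin> K.span (w' ` {..<p}) \<and> almost_regular (partial_ideal I w' p) (w' p)" if "p < Suc q" for p
      using gen[of p] q same[of p] pi[of p] im[of p] that by (cases "p = q") auto
    moreover have "\<forall>p<k. \<forall>i s. s \<ge> 1 \<longrightarrow> i + s < N \<longrightarrow> full_rank (partial_ideal I w' p) (w' p) i s"
      using t unfolding w'_def by blast
    moreover have "\<forall>p. w' p \<in> fm 1" using W_fm by (simp add: w'_def)
    ultimately show ?case by blast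
  qed
  then show ?thesis by blast
qed

section \<open>Full rank in all degrees\<close>

lemma full_rank_all:
  fixes J :: "('n::finite, 'k::field) mpoly set"
  assumes J: "hom_ideal J" and w: "w \<in> fm 1"
    and reg: "\<And>d z. d \<ge> r \<Longrightarrow> z \<in> fm d \<Longrightarrow> w * z \<in> J \<Longrightarrow> z \<in> J"
    and fr: "\<And>i s. s \<ge> 1 \<Longrightarrow> i + s < nat (r + 1) \<Longrightarrow> full_rank J w i s"
    and s: "s \<ge> 1"
  shows "full_rank J w i s"
proof -
  have inj: "z \<in> J" if "w ^ n * z \<in> J" "z \<in> fm d" "d \<ge> r" for n z d
    using that
  proof (induction n)
    case (Suc n)
    have a: "w ^ n * z \<in> fm (int n * 1 + d)" by (rule fm_mult[OF fm_power[OF w] Suc.prems(2)])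
    have b: "w * (w ^ n * z) \<in> J" using Suc.prems(1) by (simp only: power_Suc mult.assoc)
    have d: "int n * 1 + d \<ge> r" using Suc.prems(3) by simp
    show ?case by (rule Suc.IH[OF reg[OF d a b] Suc.prems(2,3)])
  qed simp
  consider "int (i + s) \<le> r" | "int i \<ge> r" | "int (i + s) > r" "int i < r" by linarith
  then show ?thesis
  proof cases
    case 1
    then show ?thesis using fr[OF s, of i] by simp
  next
    case 2
    then show ?thesis unfolding full_rank_def using inj by blast
  next
    case 3
    \<comment> \<open>\<open>w ^ s\<close> is factored through degree r. Since i < r the exponent s'
      is at least 1, so the hypothesis applies.\<close>
    define s' where "s' = nat r - i"
    have s': "s' \<ge> 1" "i + s' < nat (r + 1)" "int (i + s') = r" "s' < s"
      using 3 by (auto simp: s'_def)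
    from fr[OF s'(1,2)] show ?thesis
      unfolding full_rank_def
    proof (elim disjE)
      assume i': "\<forall>f\<in>fm (int i). w ^ s' * f \<in> J \<longrightarrow> f \<in> J"
      have "f \<in> J" if f: "f \<in> fm (int i)" "w ^ s * f \<in> J" for f
      proof -
        have "s = (s - s') + s'" using s'(4) by simp
        then have "w ^ s = w ^ (s - s') * w ^ s'" by (metis power_add)
        then have "w ^ (s - s') * (w ^ s' * f) \<in> J" using f(2) by (simp only: mult.assoc)
        then have "w ^ s' * f \<in> J" using inj[OF _ power_fm[OF w f(1), of s']] s'(3) by simp
        then show "f \<in> J" using i' f(1) by blast
      qed
      then show "(\<forall>f\<in>fm (int i). w ^ s * f \<in> J \<longrightarrow> f \<in> J) \<or>
          (\<forall>g\<in>fm (int (i + s)). \<exists>f\<in>fm (int i). g - w ^ s * f \<in> J)" by blast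
    next
      assume surj: "\<forall>g\<in>fm (int (i + s')). \<exists>f\<in>fm (int i). g - w ^ s' * f \<in> J"
      have "\<forall>g\<in>fm (int (i + (s' + n))). \<exists>f\<in>fm (int i). g - w ^ (s' + n) * f \<in> J" for n
      proof (induction n)
        case (Suc n)
        let ?m = "s' + n"
        \<comment> \<open>Splitting off a variable x from a monomial leaves one of degree
          \<open>i + ?m\<close>, congruent to some \<open>w ^ ?m * f\<close>; so the monomial is
          congruent to \<open>w ^ ?m\<close> times the form x * f of degree i + 1.\<close>
        have mono: "\<exists>h\<in>fm (int i + 1). single m c - w ^ ?m * h \<in> J"
          if m: "mdeg m = int (i + Suc ?m)" for m :: "'n \<Rightarrow>\<^sub>0 nat" and c
        proof -
          have "monomial_degree m > 0" using m by simp
          then obtain x m' where m': "m = single x 1 + m'" "monomial_degree m = Suc (monomial_degree m')"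
            by (rule variable_factor)
          have "(single m' c :: ('n, 'k) mpoly) \<in> fm (int (i + ?m))" using m m' by simp
          then obtain f where f: "f \<in> fm (int i)" "single m' c - w ^ ?m * f \<in> J"
            using Suc by blast
          have "variable x * (single m' c - w ^ ?m * f) =
              single m c - w ^ ?m * (variable x * f)"
            by (simp add: right_diff_distrib m'(1) variable_def mult_single mult.left_commute)
          then have "single m c - w ^ ?m * (variable x * f) \<in> J"
            using hom_idealD(4)[OF J f(2), of "variable x"] by simp
          moreover have "variable x * f \<in> fm (int i + 1)" using fm_mult[OF fm_variable f(1)] by (simp add: add.commute)
          ultimately show ?thesis by blast
        qed
        show ?case
        proof
          fix g assume g: "g \<in> (fm (int (i + (s' + Suc n))) :: ('n, 'k) mpoly set)"
          have "\<exists>h\<in>fm (int i + 1). (\<Sum>m\<in>A. single m (lk g m)) - w ^ ?m * h \<in> J"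
            if "finite A" "A \<subseteq> keys g" for A
            using that
          proof (induction A)
            case empty
            show ?case using hom_idealD(1)[OF J] by (intro bexI[of _ 0]) simp_all
          next
            case (insert m A)
            then obtain h where h: "h \<in> fm (int i + 1)" "(\<Sum>m\<in>A. single m (lk g m)) - w ^ ?m * h \<in> J"
              by auto
            have "mdeg m = int (i + Suc ?m)" using g insert.prems by (auto simp: fm_def)
            from mono[OF this, of "lk g m"] obtain h' where h': "h' \<in> fm (int i + 1)"
              "single m (lk g m) - w ^ ?m * h' \<in> J" by blast
            have eq: "(\<Sum>m\<in>insert m A. single m (lk g m)) - w ^ ?m * (h' + h) =
                (single m (lk g m) - w ^ ?m * h') +
                ((\<Sum>m\<in>A. single m (lk g m)) - w ^ ?m * h)"
              using insert.hyps by (simp add: distrib_left)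
            show ?case
              by (rule bexI[of _ "h' + h"]) (use eq hom_idealD(2)[OF J h'(2) h(2)] fm_add[OF h'(1) h(1)] in simp_all)
          qed
          from this[of "keys g"] obtain h where h: "h \<in> fm (int i + 1)" "g - w ^ ?m * h \<in> J"
            using sum_singles[of "keys g" g] by auto
          \<comment> \<open>One factor w is set aside: \<open>w ^ m1 * h\<close> has degree
            \<open>i + ?m\<close>, where surjectivity is known. This needs \<open>?m\<close>
            positive, which s' \<ge> 1 provides.\<close>
          obtain m1 where m1: "?m = Suc m1" using s'(1) by (cases ?m) auto
          have "w ^ m1 * h \<in> fm (int (i + 1 + m1))"
            by (rule power_fm[OF w]) (use h(1) in \<open>simp add: add.commute\<close>)
          then have "w ^ m1 * h \<in> fm (int (i + ?m))" by (simp add: m1)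
          then obtain f where f: "f \<in> fm (int i)" "w ^ m1 * h - w ^ ?m * f \<in> J" using Suc by blast
          have eq: "g - w ^ (s' + Suc n) * f = (g - w ^ ?m * h) + w * (w ^ m1 * h - w ^ ?m * f)"
            unfolding add_Suc_right m1 by (simp add: right_diff_distrib mult.assoc)
          have "g - w ^ (s' + Suc n) * f \<in> J"
            unfolding eq by (rule hom_idealD(2)[OF J h(2) hom_idealD(4)[OF J f(2)]])
          then show "\<exists>f\<in>fm (int i). g - w ^ (s' + Suc n) * f \<in> J" using f(1) by blast
        qed
      qed (use surj in simp)
      from this[of "s - s'"] show "(\<forall>f\<in>fm (int i). w ^ s * f \<in> J \<longrightarrow> f \<in> J) \<or>
          (\<forall>g\<in>fm (int (i + s)). \<exists>f\<in>fm (int i). g - w ^ s * f \<in> J)" using s'(4) by simp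
    qed
  qed
qed

section \<open>The resolution as a graded complex\<close>

lemma lin_comb_coordinate:
  assumes "v \<in> lin_comb (\<lambda>i. vscale (w i)) p (vecs n \<inter> gvec e d)"
  shows "v t \<in> lin_comb (\<lambda>i h. w i * h) p (fm (d - int (e t)))"
proof -
  have "(\<lambda>v. v t) ` lin_comb (\<lambda>i. vscale (w i)) p (vecs n \<inter> gvec e d) =
      lin_comb (\<lambda>i h. w i * h) p ((\<lambda>v. v t) ` (vecs n \<inter> gvec e d))"
    by (rule lin_comb_hom) (simp_all add: vscale_def)
  also have "\<dots> \<subseteq> lin_comb (\<lambda>i h. w i * h) p (fm (d - int (e t)))"
    by (rule lin_comb_mono) (auto simp: gvec_def)
  finally show ?thesis using assms by blast
qed

text \<open>Cofactors are chosen in each coordinate separately and set to 0 from n on.\<close>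

lemma lin_comb_coordinatesI:
  assumes "v \<in> vecs n" "\<And>t. t < n \<Longrightarrow> v t \<in> lin_comb (\<lambda>i h. w i * h) p (fm (d - int (e t)))"
  shows "v \<in> lin_comb (\<lambda>i. vscale (w i)) p (vecs n \<inter> gvec e d)"
  using assms
proof (induction p arbitrary: v)
  case 0
  then have "v t = 0" for t by (cases "t < n") (auto simp: vecs_def)
  then show ?case by (simp add: fun_eq_iff)
next
  case (Suc p)
  have "\<forall>t. \<exists>f. t < n \<longrightarrow> (f \<in> fm (d - int (e t)) \<and> v t - w p * f \<in> lin_comb (\<lambda>i h. w i * h) p (fm (d - int (e t))))"
  proof
    fix t
    show "\<exists>f. t < n \<longrightarrow> (f \<in> fm (d - int (e t)) \<and> v t - w p * f \<in> lin_comb (\<lambda>i h. w i * h) p (fm (d - int (e t))))"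
    proof (cases "t < n")
      case True
      then obtain a f where "v t = a + w p * f" "a \<in> lin_comb (\<lambda>i h. w i * h) p (fm (d - int (e t)))"
        "f \<in> fm (d - int (e t))" using Suc.prems(2)[OF True] by auto
      then show ?thesis by (intro exI[of _ f]) simp
    qed simp
  qed
  then obtain f where f: "\<And>t. t < n \<Longrightarrow> f t \<in> fm (d - int (e t)) \<and>
      v t - w p * f t \<in> lin_comb (\<lambda>i h. w i * h) p (fm (d - int (e t)))" by metis
  define g where "g t = (if t < n then f t else 0)" for t
  have g: "g \<in> vecs n \<inter> gvec e d" using f by (auto simp: g_def vecs_def gvec_def)
  have "v - vscale (w p) g \<in> lin_comb (\<lambda>i. vscale (w i)) p (vecs n \<inter> gvec e d)"
  proof (rule Suc.IH)
    show "v - vscale (w p) g \<in> vecs n" using Suc.prems(1) g vecs_closed(3,4) by blast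
    show "(v - vscale (w p) g) t \<in> lin_comb (\<lambda>i h. w i * h) p (fm (d - int (e t)))" if "t < n" for t
      using f[OF that] that by (simp add: vscale_def g_def)
  qed
  moreover have "v = (v - vscale (w p) g) + vscale (w p) g" by simp
  ultimately show ?case unfolding lin_comb.simps mem_Collect_eq using g by blast
qed

lemma mem_partial_ideal_iff:
  assumes I: "hom_ideal I" and w: "\<And>p. w p \<in> fm 1" and f: "f \<in> fm d"
  shows "f \<in> partial_ideal I w p \<longleftrightarrow>
    (\<exists>y\<in>I \<inter> fm d. \<exists>a\<in>lin_comb (\<lambda>i h. w i * h) p (fm (d - 1)). f = y + a)"
  using f
proof (induction p arbitrary: f)
  case 0
  then show ?case by (auto simp: partial_ideal_0[OF I])
next
  case (Suc p)
  have J: "hom_ideal (partial_ideal I w p)" by (rule hom_ideal_partial[OF I w])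
  have fk: "f - k * w p \<in> fm d" if "k \<in> fm (d - 1)" for k
    using Suc.prems fm_mult[OF that w[of p]] by (intro fm_diff) simp_all
  have "f \<in> partial_ideal I w (Suc p) \<longleftrightarrow> (\<exists>k\<in>fm (d - 1). f - k * w p \<in> partial_ideal I w p)"
    unfolding partial_ideal_Suc by (rule hom_ideal_insert_fm[OF J w Suc.prems])
  also have "\<dots> \<longleftrightarrow> (\<exists>k\<in>fm (d - 1). \<exists>y\<in>I \<inter> fm d. \<exists>a\<in>lin_comb (\<lambda>i h. w i * h) p (fm (d - 1)). f - k * w p = y + a)"
    using Suc.IH[OF fk] by blast
  also have "\<dots> \<longleftrightarrow> (\<exists>y\<in>I \<inter> fm d. \<exists>a\<in>lin_comb (\<lambda>i h. w i * h) (Suc p) (fm (d - 1)). f = y + a)"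
  proof
    assume "\<exists>k\<in>fm (d - 1). \<exists>y\<in>I \<inter> fm d. \<exists>a\<in>lin_comb (\<lambda>i h. w i * h) p (fm (d - 1)). f - k * w p = y + a"
    then obtain k y a where *: "k \<in> fm (d - 1)" "y \<in> I \<inter> fm d" "a \<in> lin_comb (\<lambda>i h. w i * h) p (fm (d - 1))"
      "f - k * w p = y + a" by blast
    have "f = y + (a + w p * k)" using *(4) by (simp add: algebra_simps)
    moreover have "a + w p * k \<in> lin_comb (\<lambda>i h. w i * h) (Suc p) (fm (d - 1))" using * by auto
    ultimately show "\<exists>y\<in>I \<inter> fm d. \<exists>a\<in>lin_comb (\<lambda>i h. w i * h) (Suc p) (fm (d - 1)). f = y + a"
      using *(2) by blast
  next
    assume "\<exists>y\<in>I \<inter> fm d. \<exists>a\<in>lin_comb (\<lambda>i h. w i * h) (Suc p) (fm (d - 1)). f = y + a"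
    then obtain y a k where *: "k \<in> fm (d - 1)" "y \<in> I \<inter> fm d" "a \<in> lin_comb (\<lambda>i h. w i * h) p (fm (d - 1))"
      "f = y + (a + w p * k)" by auto
    have "f - k * w p = y + a" using *(4) by (simp add: algebra_simps)
    then show "\<exists>k\<in>fm (d - 1). \<exists>y\<in>I \<inter> fm d. \<exists>a\<in>lin_comb (\<lambda>i h. w i * h) p (fm (d - 1)). f - k * w p = y + a"
      using * by blast
  qed
  finally show ?case .
qed

lemma lookup_0_lin_comb:
  assumes "\<And>i. w i \<in> fm 1" "a \<in> lin_comb (\<lambda>i h. w i * h) p A"
  shows "lk a 0 = 0"
  using assms(2) lookup_0_fm[OF assms(1)] by (induction p arbitrary: a) (auto simp: lookup_add)

locale generic_forms_resolution = linear_basis w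
  for w :: "nat \<Rightarrow> ('n::finite, 'k::field) mpoly" +
  fixes I :: "('n, 'k) mpoly set" and \<phi> :: "nat \<Rightarrow> ('n, 'k) mpoly mat" and e :: "nat \<Rightarrow> nat \<Rightarrow> nat"
  assumes I: "hom_ideal I" and w_all: "\<And>i. w i \<in> fm 1"
    and almost: "\<And>p. p < CARD('n) \<Longrightarrow> almost_regular (partial_ideal I w p) (w p)"
    and minres: "minimal_graded_free_resolution I \<phi> e"
begin

text \<open>S, with its generator in degree 0, is put in front of the resolution of I, which shifts
  all indices by one.\<close>

definition rk :: "nat \<Rightarrow> nat" where "rk j = (case j of 0 \<Rightarrow> 1 | Suc i \<Rightarrow> dim_col (\<phi> i))"
definition dg :: "nat \<Rightarrow> nat \<Rightarrow> nat" where "dg j = (case j of 0 \<Rightarrow> \<lambda>_. 0 | Suc i \<Rightarrow> e i)"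

definition F :: "nat \<Rightarrow> int \<Rightarrow> (nat \<Rightarrow> ('n, 'k) mpoly) set" where
  "F j d = vecs (rk j) \<inter> gvec (dg j) d"

lemma rk_simps [simp]: "rk 0 = 1" "rk (Suc i) = dim_col (\<phi> i)"
  and dg_simps [simp]: "dg 0 = (\<lambda>_. 0)" "dg (Suc i) = e i"
  by (simp_all add: rk_def dg_def)

lemma resolution:
  shows dim_row_\<phi>: "dim_row (\<phi> j) = rk j"
    and homogeneous_\<phi>: "homogeneous_mat (\<phi> j) (dg j) (dg (Suc j))"
    and image_\<phi>_0: "mapv (\<phi> 0) ` vecs (dim_col (\<phi> 0)) = {v \<in> vecs 1. v 0 \<in> I}"
    and image_\<phi>_Suc: "mapv (\<phi> (Suc i)) ` vecs (dim_col (\<phi> (Suc i))) = kerv (\<phi> i)"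
proof -
  have res: "graded_free_resolution I \<phi> e" using minres by (simp add: minimal_graded_free_resolution_def)
  note * = res[unfolded graded_free_resolution_alt]
  show "dim_row (\<phi> j) = rk j" using * by (cases j) simp_all
  show "homogeneous_mat (\<phi> j) (dg j) (dg (Suc j))" using * by (cases j) simp_all
  show "mapv (\<phi> 0) ` vecs (dim_col (\<phi> 0)) = {v \<in> vecs 1. v 0 \<in> I}"
    "mapv (\<phi> (Suc i)) ` vecs (dim_col (\<phi> (Suc i))) = kerv (\<phi> i)" using * by simp_all
qed

lemma minimal_entry:
  "s < dim_col (\<phi> i) \<Longrightarrow> t < dim_col (\<phi> (Suc i)) \<Longrightarrow> lk (\<phi> (Suc i) $$ (s, t)) 0 = 0"
  using minres by (simp add: minimal_graded_free_resolution_def mem_irrelevant_ideal)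

lemma vcomp_id: "v \<in> gvec e' d \<Longrightarrow> vcomp e' d v = v"
proof
  fix t assume "v \<in> gvec e' d"
  then have "v t \<in> fm (d - int (e' t))" by (simp add: gvec_def)
  then show "vcomp e' d v t = v t" by (simp add: vcomp_def hcomp_fm)
qed

lemmas mem_partial_iff = mem_partial_ideal_iff[where w = w, OF I w_all]

lemma vcomp_F: "u \<in> vecs (rk j) \<Longrightarrow> vcomp (dg j) d u \<in> F j d"
  using vcomp_gvec[of "dg j" d u] by (auto simp: F_def vecs_def vcomp_def)

lemma mapv_F: "x \<in> F (Suc j) d \<Longrightarrow> mapv (\<phi> j) x \<in> F j d"
proof -
  assume "x \<in> F (Suc j) d"
  then have "mapv (\<phi> j) x = vcomp (dg j) d (mapv (\<phi> j) x)"
    using mapv_vcomp[OF homogeneous_\<phi>[of j], of d x] vcomp_id[of x "dg (Suc j)" d]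
    by (auto simp: F_def)
  moreover have "mapv (\<phi> j) x \<in> vecs (rk j)" by (simp add: vecs_def mapv_def dim_row_\<phi>)
  ultimately show ?thesis using vcomp_F by metis
qed

lemma image_graded:
  assumes "v \<in> mapv (\<phi> j) ` vecs (dim_col (\<phi> j))" "v \<in> gvec (dg j) d"
  shows "v \<in> mapv (\<phi> j) ` F (Suc j) d"
proof -
  obtain u where u: "u \<in> vecs (dim_col (\<phi> j))" "v = mapv (\<phi> j) u" using assms(1) by blast
  have "v = vcomp (dg j) d v" using vcomp_id[OF assms(2)] by simp
  then have "v = mapv (\<phi> j) (vcomp (dg (Suc j)) d u)"
    using mapv_vcomp[OF homogeneous_\<phi>[of j], of d u] u(2) by simp
  then show ?thesis using vcomp_F[of u "Suc j" d] u(1) by simp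
qed

lemma F_generated:
  assumes "v \<in> F j d" "\<And>t. lk (v t) 0 = 0"
  shows "v \<in> lin_comb (\<lambda>i. vscale (w i)) CARD('n) (F j (d - 1))"
  unfolding F_def
proof (rule lin_comb_coordinatesI)
  show "v \<in> vecs (rk j)" using assms(1) by (simp add: F_def)
  fix t
  have "v t \<in> fm (d - int (dg j t))" using assms(1) by (simp add: F_def gvec_def)
  then show "v t \<in> lin_comb (\<lambda>i h. w i * h) CARD('n) (fm (d - 1 - int (dg j t)))"
    using w_generates[of "v t" "d - int (dg j t)"] assms(2) by (simp add: algebra_simps)
qed

sublocale graded_complex F "\<lambda>i. vscale (w i)" "\<lambda>j. mapv (\<phi> j)" "CARD('n)"
proof
  show "is_subgroup (F j d)" for j d
    by (auto simp: is_subgroup_def F_def gvec_def vecs_closed fm_diff)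
  show "vscale (w i) (x - y) = vscale (w i) x - vscale (w i) y" for i x y
    by (rule ext) (simp add: vscale_def right_diff_distrib)
  show "vscale (w i) x \<in> F j (d + 1)" if x: "x \<in> F j d" for i x j d
  proof -
    have "w i * x t \<in> fm (d + 1 - int (dg j t))" for t
    proof -
      have "x t \<in> fm (d - int (dg j t))" using x by (simp add: F_def gvec_def)
      then have "w i * x t \<in> fm (1 + (d - int (dg j t)))" by (rule fm_mult[OF w_all])
      then show ?thesis by (simp add: algebra_simps)
    qed
    then show ?thesis using x by (simp add: F_def vecs_closed) (simp add: gvec_def vscale_def)
  qed
  show "vscale (w i) (vscale (w i') x) = vscale (w i') (vscale (w i) x)" for i i' x
    by (rule ext) (simp add: vscale_def mult.left_commute)
  show "mapv (\<phi> j) (x - y) = mapv (\<phi> j) x - mapv (\<phi> j) y" for j x y by (rule mapv_diff)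
  show "mapv (\<phi> j) x \<in> F j d" if "x \<in> F (Suc j) d" for x j d using mapv_F[OF that] .
  show "mapv (\<phi> j) (vscale (w i) x) = vscale (w i) (mapv (\<phi> j) x)" for j i x by (rule mapv_scale)
  show "x \<in> mapv (\<phi> (Suc j)) ` F (Suc (Suc j)) d" if "x \<in> F (Suc j) d" "mapv (\<phi> j) x = 0" for x j d
  proof (rule image_graded)
    show "x \<in> mapv (\<phi> (Suc j)) ` vecs (dim_col (\<phi> (Suc j)))"
      unfolding image_\<phi>_Suc using that by (simp add: kerv_def F_def)
    show "x \<in> gvec (dg (Suc j)) d" using that(1) by (simp add: F_def)
  qed
  show "mapv (\<phi> j) (mapv (\<phi> (Suc j)) y) = 0" if "y \<in> F (Suc (Suc j)) d" for y j d
  proof -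
    have "mapv (\<phi> (Suc j)) y \<in> kerv (\<phi> j)" unfolding image_\<phi>_Suc[symmetric] using that by (simp add: F_def)
    then show ?thesis by (simp add: kerv_def)
  qed
  show "z \<in> lin_comb (\<lambda>i. vscale (w i)) p (F j (d - 1))"
    if p: "p < CARD('n)" and z: "z \<in> F j d" and pz: "vscale (w p) z \<in> lin_comb (\<lambda>i. vscale (w i)) p (F j d)"
    for p z j d
    unfolding F_def
  proof (rule lin_comb_coordinatesI)
    show "z \<in> vecs (rk j)" using z by (simp add: F_def)
    fix t
    have "z t \<in> fm (d - int (dg j t))" using z by (simp add: F_def gvec_def)
    moreover have "w p * z t \<in> lin_comb (\<lambda>i h. w i * h) p (fm (d - int (dg j t)))"
      using lin_comb_coordinate[OF pz[unfolded F_def], of t] by (simp add: vscale_def)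
    ultimately have "z t \<in> lin_comb (\<lambda>i h. w i * h) p (fm (d - int (dg j t) - 1))" by (rule w_regular[OF p])
    then show "z t \<in> lin_comb (\<lambda>i h. w i * h) p (fm (d - 1 - int (dg j t)))" by (simp add: algebra_simps)
  qed
qed

text \<open>\<open>I j l d\<close> holds for \<open>j \<ge> l\<close>. By minimality \<open>Z j\<close> lies in \<open>m F j\<close>, where \<open>m\<close> is the irrelevant ideal,
  so \<open>Z j = m Z j\<close>, and a basis vector of \<open>F (j+1)\<close> would lie in \<open>m F (j+1)\<close>.\<close>

lemma syzygy:
  assumes j: "j \<ge> CARD('n)"
  shows "dim_col (\<phi> j) = 0"
proof (rule ccontr)
  assume "dim_col (\<phi> j) \<noteq> 0"
  then have pos: "0 < dim_col (\<phi> j)" by simp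
  \<comment> \<open>Minimality restricts only the maps \<open>\<phi> (Suc i)\<close>, so j = 0 has
    to be excluded; there is at least one variable.\<close>
  have "CARD('n) > 0" by simp
  then obtain i where i: "j = Suc i" using j by (cases j) auto
  define b :: "nat \<Rightarrow> ('n, 'k) mpoly" where "b t = (if t = 0 then 1 else 0)" for t
  define d where "d = int (e j 0)"
  have b: "b \<in> F (Suc j) d" using pos by (auto simp: F_def b_def vecs_def gvec_def d_def)
  have \<Phi>b: "mapv (\<phi> j) b s = (if s < dim_row (\<phi> j) then \<phi> j $$ (s, 0) else 0)" for s
  proof -
    have "(\<Sum>t<dim_col (\<phi> j). \<phi> j $$ (s, t) * b t) = (\<Sum>t<dim_col (\<phi> j). if t = 0 then \<phi> j $$ (s, 0) else 0)"
      by (rule sum.cong) (auto simp: b_def)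
    then show ?thesis using pos by (simp add: mapv_def)
  qed
  have "lk (mapv (\<phi> j) b s) 0 = 0" for s
    using minimal_entry[of s i 0] pos dim_row_\<phi>[of j] by (simp add: \<Phi>b[unfolded i] i)
  then have "mapv (\<phi> j) b \<in> lin_comb (\<lambda>i. vscale (w i)) CARD('n) (F j (d - 1))"
    by (rule F_generated[OF mapv_F[OF b]])
  moreover have "mapv (\<phi> j) b \<in> Z j d" using b by (simp add: Z_def)
  ultimately have "mapv (\<phi> j) b \<in> lin_comb (\<lambda>i. vscale (w i)) CARD('n) (Z j (d - 1))"
    using I_le[OF j order_refl, of d] unfolding I_def by blast
  then obtain v where v: "v \<in> lin_comb (\<lambda>i. vscale (w i)) CARD('n) (F (Suc j) (d - 1))"
    "mapv (\<phi> j) b = mapv (\<phi> j) v" unfolding Z_def \<Phi>_L[symmetric] by blast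
  have v': "lk (v t) 0 = 0" "v \<in> vecs (rk (Suc j))" for t
  proof -
    show "lk (v t) 0 = 0"
      using lookup_0_lin_comb[OF w_all lin_comb_coordinate[OF v(1)[unfolded F_def], of t]] .
    have "lin_comb (\<lambda>i. vscale (w i)) q (F (Suc j) (d - 1)) \<subseteq> vecs (rk (Suc j))" for q
      by (induction q) (auto simp: F_def vecs_closed)
    then show "v \<in> vecs (rk (Suc j))" using v(1) by blast
  qed
  have "b - v \<in> kerv (\<phi> j)"
    using b v' v(2) by (simp add: kerv_def F_def vecs_closed mapv_diff)
  \<comment> \<open>A vector of the kernel is an image under the next matrix, so its constant terms
    vanish; those of v vanish too, but b has constant term 1.\<close>
  then obtain u where u: "b - v = mapv (\<phi> (Suc j)) u" unfolding image_\<phi>_Suc[symmetric] by blast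
  have "lk (mapv (\<phi> (Suc j)) u 0) 0 = 0"
    using minimal_entry[of 0 j] pos dim_row_\<phi>[of "Suc j"]
    by (simp add: mapv_def lookup_sum)
  then have "lk (b 0) 0 = 0" using v'(1)[of 0] unfolding u[symmetric] by (simp add: lookup_minus)
  then show False by (simp add: b_def)
qed

lemma Z_0: "Z 0 d = {v \<in> vecs 1. v 0 \<in> I \<inter> fm d}"
proof
  show "Z 0 d \<subseteq> {v \<in> vecs 1. v 0 \<in> I \<inter> fm d}"
  proof
    fix v assume "v \<in> Z 0 d"
    then obtain u where u: "u \<in> F 1 d" "v = mapv (\<phi> 0) u" by (auto simp: Z_def)
    then have "v \<in> {v \<in> vecs 1. v 0 \<in> I}" unfolding image_\<phi>_0[symmetric] by (auto simp: F_def)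
    moreover have "v \<in> F 0 d" using mapv_F[of u 0 d] u by simp
    then have "v 0 \<in> fm (d - 0)" by (simp add: F_def gvec_def)
    ultimately show "v \<in> {v \<in> vecs 1. v 0 \<in> I \<inter> fm d}" by simp
  qed
  show "{v \<in> vecs 1. v 0 \<in> I \<inter> fm d} \<subseteq> Z 0 d"
  proof
    fix v assume v: "v \<in> {v \<in> vecs 1. v 0 \<in> I \<inter> fm d}"
    have "v \<in> gvec (dg 0) d"
      unfolding gvec_def
    proof (intro CollectI allI)
      fix t show "v t \<in> fm (d - int (dg 0 t))" using v by (cases "t = 0") (auto simp: vecs_def)
    qed
    then show "v \<in> Z 0 d" unfolding Z_def
      using v by (intro image_graded) (simp_all add: image_\<phi>_0)
  qed
qed

text \<open>Entry and exit of the abstract argument: almost regularity provides \<open>C 0\<close>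
  in large degrees, and the sharp bound on S/I is read off from \<open>C 0\<close>.\<close>

lemma C_0_iff:
  "C 0 p d \<longleftrightarrow> (\<forall>z\<in>fm d. w p * z \<in> partial_ideal I w p \<longrightarrow> z \<in> partial_ideal I w p)"
proof
  assume C: "C 0 p d"
  show "\<forall>z\<in>fm d. w p * z \<in> partial_ideal I w p \<longrightarrow> z \<in> partial_ideal I w p"
  proof (intro ballI impI)
    fix z assume z: "z \<in> fm d" "w p * z \<in> partial_ideal I w p"
    let ?v = "\<lambda>f t. if t = 0 then f else 0 :: ('n, 'k) mpoly"
    have "w p * z \<in> fm (d + 1)" using fm_mult[OF w_all z(1)] by (simp add: add.commute)
    from z(2)[unfolded mem_partial_iff[OF this]] obtain y a where
      y: "y \<in> I \<inter> fm (d + 1)" and a: "a \<in> lin_comb (\<lambda>i h. w i * h) p (fm (d + 1 - 1))" and eq: "w p * z = y + a"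
      by blast
    have vz: "?v z \<in> F 0 d" using z(1) by (auto simp: F_def vecs_def gvec_def)
    have vy: "?v y \<in> Z 0 (d + 1)" using y unfolding Z_0 by (auto simp: vecs_def)
    have va: "?v a \<in> lin_comb (\<lambda>i. vscale (w i)) p (F 0 d)"
      unfolding F_def by (rule lin_comb_coordinatesI) (use a in \<open>auto simp: vecs_def\<close>)
    have "vscale (w p) (?v z) = ?v y + ?v a" using eq by (auto simp: vscale_def fun_eq_iff)
    then obtain y' a' where ya: "y' \<in> Z 0 d" "a' \<in> lin_comb (\<lambda>i. vscale (w i)) p (F 0 (d - 1))" "?v z = y' + a'"
      by (rule CD[OF C vz vy va])
    have "z = y' 0 + a' 0" using fun_cong[OF ya(3), of 0] by simp
    moreover have "a' 0 \<in> lin_comb (\<lambda>i h. w i * h) p (fm (d - 1))"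
      using lin_comb_coordinate[OF ya(2)[unfolded F_def], of 0] by simp
    moreover have "y' 0 \<in> I \<inter> fm d" using ya(1) unfolding Z_0 by simp
    ultimately show "z \<in> partial_ideal I w p" unfolding mem_partial_iff[OF z(1)] by blast
  qed
next
  assume *: "\<forall>z\<in>fm d. w p * z \<in> partial_ideal I w p \<longrightarrow> z \<in> partial_ideal I w p"
  show "C 0 p d"
    unfolding C_def
  proof (intro ballI impI)
    fix z y a assume z: "z \<in> F 0 d" and y: "y \<in> Z 0 (d + 1)" and a: "a \<in> lin_comb (\<lambda>i. vscale (w i)) p (F 0 d)"
      and eq: "vscale (w p) z = y + a"
    have z0: "z 0 \<in> fm d" and zv: "z \<in> vecs 1" using z by (auto simp: F_def gvec_def)
    have "w p * z 0 = y 0 + a 0" using fun_cong[OF eq, of 0] by (simp add: vscale_def)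
    moreover have "y 0 \<in> I \<inter> fm (d + 1)" using y unfolding Z_0 by simp
    moreover have "a 0 \<in> lin_comb (\<lambda>i h. w i * h) p (fm (d + 1 - 1))"
      using lin_comb_coordinate[OF a[unfolded F_def], of 0] by simp
    moreover have "w p * z 0 \<in> fm (d + 1)" using fm_mult[OF w_all z0] by (simp add: add.commute)
    ultimately have "w p * z 0 \<in> partial_ideal I w p" using mem_partial_iff by blast
    then have "z 0 \<in> partial_ideal I w p" using * z0 by blast
    then obtain y' a' where ya: "y' \<in> I \<inter> fm d" "a' \<in> lin_comb (\<lambda>i h. w i * h) p (fm (d - 1))" "z 0 = y' + a'"
      unfolding mem_partial_iff[OF z0] by blast
    let ?v = "\<lambda>f t. if t = 0 then f else 0 :: ('n, 'k) mpoly"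
    have "z = ?v y' + ?v a'" using ya(3) zv by (auto simp: fun_eq_iff vecs_def)
    moreover have "?v y' \<in> Z 0 d" unfolding Z_0 using ya(1) by (auto simp: vecs_def)
    moreover have "?v a' \<in> lin_comb (\<lambda>i. vscale (w i)) p (F 0 (d - 1))"
      unfolding F_def by (rule lin_comb_coordinatesI) (use ya(2) in \<open>auto simp: vecs_def\<close>)
    ultimately show "\<exists>y'\<in>Z 0 d. \<exists>a'\<in>lin_comb (\<lambda>i. vscale (w i)) p (F 0 (d - 1)). z = y' + a'" by blast
  qed
qed

lemma C_0_large: "\<exists>D. \<forall>p<CARD('n). \<forall>d\<ge>D. C 0 p d"
proof -
  have "\<exists>D. \<forall>p<q. \<forall>d\<ge>D. C 0 p d" if "q \<le> CARD('n)" for q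
    using that
  proof (induction q)
    case (Suc q)
    then obtain D where D: "\<forall>p<q. \<forall>d\<ge>D. C 0 p d" by auto
    obtain D' where D': "\<forall>d\<ge>D'. \<forall>z\<in>fm d. w q * z \<in> partial_ideal I w q \<longrightarrow> z \<in> partial_ideal I w q"
      using almost[of q] Suc.prems unfolding almost_regular_def by auto
    have "C 0 p d" if "p < Suc q" "d \<ge> max D D'" for p d
    proof (cases "p = q")
      case True
      have "D' \<le> d" using that by simp
      then show ?thesis using D' unfolding C_0_iff True by blast
    qed (use D that in auto)
    then show ?case by blast
  qed simp
  then show ?thesis by blast
qed

theorem injective_from_degree:
  assumes r: "\<And>j t. t < dim_col (\<phi> j) \<Longrightarrow> int (e j t) \<le> r + int j"
    and "p < CARD('n)" "d \<ge> r" "z \<in> fm d" "w p * z \<in> partial_ideal I w p"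
  shows "z \<in> partial_ideal I w p"
proof -
  obtain D where D: "\<forall>p<CARD('n). \<forall>d\<ge>D. C 0 p d" using C_0_large by blast
  have "C 0 p d"
  proof (rule C_of_generator_degrees[of r D])
    \<comment> \<open>All generators of \<open>F (Suc j)\<close> have degree at most r + j < d, so
      every coordinate has positive degree and no constant term.\<close>
    fix j :: nat and d assume d: "d > r + int j"
    show "F (Suc j) d \<subseteq> lin_comb (\<lambda>i. vscale (w i)) CARD('n) (F (Suc j) (d - 1))"
    proof
      fix v assume v: "v \<in> F (Suc j) d"
      have "lk (v t) 0 = 0" for t
      proof (cases "t < dim_col (\<phi> j)")
        case True
        have "v t \<in> fm (d - int (e j t))" using v by (simp add: F_def gvec_def)
        then show ?thesis by (rule lookup_0_fm) (use r[OF True] d in simp)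
      qed (use v in \<open>simp add: F_def vecs_def\<close>)
      then show "v \<in> lin_comb (\<lambda>i. vscale (w i)) CARD('n) (F (Suc j) (d - 1))"
        by (rule F_generated[OF v])
    qed
  qed (use D assms in auto)
  then show ?thesis using assms(4,5) unfolding C_0_iff by blast
qed

end

lemma injective_from_regularity:
  fixes w :: "nat \<Rightarrow> ('n::finite, 'k::field) mpoly"
  assumes I: "hom_ideal I" and w: "\<And>p. w p \<in> fm 1"
    and indep: "\<And>p. p < CARD('n) \<Longrightarrow> w p \<notin> K.span (w ` {..<p})"
    and almost: "\<And>p. p < CARD('n) \<Longrightarrow> almost_regular (partial_ideal I w p) (w p)"
    and p: "p < CARD('n)" and d: "d \<ge> regularity I" and z: "z \<in> fm d" "w p * z \<in> partial_ideal I w p"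
  shows "z \<in> partial_ideal I w p"
proof -
  \<comment> \<open>This is the resolution selected inside \<open>graded_betti\<close>, so the Betti
    numbers count its generators.\<close>
  define res where "res = (SOME (\<phi>, e). minimal_graded_free_resolution I \<phi> e)"
  obtain \<phi> e where res: "res = (\<phi>, e)" by (cases res)
  have "\<exists>x. case x of (\<phi>, e) \<Rightarrow> minimal_graded_free_resolution I \<phi> e"
    using minimal_resolution_exists[OF I] by auto
  from someI_ex[OF this] have min: "minimal_graded_free_resolution I \<phi> e"
    unfolding res_def[symmetric] res by simp
  have betti: "graded_betti I i j = card {t. t < dim_col (\<phi> i) \<and> e i t = j}" for i j
    unfolding graded_betti_def res_def[symmetric] res by simp
  have betti_ne: "graded_betti I i j \<noteq> 0 \<longleftrightarrow> (\<exists>t<dim_col (\<phi> i). e i t = j)" for i j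
    unfolding betti by (auto simp: card_eq_0_iff)
  interpret generic_forms_resolution w I \<phi> e
    by unfold_locales (use assms min in auto)
  let ?A = "{int (Max {j. graded_betti I i j \<noteq> 0}) - int i | i. \<exists>j. graded_betti I i j \<noteq> 0}"
  \<comment> \<open>\<open>Max\<close> is meaningful for a finite set only; \<open>syzygy\<close>
    bounds the homological index.\<close>
  have "?A \<subseteq> (\<lambda>i. int (Max {j. graded_betti I i j \<noteq> 0}) - int i) ` {..<CARD('n)}"
  proof
    fix x assume "x \<in> ?A"
    then obtain i j where ij: "x = int (Max {j. graded_betti I i j \<noteq> 0}) - int i" "graded_betti I i j \<noteq> 0" by auto
    then have "\<exists>t<dim_col (\<phi> i). e i t = j" using betti_ne by blast
    then have "i < CARD('n)" using syzygy[of i] by (cases "i < CARD('n)") auto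
    then show "x \<in> (\<lambda>i. int (Max {j. graded_betti I i j \<noteq> 0}) - int i) ` {..<CARD('n)}" using ij(1) by blast
  qed
  then have fin: "finite ?A" by (rule finite_subset) simp
  have "int (e j t) \<le> regularity I + int j" if t: "t < dim_col (\<phi> j)" for j t
  proof -
    have "{i. graded_betti I j i \<noteq> 0} = e j ` {..<dim_col (\<phi> j)}" unfolding betti_ne by auto
    then have "finite {i. graded_betti I j i \<noteq> 0}" by simp
    moreover have ne: "graded_betti I j (e j t) \<noteq> 0" unfolding betti_ne using t by blast
    ultimately have "e j t \<le> Max {i. graded_betti I j i \<noteq> 0}" by (intro Max_ge) auto
    moreover have "int (Max {i. graded_betti I j i \<noteq> 0}) - int j \<le> regularity I"
      unfolding regularity_def by (rule Max_ge[OF fin]) (use ne in blast)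
    ultimately show ?thesis by linarith
  qed
  from injective_from_degree[OF this p d z] show ?thesis .
qed

section \<open>Quotient rings\<close>

text \<open>Stated for any homomorphism h from S with kernel J, so that it applies to S/I and to
  quotients of S/I without identifying the latter with quotients of S.\<close>

lemma has_SLP_quotient:
  fixes h :: "('n::finite, 'k::field) mpoly \<Rightarrow> 'a" and R :: "('a, 'b) ring_scheme"
  assumes h: "ring_hom_ring mpoly_ring R h" and ker: "\<And>f. h f = \<zero>\<^bsub>R\<^esub> \<longleftrightarrow> f \<in> J"
    and w: "w \<in> forms 1"
  shows "has_SLP R (\<lambda>d. h ` forms d) (h w) \<longleftrightarrow> (\<forall>i. \<forall>s\<ge>1. full_rank J w i s)"
proof -
  interpret h: ring_hom_ring mpoly_ring R h by (rule h)
  have h_eq: "h f = h g \<longleftrightarrow> f - g \<in> J" for f g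
  proof -
    have "h f = h ((f - g) + g)" by simp
    also have "\<dots> = h (f - g) \<oplus>\<^bsub>R\<^esub> h g" using h.hom_add[of "f - g" g] by simp
    finally have "h f = h g \<longleftrightarrow> h (f - g) \<oplus>\<^bsub>R\<^esub> h g = h g" by simp
    also have "\<dots> \<longleftrightarrow> h (f - g) = \<zero>\<^bsub>R\<^esub>"
      using h.S.add.r_cancel_one[of "h g" "h (f - g)"] h.hom_closed[of g] h.hom_closed[of "f - g"] by simp
    finally show ?thesis by (simp add: ker)
  qed
  have pow: "h w [^]\<^bsub>R\<^esub> (s::nat) \<otimes>\<^bsub>R\<^esub> h f = h (w ^ s * f)" for s f
  proof -
    have "h w [^]\<^bsub>R\<^esub> s = h (w ^ s)"
    proof (induction s)
      case 0
      show ?case using h.hom_one by simp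
    next
      case (Suc s)
      then show ?case using h.hom_mult[of "w ^ s" w] by (simp add: mult.commute)
    qed
    then show ?thesis using h.hom_mult[of "w ^ s" f] by simp
  qed
  have "inj_on (\<lambda>x. h w [^]\<^bsub>R\<^esub> s \<otimes>\<^bsub>R\<^esub> x) (h ` forms i) \<longleftrightarrow> (\<forall>f\<in>fm (int i). w ^ s * f \<in> J \<longrightarrow> f \<in> J)"
    for i s
  proof
    assume inj: "inj_on (\<lambda>x. h w [^]\<^bsub>R\<^esub> s \<otimes>\<^bsub>R\<^esub> x) (h ` forms i)"
    show "\<forall>f\<in>fm (int i). w ^ s * f \<in> J \<longrightarrow> f \<in> J"
    proof (intro ballI impI)
      fix f assume f: "f \<in> fm (int i)" "w ^ s * f \<in> J"
      have "h (w ^ s * f) = h (w ^ s * 0)" unfolding h_eq using f(2) by simp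
      then have "h w [^]\<^bsub>R\<^esub> s \<otimes>\<^bsub>R\<^esub> h f = h w [^]\<^bsub>R\<^esub> s \<otimes>\<^bsub>R\<^esub> h 0" unfolding pow .
      moreover have "h f \<in> h ` forms i" "h 0 \<in> h ` forms i"
        using f(1) by (auto simp: forms_eq_fm)
      ultimately have "h f = h 0" by (rule inj_onD[OF inj])
      then show "f \<in> J" unfolding h_eq by simp
    qed
  next
    assume inj: "\<forall>f\<in>fm (int i). w ^ s * f \<in> J \<longrightarrow> f \<in> J"
    show "inj_on (\<lambda>x. h w [^]\<^bsub>R\<^esub> s \<otimes>\<^bsub>R\<^esub> x) (h ` forms i)"
    proof (rule inj_onI, elim imageE)
      fix x y f g assume xy: "h w [^]\<^bsub>R\<^esub> s \<otimes>\<^bsub>R\<^esub> x = h w [^]\<^bsub>R\<^esub> s \<otimes>\<^bsub>R\<^esub> y"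
        and fg: "x = h f" "f \<in> forms i" "y = h g" "g \<in> forms i"
      have "w ^ s * (f - g) \<in> J" using xy unfolding fg pow h_eq right_diff_distrib .
      moreover have "f - g \<in> fm (int i)" using fg by (simp add: forms_eq_fm fm_diff)
      ultimately show "x = y" unfolding fg h_eq using inj by blast
    qed
  qed
  moreover have "(\<lambda>x. h w [^]\<^bsub>R\<^esub> s \<otimes>\<^bsub>R\<^esub> x) ` h ` forms i = h ` forms (i + s) \<longleftrightarrow>
      (\<forall>g\<in>fm (int (i + s)). \<exists>f\<in>fm (int i). g - w ^ s * f \<in> J)" for i s
  proof -
    have w1: "w \<in> fm 1" using w by (simp add: forms_eq_fm)
    have "(\<lambda>x. h w [^]\<^bsub>R\<^esub> s \<otimes>\<^bsub>R\<^esub> x) ` h ` forms i \<subseteq> h ` forms (i + s)"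
      using power_fm[OF w1] by (auto simp: pow forms_eq_fm)
    then have "(\<lambda>x. h w [^]\<^bsub>R\<^esub> s \<otimes>\<^bsub>R\<^esub> x) ` h ` forms i = h ` forms (i + s) \<longleftrightarrow>
        (\<forall>g\<in>forms (i + s). h g \<in> (\<lambda>x. h w [^]\<^bsub>R\<^esub> s \<otimes>\<^bsub>R\<^esub> x) ` h ` forms i)"
      by blast
    also have "\<dots> \<longleftrightarrow> (\<forall>g\<in>forms (i + s). \<exists>f\<in>forms i. h g = h (w ^ s * f))"
      by (simp add: image_image pow image_iff)
    finally show ?thesis unfolding h_eq forms_eq_fm .
  qed
  ultimately show ?thesis
    unfolding has_SLP_def full_rank_def Let_def using w by auto
qed

lemma ring_hom_quotient:
  fixes R :: "('a, 'b) ring_scheme"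
  assumes h: "ring_hom_ring mpoly_ring R (h :: ('n, 'k::field) mpoly \<Rightarrow> 'a)" and K: "ideal K R"
  shows "ring_hom_ring mpoly_ring (R Quot K) (\<lambda>f. K +>\<^bsub>R\<^esub> h f)"
    and "K +>\<^bsub>R\<^esub> h f = \<zero>\<^bsub>R Quot K\<^esub> \<longleftrightarrow> h f \<in> K"
proof -
  interpret h: ring_hom_ring mpoly_ring R h by (rule h)
  interpret K: ideal K R by (rule K)
  have q: "ring_hom_ring R (R Quot K) ((+>\<^bsub>R\<^esub>) K)" by (rule K.rcos_ring_hom_ring)
  have "(+>\<^bsub>R\<^esub>) K \<circ> h \<in> Ring.ring_hom mpoly_ring (R Quot K)"
    by (rule ring_hom_trans[OF h.homh ring_hom_ring.homh[OF q]])
  then show "ring_hom_ring mpoly_ring (R Quot K) (\<lambda>f. K +>\<^bsub>R\<^esub> h f)"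
    using ring_mpoly_ring K.quotient_is_ring
    by (intro ring_hom_ringI2) (simp_all add: comp_def)
  have hf: "h f \<in> carrier R" using h.hom_closed[of f] by simp
  have "K +>\<^bsub>R\<^esub> h f = K \<longleftrightarrow> h f \<in> K"
  proof
    assume "K +>\<^bsub>R\<^esub> h f = K"
    then show "h f \<in> K" using K.a_rcos_self[OF hf] by simp
  next
    assume "h f \<in> K"
    then show "K +>\<^bsub>R\<^esub> h f = K" by (rule K.a_rcos_const)
  qed
  then show "K +>\<^bsub>R\<^esub> h f = \<zero>\<^bsub>R Quot K\<^esub> \<longleftrightarrow> h f \<in> K" by (simp add: FactRing_def)
qed

text \<open>The preimage under h of an ideal generated by images is J + \<langle>W\<rangle>; so the
  ideals in the definition of the k-SLP lift to S.\<close>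

lemma hom_mem_Idl:
  fixes R :: "('a, 'b) ring_scheme"
  assumes h: "ring_hom_ring mpoly_ring R (h :: ('n, 'k::field) mpoly \<Rightarrow> 'a)"
    and surj: "h ` UNIV = carrier R" and ker: "\<And>f. h f = \<zero>\<^bsub>R\<^esub> \<longleftrightarrow> f \<in> J" and J: "S.subspace J"
  shows "h f \<in> Idl\<^bsub>R\<^esub> (h ` W) \<longleftrightarrow> f \<in> S.span (J \<union> W)"
proof -
  interpret h: ring_hom_ring mpoly_ring R h by (rule h)
  have sub: "h ` W \<subseteq> carrier R" using surj by blast
  have K: "ideal (Idl\<^bsub>R\<^esub> (h ` W)) R" by (rule h.S.genideal_ideal[OF sub])
  interpret K: ideal "Idl\<^bsub>R\<^esub> (h ` W)" R by (rule K)
  have z: "\<zero>\<^bsub>R\<^esub> \<in> Idl\<^bsub>R\<^esub> (h ` W)" by (rule additive_subgroup.zero_closed[OF K.additive_subgroup_axioms])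
  have "S.subspace {f. h f \<in> Idl\<^bsub>R\<^esub> (h ` W)}"
  proof (rule S.subspaceI)
    show "0 \<in> {f. h f \<in> Idl\<^bsub>R\<^esub> (h ` W)}" using z ker[of 0] S.subspace_0[OF J] by simp
    show "x + y \<in> {f. h f \<in> Idl\<^bsub>R\<^esub> (h ` W)}" if "x \<in> {f. h f \<in> Idl\<^bsub>R\<^esub> (h ` W)}" "y \<in> {f. h f \<in> Idl\<^bsub>R\<^esub> (h ` W)}" for x y
      using that h.hom_add[of x y] additive_subgroup.a_closed[OF K.additive_subgroup_axioms] by simp
    show "c * x \<in> {f. h f \<in> Idl\<^bsub>R\<^esub> (h ` W)}" if "x \<in> {f. h f \<in> Idl\<^bsub>R\<^esub> (h ` W)}" for c x
      using that h.hom_mult[of c x] K.I_l_closed[of "h x" "h c"] h.hom_closed[of c] by simp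
  qed
  moreover have "J \<union> W \<subseteq> {f. h f \<in> Idl\<^bsub>R\<^esub> (h ` W)}"
  proof
    fix x assume "x \<in> J \<union> W"
    then show "x \<in> {f. h f \<in> Idl\<^bsub>R\<^esub> (h ` W)}"
      using z ker[of x] h.S.genideal_self[OF sub] by auto
  qed
  ultimately have 1: "S.span (J \<union> W) \<subseteq> {f. h f \<in> Idl\<^bsub>R\<^esub> (h ` W)}" by (intro S.span_minimal)
  have "ideal (S.span (J \<union> W)) mpoly_ring" by (simp add: ideal_mpoly_ring)
  then have "subgroup (S.span (J \<union> W)) (add_monoid mpoly_ring)"
    by (rule additive_subgroup.a_subgroup[OF ideal.axioms(1)])
  then have "subgroup (h ` S.span (J \<union> W)) (add_monoid R)" by (rule h.img_is_add_subgroup)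
  then have "ideal (h ` S.span (J \<union> W)) R"
  proof (rule idealI[OF h.S.ring_axioms])
    fix a x assume "a \<in> h ` S.span (J \<union> W)" "x \<in> carrier R"
    then obtain f c where f: "f \<in> S.span (J \<union> W)" "a = h f" "x = h c" using surj by blast
    have "x \<otimes>\<^bsub>R\<^esub> a = h (c * f)" "a \<otimes>\<^bsub>R\<^esub> x = h (c * f)"
      using h.hom_mult[of c f] h.hom_mult[of f c] f(2,3) by (simp_all add: mult.commute)
    moreover have "c * f \<in> S.span (J \<union> W)" using f(1) by (rule S.span_scale)
    ultimately show "x \<otimes>\<^bsub>R\<^esub> a \<in> h ` S.span (J \<union> W)" "a \<otimes>\<^bsub>R\<^esub> x \<in> h ` S.span (J \<union> W)" by simp_all
  qed
  moreover have "h ` W \<subseteq> h ` S.span (J \<union> W)" by (auto intro: S.span_base)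
  ultimately have 2: "Idl\<^bsub>R\<^esub> (h ` W) \<subseteq> h ` S.span (J \<union> W)" by (rule h.S.genideal_minimal)
  show ?thesis
  proof
    assume "h f \<in> Idl\<^bsub>R\<^esub> (h ` W)"
    then obtain g where g: "g \<in> S.span (J \<union> W)" "h f = h g" using 2 by blast
    have "h (f - g) \<oplus>\<^bsub>R\<^esub> h g = h g" using h.hom_add[of "f - g" g] g(2) by simp
    then have "h (f - g) = \<zero>\<^bsub>R\<^esub>"
      using h.S.add.r_cancel_one[of "h g" "h (f - g)"] h.hom_closed[of g] h.hom_closed[of "f - g"] by simp
    then have "f - g \<in> S.span (J \<union> W)" using ker S.span_base by blast
    then have "(f - g) + g \<in> S.span (J \<union> W)" using g(1) by (rule S.span_add)
    then show "f \<in> S.span (J \<union> W)" by simp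
  qed (use 1 in blast)
qed

text \<open>Lefschetz elements of the quotient lift to linear forms, and full rank depends on their
  classes only. The definition counts the forms from 1 and treats the first one apart; here they are
  counted from 0, and \<open>partial_ideal I w 0\<close> is I.\<close>

lemma has_k_SLP_quotient:
  fixes I :: "('n::finite, 'k::field) mpoly set"
  assumes I: "S.subspace I" and k: "1 \<le> k"
  shows "has_k_SLP k (mpoly_ring Quot I) (quotient_grading mpoly_ring I forms) \<longleftrightarrow>
    (\<exists>w. (\<forall>p<k. w p \<in> fm 1) \<and> (\<forall>p<k. \<forall>i. \<forall>s\<ge>1. full_rank (partial_ideal I w p) (w p) i s))"
proof -
  let ?S = "mpoly_ring :: ('n, 'k) mpoly ring"
  let ?R = "?S Quot I"
  define h where "h f = I +>\<^bsub>?S\<^esub> f" for f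
  have id: "ring_hom_ring ?S ?S (\<lambda>f. f)"
    using ring_mpoly_ring by (intro ring_hom_ringI2) (auto simp: Ring.ring_hom_def)
  have I': "ideal I ?S" using I by (simp add: ideal_mpoly_ring)
  have h: "ring_hom_ring ?S ?R h" and ker: "\<And>f. h f = \<zero>\<^bsub>?R\<^esub> \<longleftrightarrow> f \<in> I"
    using ring_hom_quotient[OF id I'] by (simp_all add: h_def[abs_def])
  have surj: "h ` UNIV = carrier ?R" by (auto simp: FactRing_def A_RCOSETS_def' h_def)
  have G: "quotient_grading ?S I forms = (\<lambda>d. h ` forms d)"
    by (simp add: quotient_grading_def h_def fun_eq_iff)
  have step1: "has_SLP ?R (\<lambda>d. h ` forms d) (h w) \<longleftrightarrow> (\<forall>i. \<forall>s\<ge>1. full_rank I w i s)" if "w \<in> forms 1" for w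
    by (rule has_SLP_quotient[OF h ker that])
  have step: "has_SLP (?R Quot (Idl\<^bsub>?R\<^esub> (h ` W)))
      (quotient_grading ?R (Idl\<^bsub>?R\<^esub> (h ` W)) (\<lambda>d. h ` forms d)) (Idl\<^bsub>?R\<^esub> (h ` W) +>\<^bsub>?R\<^esub> h w) \<longleftrightarrow>
      (\<forall>i. \<forall>s\<ge>1. full_rank (S.span (I \<union> W)) w i s)" if "w \<in> forms 1" for w W
  proof -
    let ?K = "Idl\<^bsub>?R\<^esub> (h ` W)"
    have "ring ?R" using h by (simp add: ring_hom_ring_def)
    then have K: "ideal ?K ?R" by (rule ring.genideal_ideal) (use surj in blast)
    have "quotient_grading ?R ?K (\<lambda>d. h ` forms d) = (\<lambda>d. (\<lambda>f. ?K +>\<^bsub>?R\<^esub> h f) ` forms d)"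
      by (simp add: quotient_grading_def fun_eq_iff image_image)
    moreover have "?K +>\<^bsub>?R\<^esub> h f = \<zero>\<^bsub>?R Quot ?K\<^esub> \<longleftrightarrow> f \<in> S.span (I \<union> W)" for f
      unfolding ring_hom_quotient(2)[OF h K] by (rule hom_mem_Idl[OF h surj ker I])
    ultimately show ?thesis
      using has_SLP_quotient[OF ring_hom_quotient(1)[OF h K] _ that] by simp
  qed
  show ?thesis
  proof
    assume "has_k_SLP k ?R (quotient_grading ?S I forms)"
    then obtain u where u: "\<forall>i\<in>{1..k}. u i \<in> h ` forms 1" "has_SLP ?R (\<lambda>d. h ` forms d) (u 1)"
      "\<forall>i\<in>{2..k}. has_SLP (?R Quot (Idl\<^bsub>?R\<^esub> (u ` {1..i-1})))
          (quotient_grading ?R (Idl\<^bsub>?R\<^esub> (u ` {1..i-1})) (\<lambda>d. h ` forms d)) (Idl\<^bsub>?R\<^esub> (u ` {1..i-1}) +>\<^bsub>?R\<^esub> u i)"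
      unfolding has_k_SLP_def G Let_def by (elim exE conjE)
    have "\<forall>i\<in>{1..k}. \<exists>f. f \<in> forms 1 \<and> u i = h f" using u(1) by auto
    from bchoice[OF this] obtain v where v: "\<forall>i\<in>{1..k}. v i \<in> forms 1 \<and> u i = h (v i)" by (elim exE)
    define w where "w p = v (Suc p)" for p
    have "full_rank (partial_ideal I w p) (w p) i s" if p: "p < k" and s: "s \<ge> 1" for p i s
    proof (cases p)
      case 0
      then show ?thesis
        using step1[of "v 1"] u(2) v k s p I by (simp add: partial_ideal_def w_def S.span_eq_iff[THEN iffD2])
    next
      case (Suc q)
      have img: "u ` {1..Suc p - 1} = h ` w ` {..<p}"
      proof -
        have "{1..Suc p - 1} = Suc ` {..<p}" by (auto simp: image_Suc_lessThan)
        then have "u ` {1..Suc p - 1} = (\<lambda>i. u (Suc i)) ` {..<p}" by (simp only: image_image)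
        also have "\<dots> = (\<lambda>i. h (w i)) ` {..<p}" by (rule image_cong) (use v p in \<open>auto simp: w_def\<close>)
        finally show ?thesis by (simp only: image_image)
      qed
      have "Suc p \<in> {2..k}" using Suc p by simp
      with u(3) have "has_SLP (?R Quot (Idl\<^bsub>?R\<^esub> (u ` {1..Suc p-1})))
          (quotient_grading ?R (Idl\<^bsub>?R\<^esub> (u ` {1..Suc p-1})) (\<lambda>d. h ` forms d)) (Idl\<^bsub>?R\<^esub> (u ` {1..Suc p-1}) +>\<^bsub>?R\<^esub> u (Suc p))"
        by blast
      moreover have "u (Suc p) = h (w p)" "w p \<in> forms 1" using v p by (auto simp: w_def)
      ultimately show ?thesis
        using step[of "w p" "w ` {..<p}"] s unfolding img partial_ideal_def by simp
    qed
    moreover have "w p \<in> fm 1" if "p < k" for p using v that by (simp add: w_def forms_eq_fm)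
    ultimately show "\<exists>w. (\<forall>p<k. w p \<in> fm 1) \<and> (\<forall>p<k. \<forall>i. \<forall>s\<ge>1. full_rank (partial_ideal I w p) (w p) i s)"
      by blast
  next
    assume "\<exists>w. (\<forall>p<k. w p \<in> fm 1) \<and> (\<forall>p<k. \<forall>i. \<forall>s\<ge>1. full_rank (partial_ideal I w p) (w p) i s)"
    then obtain w where w: "\<And>p. p < k \<Longrightarrow> w p \<in> fm 1"
      "\<And>p i s. p < k \<Longrightarrow> s \<ge> 1 \<Longrightarrow> full_rank (partial_ideal I w p) (w p) i s" by blast
    define u where "u i = h (w (i - 1))" for i
    have w1: "w p \<in> forms 1" if "p < k" for p using w(1)[OF that] by (simp add: forms_eq_fm)
    have "has_SLP ?R (\<lambda>d. h ` forms d) (u 1)"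
      using step1[OF w1[of 0]] w(2)[of 0] k I by (simp add: u_def partial_ideal_def S.span_eq_iff[THEN iffD2])
    moreover have "has_SLP (?R Quot (Idl\<^bsub>?R\<^esub> (u ` {1..i-1})))
          (quotient_grading ?R (Idl\<^bsub>?R\<^esub> (u ` {1..i-1})) (\<lambda>d. h ` forms d)) (Idl\<^bsub>?R\<^esub> (u ` {1..i-1}) +>\<^bsub>?R\<^esub> u i)"
      if i: "i \<in> {2..k}" for i
    proof -
      have img: "u ` {1..i-1} = h ` w ` {..<i-1}"
      proof -
        have "{1..i-1} = Suc ` {..<i-1}" by (auto simp: image_Suc_lessThan)
        then have "u ` {1..i-1} = (\<lambda>j. u (Suc j)) ` {..<i-1}" by (simp only: image_image)
        then show ?thesis by (simp add: u_def image_image)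
      qed
      have "i - 1 < k" using i by auto
      then show ?thesis
        using step[OF w1[of "i - 1"], of "w ` {..<i-1}"] w(2)[of "i - 1"]
        unfolding img partial_ideal_def by (simp add: u_def)
    qed
    moreover have "\<forall>i\<in>{1..k}. u i \<in> h ` forms 1" using w1 by (auto simp: u_def)
    ultimately show "has_k_SLP k ?R (quotient_grading ?S I forms)"
      unfolding has_k_SLP_def G Let_def by blast
  qed
qed

section \<open>Truncation\<close>

lemma ideal_hat_eq:
  fixes I :: "('n::finite, 'k::field) mpoly set"
  assumes "S.subspace I"
  shows "ideal_hat I = S.span (I \<union> min_degree_ge (nat (regularity I + 1)))"
proof -
  have *: "S.span I = I" "S.span (min_degree_ge e :: ('n, 'k) mpoly set) = min_degree_ge e" for e
    using assms subspace_min_degree_ge by (simp_all only: S.span_eq_iff)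
  show ?thesis
    unfolding ideal_hat_def irrelevant_ideal_power S.span_Un * by (auto simp: set_add_def')
qed

text \<open>In degree d of a sum f = g + h the summand h contributes nothing below the exponent;
  from the exponent on f itself lies in the power.\<close>

lemma hat_fm:
  fixes I :: "('n::finite, 'k::field) mpoly set"
  assumes I: "hom_ideal I" and w: "\<And>j. j < p \<Longrightarrow> w j \<in> fm 1" and f: "f \<in> fm (int d)"
  shows "f \<in> partial_ideal (ideal_hat I) w p \<longleftrightarrow> nat (regularity I + 1) \<le> d \<or> f \<in> partial_ideal I w p"
proof -
  let ?e = "nat (regularity I + 1)"
  have J: "hom_ideal (partial_ideal I w p)" by (rule hom_ideal_partial[OF I w])
  have "S.span (ideal_hat I \<union> w ` {..<p}) = S.span ((I \<union> w ` {..<p}) \<union> min_degree_ge ?e)"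
  proof -
    have "S.span (ideal_hat I \<union> w ` {..<p}) = S.span ((I \<union> min_degree_ge ?e) \<union> w ` {..<p})"
      unfolding ideal_hat_eq[OF hom_idealD(7)[OF I]] S.span_Un[of "S.span _"] S.span_span
        S.span_Un[of "I \<union> min_degree_ge ?e" "w ` {..<p}"] ..
    then show ?thesis by (simp only: Un_ac)
  qed
  moreover have "S.span (min_degree_ge ?e) = (min_degree_ge ?e :: ('n, 'k) mpoly set)"
    using subspace_min_degree_ge by (simp only: S.span_eq_iff)
  ultimately have "S.span (ideal_hat I \<union> w ` {..<p}) =
      {x + y |x y. x \<in> S.span (I \<union> w ` {..<p}) \<and> y \<in> min_degree_ge ?e}"
    by (simp only: S.span_Un[of "I \<union> w ` {..<p}"])
  then have "f \<in> partial_ideal (ideal_hat I) w p \<longleftrightarrow> (\<exists>g h. f = g + h \<and> g \<in> partial_ideal I w p \<and> h \<in> min_degree_ge ?e)"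
    unfolding partial_ideal_def by simp
  also have "\<dots> \<longleftrightarrow> ?e \<le> d \<or> f \<in> partial_ideal I w p"
  proof
    assume "\<exists>g h. f = g + h \<and> g \<in> partial_ideal I w p \<and> h \<in> min_degree_ge ?e"
    then obtain g h where gh: "f = g + h" "g \<in> partial_ideal I w p" "h \<in> min_degree_ge ?e" by blast
    show "?e \<le> d \<or> f \<in> partial_ideal I w p"
    proof (cases "?e \<le> d")
      case False
      have "hcomp (int d) h = 0"
        by (rule poly_mapping_eqI)
          (use gh(3) False in \<open>auto simp: lookup_hcomp min_degree_ge_def in_keys_iff\<close>)
      then have "f = hcomp (int d) g" using hcomp_fm[OF f, of "int d"] gh(1) by (simp add: hcomp_add)
      then show ?thesis using hom_idealD(6)[OF J gh(2)] by simp
    qed simp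
  next
    assume "?e \<le> d \<or> f \<in> partial_ideal I w p"
    then show "\<exists>g h. f = g + h \<and> g \<in> partial_ideal I w p \<and> h \<in> min_degree_ge ?e"
    proof
      assume "?e \<le> d"
      then have "f \<in> min_degree_ge ?e" using f by (auto simp: min_degree_ge_def fm_def)
      then show ?thesis using hom_idealD(1)[OF J] by (intro exI[of _ 0] exI[of _ f]) simp
    next
      assume "f \<in> partial_ideal I w p"
      then show ?thesis using S.subspace_0[OF subspace_min_degree_ge[of ?e]] by (intro exI[of _ f] exI[of _ 0]) simp
    qed
  qed
  finally show ?thesis .
qed

text \<open>If the target degree is truncated, the map is onto 0; otherwise source and target both
  lie below the truncation, where the two ideals agree.\<close>

lemma full_rank_hat:
  fixes I :: "('n::finite, 'k::field) mpoly set"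
  assumes I: "hom_ideal I" and w: "\<And>j. j \<le> p \<Longrightarrow> w j \<in> fm 1"
  shows "full_rank (partial_ideal (ideal_hat I) w p) (w p) i s \<longleftrightarrow>
    nat (regularity I + 1) \<le> i + s \<or> full_rank (partial_ideal I w p) (w p) i s"
proof -
  have mem: "f \<in> partial_ideal (ideal_hat I) w p \<longleftrightarrow> nat (regularity I + 1) \<le> d \<or> f \<in> partial_ideal I w p"
    if "f \<in> fm (int d)" for f d
    by (rule hat_fm[OF I _ that]) (use w in simp)
  have wp: "w p \<in> fm 1" using w by simp
  have diff: "g - w p ^ s * f \<in> fm (int (i + s))" if "g \<in> fm (int (i + s))" "f \<in> fm (int i)" for f g
    using that(1) power_fm[OF wp that(2)] by (rule fm_diff)
  show ?thesis
  proof (cases "nat (regularity I + 1) \<le> i + s")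
    case True
    have "\<forall>g\<in>fm (int (i + s)). \<exists>f\<in>fm (int i). g - w p ^ s * f \<in> partial_ideal (ideal_hat I) w p"
    proof
      fix g assume "g \<in> (fm (int (i + s)) :: ('n, 'k) mpoly set)"
      then show "\<exists>f\<in>fm (int i). g - w p ^ s * f \<in> partial_ideal (ideal_hat I) w p"
        using mem[OF diff[of g 0]] True by (intro bexI[of _ 0]) simp_all
    qed
    then show ?thesis using True unfolding full_rank_def by blast
  next
    case False
    then have i: "\<not> nat (regularity I + 1) \<le> i" by simp
    have "full_rank (partial_ideal (ideal_hat I) w p) (w p) i s \<longleftrightarrow> full_rank (partial_ideal I w p) (w p) i s"
      unfolding full_rank_def
      using mem[OF power_fm[OF wp]] mem[OF diff] mem[of _ i] False i by (simp cong: ball_cong bex_cong)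
    then show ?thesis using False by simp
  qed
qed

theorem theorem5p4:
  fixes I :: "('n::finite, 'k::field_char_0) mpoly set" and k :: nat
  assumes "homogeneous_ideal I"
    and "I \<noteq> {0}"
    and "1 \<le> k" and "k \<le> CARD('n)"
  shows "has_k_SLP k (mpoly_ring Quot I) (quotient_grading mpoly_ring I forms) \<longleftrightarrow>
         has_k_SLP k (mpoly_ring Quot ideal_hat I) (quotient_grading mpoly_ring (ideal_hat I) forms)"
proof -
  have I: "hom_ideal I" by (rule homogeneous_ideal_imp_hom_ideal[OF assms(1)])
  let ?N = "nat (regularity I + 1)"
  have "S.subspace (ideal_hat I)"
    unfolding ideal_hat_eq[OF hom_idealD(7)[OF I]] by (rule S.subspace_span)
  note slp = has_k_SLP_quotient[OF hom_idealD(7)[OF I] assms(3)] has_k_SLP_quotient[OF this assms(3)]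
  show ?thesis
    unfolding slp
  proof
    assume "\<exists>w. (\<forall>p<k. w p \<in> fm 1) \<and> (\<forall>p<k. \<forall>i. \<forall>s\<ge>1. full_rank (partial_ideal I w p) (w p) i s)"
    then obtain w where w: "\<And>p. p < k \<Longrightarrow> w p \<in> fm 1"
      "\<And>p i s. p < k \<Longrightarrow> s \<ge> 1 \<Longrightarrow> full_rank (partial_ideal I w p) (w p) i s" by blast
    have "full_rank (partial_ideal (ideal_hat I) w p) (w p) i s" if "p < k" "s \<ge> 1" for p i s
      using full_rank_hat[OF I, of p w i s] w that by simp
    then show "\<exists>w. (\<forall>p<k. w p \<in> fm 1) \<and> (\<forall>p<k. \<forall>i. \<forall>s\<ge>1. full_rank (partial_ideal (ideal_hat I) w p) (w p) i s)"
      using w(1) by blast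
  next
    assume "\<exists>w. (\<forall>p<k. w p \<in> fm 1) \<and> (\<forall>p<k. \<forall>i. \<forall>s\<ge>1. full_rank (partial_ideal (ideal_hat I) w p) (w p) i s)"
    then obtain w0 where w0: "\<And>p. p < k \<Longrightarrow> w0 p \<in> fm 1"
      "\<And>p i s. p < k \<Longrightarrow> s \<ge> 1 \<Longrightarrow> full_rank (partial_ideal (ideal_hat I) w0 p) (w0 p) i s" by blast
    \<comment> \<open>This is all that is retained of the given forms: full rank in degrees up to
      reg I.\<close>
    have fr: "full_rank (partial_ideal I w0 p) (w0 p) i s" if "p < k" "s \<ge> 1" "i + s < ?N" for p i s
      using full_rank_hat[OF I, of p w0 i s] w0 that by simp
    have "\<exists>w. (\<forall>p. w p \<in> fm 1) \<and>
      (\<forall>p<k. \<forall>i s. s \<ge> 1 \<longrightarrow> i + s < ?N \<longrightarrow> full_rank (partial_ideal I w p) (w p) i s) \<and>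
      (\<forall>p<CARD('n). w p \<notin> K.span (w ` {..<p}) \<and> almost_regular (partial_ideal I w p) (w p))"
      by (rule generic_tuple[where ?w0.0 = w0, OF I _ _ assms(4)]) (fact w0(1), fact fr)
    then obtain w where *: "(\<forall>p. w p \<in> fm 1) \<and>
      (\<forall>p<k. \<forall>i s. s \<ge> 1 \<longrightarrow> i + s < ?N \<longrightarrow> full_rank (partial_ideal I w p) (w p) i s) \<and>
      (\<forall>p<CARD('n). w p \<notin> K.span (w ` {..<p}) \<and> almost_regular (partial_ideal I w p) (w p))"
      by (elim exE)
    have w: "w p \<in> fm 1" for p using * by blast
    have "full_rank (partial_ideal I w p) (w p) i s" if p: "p < k" and s: "s \<ge> 1" for p i s
    proof (rule full_rank_all[OF hom_ideal_partial[OF I w] w _ _ s])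
      show "full_rank (partial_ideal I w p) (w p) i s" if "s \<ge> 1" "i + s < ?N" for i s
        using * p that by blast
      show "z \<in> partial_ideal I w p"
        if "d \<ge> regularity I" "z \<in> fm d" "w p * z \<in> partial_ideal I w p" for d z
        by (rule injective_from_regularity[OF I w _ _ _ that]) (use * p assms(4) in auto)
    qed
    then show "\<exists>w. (\<forall>p<k. w p \<in> fm 1) \<and> (\<forall>p<k. \<forall>i. \<forall>s\<ge>1. full_rank (partial_ideal I w p) (w p) i s)"
      using w by blast
  qed
qed

end
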